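(* Let $\Phi=\Phi_M+\Phi_G$ be the Poisson$+$Grid point process, let the fading variable $F$ be exponentially distributed with mean $1/\mu$, and let the path-loss function be $l(r)=(Ar)^\beta$ with $A>0$ and $\beta>2$. Then for every unit vector $\mathrm{d}\in\mathbb{R}^2$ the non-negative limit $$\kappa_{\mathrm{d}}=\lim_{t\to\infty}\frac{p(0,t\mathrm{d},\Phi)}{t}$$ exists $\mathbf{P}$-a.s. and is $\mathbf{P}$-a.s. finite. The convergence also holds in $L_1$.
   Context: Poisson$+$Grid process: $\Phi=\Phi_M+\Phi_G$ is the superposition of two independent point processes on $\mathbb{R}^2$, where $\Phi_M$ is a stationary Poisson process with finite positive intensity $\lambda_M$ and $\Phi_G=s\mathbb{Z}^2+U_G$, $s>0$, is a square grid randomly shifted by $U_G$ uniformly distributed in $[0,s]^2$. Marks. The points $X_i$ of $\Phi$ carry random marks: medium access indicators $e_i(n)$, $n\in\mathbb{Z}$, i.i.d. in $i$ and $n$, Bernoulli with $\mathbf{P}\{e=1\}=p=1-\mathbf{P}\{e=0\}$, $0<p<1$; noise powers $W_i(n)\ge 0$, i.i.d. in $i,n$, distributed as a generic variable $W$ with arbitrary distribution on $[0,\infty)$; fadings $F_{i,j}(n)\ge 0$, i.i.d. in $i,j,n$, distributed as $F$. Given $\Phi$, the three families are independent, with these laws. $l$ is the path-loss function and $T>0$ is a fixed threshold. Let $I_{i,j}(n)=\sum_{k\ne i:\,e_k(n)=1}F_{k,j}(n)/l(|X_k-X_j|)$ and, when $e_i(n)=1$, $e_j(n)=0$, $\mathrm{SINR}_{i,j}(n)=\dfrac{F_{i,j}(n)/l(|X_i-X_j|)}{W_j(n)+I_{i,j}(n)}$.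 Put $\delta_{i,j}(n)=\mathbf{1}(\mathrm{SINR}_{i,j}(n)\ge T)$ if $i\ne j$, $e_i(n)=1$, $e_j(n)=0$; $\delta_{i,i}(n)=1$; and $\delta_{i,j}(n)=0$ otherwise. The space-time SINR graph $\mathbb{G}$ is the directed graph with vertex set $\Phi\times\mathbb{Z}$ and a directed edge from $(X_i,n)$ to $(X_j,n+1)$ whenever $\delta_{i,j}(n)=1$. For $x\in\mathbb{R}^2$, $X(x)$ is the (a.s. unique) point of $\Phi$ closest to $x$. For $x,y\in\mathbb{R}^2$, $P(x,y,n)$ is the length (number of edges) of a shortest directed path of $\mathbb{G}$ from $(X(x),n)$ to the set $\{(X(y),n+l):l\in\{1,2,\ldots\}\}$, and $p(x,y,\Phi)=\mathbf{E}[P(x,y,0)\mid\Phi]$ (the letter $p$ with arguments denotes this function, without arguments the Bernoulli parameter). *)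

theory Defs
  imports "HOL-Probability.Probability"
begin

section \<open>Poisson process and randomly shifted grid\<close>

text \<open>
  A point process on the plane is a map \<^term>\<open>\<Psi> :: 'w \<Rightarrow> (real^2) set\<close> whose values are locally finite
  sets. The sigma-algebra that it generates on the underlying probability space is generated by the
  numbers of points in bounded Borel sets.
\<close>

definition process_algebra :: "'w measure \<Rightarrow> ('w \<Rightarrow> (real^2) set) \<Rightarrow> 'w measure" where
  "process_algebra M \<Psi> = sigma (space M)
     {{\<omega> \<in> space M. card (\<Psi> \<omega> \<inter> B) = k} | B k. B \<in> sets borel \<and> bounded B}"

definition indep_of_process ::
  "'w measure \<Rightarrow> ('w \<Rightarrow> (real^2) set) \<Rightarrow> 'b measure \<Rightarrow> ('w \<Rightarrow> 'b) \<Rightarrow> bool" where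
  "indep_of_process M \<Psi> N f \<longleftrightarrow> f \<in> M \<rightarrow>\<^sub>M N \<and>
     prob_space.indep_set M (sets (process_algebra M \<Psi>)) {f -` B \<inter> space M | B. B \<in> sets N}"

text \<open>The rate \<open>\<nu>\<bar>B\<bar>\<close> may vanish, which the library's Poisson distribution does not allow.\<close>

definition poisson_process :: "'w measure \<Rightarrow> real \<Rightarrow> ('w \<Rightarrow> (real^2) set) \<Rightarrow> bool" where
  "poisson_process M \<nu> \<Psi> \<longleftrightarrow>
     (\<forall>\<omega>\<in>space M. \<forall>B. bounded B \<longrightarrow> finite (\<Psi> \<omega> \<inter> B)) \<and>
     (\<forall>B\<in>sets borel. bounded B \<longrightarrow>
        (\<lambda>\<omega>. card (\<Psi> \<omega> \<inter> B)) \<in> M \<rightarrow>\<^sub>M count_space UNIV \<and>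
        (\<forall>k. measure M {\<omega> \<in> space M. card (\<Psi> \<omega> \<inter> B) = k}
               = (\<nu> * measure lborel B) ^ k / fact k * exp (- (\<nu> * measure lborel B)))) \<and>
     (\<forall>(B :: nat \<Rightarrow> (real^2) set) m.
        (\<forall>i<m. B i \<in> sets borel \<and> bounded (B i)) \<and> disjoint_family_on B {..<m} \<longrightarrow>
        prob_space.indep_vars M (\<lambda>_. count_space UNIV) (\<lambda>i \<omega>. card (\<Psi> \<omega> \<inter> B i)) {..<m})"

definition shifted_grid :: "real \<Rightarrow> real^2 \<Rightarrow> (real^2) set" where
  "shifted_grid s u = {s *\<^sub>R z + u | z. \<forall>i. z $ i \<in> \<int>}"

section \<open>The space-time SINR graph\<close>

text \<open>
  In this section \<open>X\<close> is an enumeration of a configuration of points and \<open>e\<close>, \<open>W\<close>, \<open>F\<close> are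
  realisations of the marks, with \<open>e (i, n)\<close> for \<open>e\<^sub>i(n) = 1\<close>. Powers are
  extended nonnegative reals, so that an infinite interference gives a zero ratio and a
  vanishing denominator an infinite one (for a positive numerator).
\<close>

definition interference ::
  "(real \<Rightarrow> real) \<Rightarrow> (nat \<Rightarrow> real^2) \<Rightarrow> (nat \<times> int \<Rightarrow> bool) \<Rightarrow> (nat \<times> nat \<times> int \<Rightarrow> real)
     \<Rightarrow> nat \<Rightarrow> nat \<Rightarrow> int \<Rightarrow> ennreal" where
  "interference l X e F i j n =
     (\<Sum>k. if k \<noteq> i \<and> e (k, n) then ennreal (F (k, j, n)) / ennreal (l (dist (X k) (X j))) else 0)"

definition sinr ::
  "(real \<Rightarrow> real) \<Rightarrow> (nat \<Rightarrow> real^2) \<Rightarrow> (nat \<times> int \<Rightarrow> bool) \<Rightarrow> (nat \<times> int \<Rightarrow> real)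
     \<Rightarrow> (nat \<times> nat \<times> int \<Rightarrow> real) \<Rightarrow> nat \<Rightarrow> nat \<Rightarrow> int \<Rightarrow> ennreal" where
  "sinr l X e W F i j n =
     (ennreal (F (i, j, n)) / ennreal (l (dist (X i) (X j))))
       / (ennreal (W (j, n)) + interference l X e F i j n)"

definition connected_at ::
  "(real \<Rightarrow> real) \<Rightarrow> real \<Rightarrow> (nat \<Rightarrow> real^2) \<Rightarrow> (nat \<times> int \<Rightarrow> bool) \<Rightarrow> (nat \<times> int \<Rightarrow> real)
     \<Rightarrow> (nat \<times> nat \<times> int \<Rightarrow> real) \<Rightarrow> nat \<Rightarrow> nat \<Rightarrow> int \<Rightarrow> bool" where
  "connected_at l T X e W F i j n \<longleftrightarrow>
     i = j \<or> (e (i, n) \<and> \<not> e (j, n) \<and> ennreal T \<le> sinr l X e W F i j n)"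

definition sinr_graph ::
  "(real \<Rightarrow> real) \<Rightarrow> real \<Rightarrow> (nat \<Rightarrow> real^2) \<Rightarrow> (nat \<times> int \<Rightarrow> bool) \<Rightarrow> (nat \<times> int \<Rightarrow> real)
     \<Rightarrow> (nat \<times> nat \<times> int \<Rightarrow> real) \<Rightarrow> (((real^2) \<times> int) \<times> ((real^2) \<times> int)) set" where
  "sinr_graph l T X e W F =
     {((X i, n), (X j, n + 1)) | i j n. connected_at l T X e W F i j n}"

text \<open>Ties, which have probability zero, go to the smallest index.\<close>

definition nearest :: "(nat \<Rightarrow> real^2) \<Rightarrow> real^2 \<Rightarrow> real^2" where
  "nearest X x = X (LEAST i. \<forall>j. dist x (X i) \<le> dist x (X j))"

text \<open>The infimum is \<open>\<infinity>\<close> if there is no path.\<close>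

definition path_delay ::
  "(real \<Rightarrow> real) \<Rightarrow> real \<Rightarrow> (nat \<Rightarrow> real^2) \<Rightarrow> (nat \<times> int \<Rightarrow> bool) \<Rightarrow> (nat \<times> int \<Rightarrow> real)
     \<Rightarrow> (nat \<times> nat \<times> int \<Rightarrow> real) \<Rightarrow> real^2 \<Rightarrow> real^2 \<Rightarrow> int \<Rightarrow> enat" where
  "path_delay l T X e W F x y n =
     (INF k \<in> {k. \<exists>h::nat. 1 \<le> h \<and>
        ((nearest X x, n), (nearest X y, n + int h)) \<in> sinr_graph l T X e W F ^^ k}. enat k)"

section \<open>Random marks and the conditional mean delay\<close>

definition marks_law ::
  "real \<Rightarrow> real measure \<Rightarrow> real measure \<Rightarrow>
     ((nat \<times> int \<Rightarrow> bool) \<times> (nat \<times> int \<Rightarrow> real) \<times> (nat \<times> nat \<times> int \<Rightarrow> real)) measure" where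
  "marks_law p \<W> \<F> =
     (\<Pi>\<^sub>M _\<in>UNIV. measure_pmf (bernoulli_pmf p)) \<Otimes>\<^sub>M (\<Pi>\<^sub>M _\<in>UNIV. \<W>) \<Otimes>\<^sub>M (\<Pi>\<^sub>M _\<in>UNIV. \<F>)"

text \<open>
  The conditional expectation of the delay at time \<open>0\<close> given the point process. The marks are
  independent of the points, so this is the expectation over the marks with the points held fixed.
  This version is defined simultaneously for all \<open>x\<close> and \<open>y\<close>, which matters for almost sure limits
  along a continuous parameter; the lemma \<open>mean_delay_eq_cond_exp\<close> relates it to the
  library's conditional expectation.
\<close>

definition mean_delay ::
  "'w measure \<Rightarrow> (real \<Rightarrow> real) \<Rightarrow> real \<Rightarrow> (nat \<Rightarrow> 'w \<Rightarrow> real^2) \<Rightarrow> ('w \<Rightarrow> nat \<times> int \<Rightarrow> bool)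
     \<Rightarrow> ('w \<Rightarrow> nat \<times> int \<Rightarrow> real) \<Rightarrow> ('w \<Rightarrow> nat \<times> nat \<times> int \<Rightarrow> real)
     \<Rightarrow> real^2 \<Rightarrow> real^2 \<Rightarrow> 'w \<Rightarrow> ennreal" where
  "mean_delay M l T X e W F x y \<omega> =
     (\<integral>\<^sup>+\<omega>'. ennreal_of_enat (path_delay l T (\<lambda>i. X i \<omega>) (e \<omega>') (W \<omega>') (F \<omega>') x y 0) \<partial>M)"

lemma relpow_sinr_graph_Suc:
  "((X a, n), (X b, m)) \<in> sinr_graph l T X e W F ^^ Suc k \<longleftrightarrow>
     (\<exists>c n'. ((X a, n), (X c, n')) \<in> sinr_graph l T X e W F ^^ k \<and>
             ((X c, n'), (X b, m)) \<in> sinr_graph l T X e W F)"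
  by (fastforce simp: sinr_graph_def)

lemma sinr_graph_iff:
  "((X a, n), (X b, m)) \<in> sinr_graph l T X e W F \<longleftrightarrow>
     m = n + 1 \<and> (\<exists>i j. X i = X a \<and> X j = X b \<and> connected_at l T X e W F i j n)"
  by (auto simp: sinr_graph_def) metis+

lemma path_delay_less:
  "path_delay l T X e W F x y n < enat N \<longleftrightarrow>
     (\<exists>k<N. \<exists>h::nat. 1 \<le> h \<and>
        ((nearest X x, n), (nearest X y, n + int h)) \<in> sinr_graph l T X e W F ^^ k)"
  by (auto simp: path_delay_def INF_less_iff)

context
  fixes S :: "'a measure" and X :: "'a \<Rightarrow> nat \<Rightarrow> real^2" and e :: "'a \<Rightarrow> nat \<times> int \<Rightarrow> bool"
    and W :: "'a \<Rightarrow> nat \<times> int \<Rightarrow> real" and F :: "'a \<Rightarrow> nat \<times> nat \<times> int \<Rightarrow> real"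
    and l :: "real \<Rightarrow> real"
  assumes [measurable]: "\<And>i. (\<lambda>a. X a i) \<in> borel_measurable S"
    "\<And>i. Measurable.pred S (\<lambda>a. e a i)" "\<And>i. (\<lambda>a. W a i) \<in> borel_measurable S"
    "\<And>i. (\<lambda>a. F a i) \<in> borel_measurable S" "l \<in> borel_measurable borel"
begin

lemma measurable_connected_at [measurable]:
  "Measurable.pred S (\<lambda>a. connected_at l T (X a) (e a) (W a) (F a) i j n)"
  unfolding connected_at_def sinr_def interference_def by measurable

lemma measurable_relpow_sinr_graph [measurable]:
  "Measurable.pred S
     (\<lambda>a. ((X a i, n), (X a j, m)) \<in> sinr_graph l T (X a) (e a) (W a) (F a) ^^ k)"
proof (induction k arbitrary: j m)
  case 0
  show ?case by simp
next
  case (Suc k)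
  note [measurable] = Suc.IH
  show ?case
    unfolding relpow_sinr_graph_Suc sinr_graph_iff by measurable
qed

lemma measurable_path_delay:
  "(\<lambda>a. ennreal_of_enat (path_delay l T (X a) (e a) (W a) (F a) x y n)) \<in> borel_measurable S"
proof -
  define J where "J z a = (LEAST i. \<forall>j. dist z (X a i) \<le> dist z (X a j))" for z a
  have J [measurable]: "J z \<in> S \<rightarrow>\<^sub>M count_space UNIV" for z
    unfolding J_def by measurable
  have less [measurable]:
    "Measurable.pred S (\<lambda>a. path_delay l T (X a) (e a) (W a) (F a) x y n < enat N)" for N
  proof -
    have "path_delay l T (X a) (e a) (W a) (F a) x y n < enat N \<longleftrightarrow>
        (\<exists>k<N. \<exists>h::nat. 1 \<le> h \<and> (\<exists>i j. J x a = i \<and> J y a = j \<and>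
           ((X a i, n), (X a j, n + int h)) \<in> sinr_graph l T (X a) (e a) (W a) (F a) ^^ k))" for a
      unfolding path_delay_less nearest_def J_def by simp
    then show ?thesis by (simp only:) measurable
  qed
  have eq: "(path_delay l T (X a) (e a) (W a) (F a) x y n = enat k) \<longleftrightarrow>
      path_delay l T (X a) (e a) (W a) (F a) x y n < enat (Suc k) \<and>
      \<not> path_delay l T (X a) (e a) (W a) (F a) x y n < enat k" for a k
    by (cases "path_delay l T (X a) (e a) (W a) (F a) x y n") auto
  have [measurable]: "Measurable.pred S (\<lambda>a. path_delay l T (X a) (e a) (W a) (F a) x y n = enat k)" for k
    unfolding eq by measurable
  have inf: "path_delay l T (X a) (e a) (W a) (F a) x y n = \<infinity> \<longleftrightarrow>
      (\<forall>k. path_delay l T (X a) (e a) (W a) (F a) x y n \<noteq> enat k)" for a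
    by (cases "path_delay l T (X a) (e a) (W a) (F a) x y n") auto
  have "Measurable.pred S (\<lambda>a. path_delay l T (X a) (e a) (W a) (F a) x y n = c)" for c
  proof (cases c)
    case (enat k)
    then show ?thesis by (simp only:) measurable
  next
    case infinity
    then show ?thesis unfolding infinity inf by measurable
  qed
  then have "(\<lambda>a. path_delay l T (X a) (e a) (W a) (F a) x y n) \<in> S \<rightarrow>\<^sub>M count_space UNIV"
    by (intro measurable_count_space_eq2_countable[THEN iffD2])
      (auto simp: pred_def vimage_def Int_def conj_commute)
  then show ?thesis
    by (rule measurable_compose) simp
qed

end

lemma mean_delay_eq_cond_exp:
  fixes M :: "'w measure" and X :: "nat \<Rightarrow> 'w \<Rightarrow> real^2"
  assumes "prob_space M"
    and X [measurable]: "\<And>i. X i \<in> borel_measurable (process_algebra M \<Phi>)"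
    and indep: "indep_of_process M \<Phi> (marks_law p \<W> \<F>) (\<lambda>\<omega>. (e \<omega>, W \<omega>, F \<omega>))"
    and sets_WF [measurable_cong]: "sets \<W> = sets borel" "sets \<F> = sets borel"
    and l [measurable]: "l \<in> borel_measurable borel"
  shows "(\<lambda>\<omega>. mean_delay M l T X e W F x y \<omega>) \<in> borel_measurable (process_algebra M \<Phi>)"
    and "AE \<omega> in M. mean_delay M l T X e W F x y \<omega> =
           nn_cond_exp M (process_algebra M \<Phi>)
             (\<lambda>\<omega>. ennreal_of_enat (path_delay l T (\<lambda>i. X i \<omega>) (e \<omega>) (W \<omega>) (F \<omega>) x y 0)) \<omega>"
proof -
  interpret prob_space M by fact
  let ?S = "process_algebra M \<Phi>" and ?K = "marks_law p \<W> \<F>"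
  let ?mk = "\<lambda>\<omega>. (e \<omega>, W \<omega>, F \<omega>)"
  define g where "g \<omega> m = ennreal_of_enat
    (path_delay l T (\<lambda>i. X i \<omega>) (fst m) (fst (snd m)) (snd (snd m)) x y 0)" for \<omega> m
  have space_S: "space ?S = space M" by (simp add: process_algebra_def space_measure_of_conv)
  have mk [measurable]: "?mk \<in> M \<rightarrow>\<^sub>M ?K"
    and ind: "indep_set (sets ?S) {?mk -` B \<inter> space M | B. B \<in> sets ?K}"
    using indep by (simp_all add: indep_of_process_def)
  have sets_S: "sets ?S \<subseteq> sets M"
    using indep_setD_ev1[OF ind] .
  have id [measurable]: "(\<lambda>\<omega>. \<omega>) \<in> M \<rightarrow>\<^sub>M ?S"
    using sets_S by (auto simp: measurable_def space_S dest: sets.sets_into_space)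
  have g [measurable]: "(\<lambda>z. g (fst z) (snd z)) \<in> borel_measurable (?S \<Otimes>\<^sub>M ?K)"
    unfolding g_def marks_law_def
    by (rule measurable_path_delay) measurable
  interpret K: prob_space "distr M ?K ?mk" by (rule prob_space_distr) simp
  interpret S: prob_space "distr M ?S (\<lambda>\<omega>. \<omega>)" by (rule prob_space_distr) simp
  interpret SK: pair_sigma_finite "distr M ?S (\<lambda>\<omega>. \<omega>)" "distr M ?K ?mk" ..
  have joint: "distr M ?S (\<lambda>\<omega>. \<omega>) \<Otimes>\<^sub>M distr M ?K ?mk = distr M (?S \<Otimes>\<^sub>M ?K) (\<lambda>\<omega>. (\<omega>, ?mk \<omega>))"
  proof (rule pair_measure_eqI)
    fix A B assume "A \<in> sets (distr M ?S (\<lambda>\<omega>. \<omega>))" "B \<in> sets (distr M ?K ?mk)"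
    then have [measurable]: "A \<in> sets ?S" "B \<in> sets ?K" by simp_all
    have A: "A \<inter> space M = A" using sets.sets_into_space[of A ?S] by (auto simp: space_S)
    have "prob (A \<inter> (?mk -` B \<inter> space M)) = prob A * prob (?mk -` B \<inter> space M)"
      by (rule indep_setD[OF ind]) auto
    moreover have "(\<lambda>\<omega>. (\<omega>, ?mk \<omega>)) -` (A \<times> B) \<inter> space M = A \<inter> (?mk -` B \<inter> space M)"
      using A by auto
    ultimately show "emeasure (distr M ?S (\<lambda>\<omega>. \<omega>)) A * emeasure (distr M ?K ?mk) B =
        emeasure (distr M (?S \<Otimes>\<^sub>M ?K) (\<lambda>\<omega>. (\<omega>, ?mk \<omega>))) (A \<times> B)"
      by (simp add: emeasure_distr emeasure_eq_measure ennreal_mult'[symmetric] A)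
  qed (simp_all add: K.sigma_finite_measure_axioms S.sigma_finite_measure_axioms)
  have mean: "mean_delay M l T X e W F x y \<omega> = (\<integral>\<^sup>+m. g \<omega> m \<partial>distr M ?K ?mk)"
    if "\<omega> \<in> space M" for \<omega>
  proof -
    have "\<omega> \<in> space ?S" using that by (simp add: process_algebra_def space_measure_of_conv)
    then have [measurable]: "g \<omega> \<in> borel_measurable ?K"
      using measurable_compose[OF measurable_Pair1' g, of \<omega>] by simp
    show ?thesis by (simp add: nn_integral_distr) (simp add: mean_delay_def g_def)
  qed
  have "(\<lambda>\<omega>. \<integral>\<^sup>+m. g \<omega> m \<partial>distr M ?K ?mk) \<in> borel_measurable ?S"
    by (rule K.borel_measurable_nn_integral) (use g in \<open>simp add: case_prod_beta'\<close>)
  then show meas: "(\<lambda>\<omega>. mean_delay M l T X e W F x y \<omega>) \<in> borel_measurable ?S"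
    by (rule measurable_cong[THEN iffD2, rotated]) (simp add: mean space_S)
  interpret finite_measure_subalgebra M ?S
    by unfold_locales (simp add: subalgebra_def space_S sets_S)
  have "(\<lambda>\<omega>. g \<omega> (?mk \<omega>)) \<in> borel_measurable M"
    using measurable_compose[OF measurable_Pair[OF id mk] g] by simp
  moreover have "(\<integral>\<^sup>+\<omega>\<in>A. g \<omega> (?mk \<omega>) \<partial>M) = (\<integral>\<^sup>+\<omega>\<in>A. mean_delay M l T X e W F x y \<omega> \<partial>M)"
    if [measurable]: "A \<in> sets ?S" for A
  proof -
    define h where "h z = g (fst z) (snd z) * indicator A (fst z)" for z
    have h [measurable]: "h \<in> borel_measurable (?S \<Otimes>\<^sub>M ?K)"
      unfolding h_def by measurable
    have "(\<integral>\<^sup>+\<omega>\<in>A. g \<omega> (?mk \<omega>) \<partial>M) = (\<integral>\<^sup>+z. h z \<partial>distr M (?S \<Otimes>\<^sub>M ?K) (\<lambda>\<omega>. (\<omega>, ?mk \<omega>)))"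
      by (subst nn_integral_distr) (auto simp: h_def)
    also have "\<dots> = (\<integral>\<^sup>+\<omega>. \<integral>\<^sup>+m. h (\<omega>, m) \<partial>distr M ?K ?mk \<partial>distr M ?S (\<lambda>\<omega>. \<omega>))"
      unfolding joint[symmetric] by (rule K.nn_integral_fst[symmetric]) simp
    also have "\<dots> = (\<integral>\<^sup>+\<omega>. \<integral>\<^sup>+m. h (\<omega>, m) \<partial>distr M ?K ?mk \<partial>M)"
      by (rule nn_integral_distr) (simp, rule K.borel_measurable_nn_integral, simp)
    also have "\<dots> = (\<integral>\<^sup>+\<omega>\<in>A. mean_delay M l T X e W F x y \<omega> \<partial>M)"
      by (rule nn_integral_cong) (simp add: mean h_def indicator_def)
    finally show ?thesis .
  qed
  ultimately show "AE \<omega> in M. mean_delay M l T X e W F x y \<omega> = nn_cond_exp M ?S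
      (\<lambda>\<omega>. ennreal_of_enat (path_delay l T (\<lambda>i. X i \<omega>) (e \<omega>) (W \<omega>) (F \<omega>) x y 0)) \<omega>"
    using nn_cond_exp_charact[of "\<lambda>\<omega>. g \<omega> (?mk \<omega>)" "mean_delay M l T X e W F x y"] meas
    by (simp add: g_def)
qed

end

theory Submission
  imports Defs
begin

text \<open>
The limit comes from the subadditive ergodic theorem: a delay from \<open>x\<close> to \<open>z\<close> is at most a delay from
\<open>x\<close> to \<open>y\<close> followed by one from \<open>y\<close> to \<open>z\<close>, and the configuration of points is stationary under
translation by \<open>d\<close>. In a lattice direction this translation is not ergodic for the shifted grid, which is
why the limit is a function of the configuration.

Subadditivity survives the passage to conditional means because the second part of the journey only
uses marks of time slots after the first arrival. These are independent of the first arrival and have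
the same law as the marks from time \<open>0\<close> on; the lemma \<open>mean_hops_triangle\<close> makes this precise by
splicing two independent families of marks at the arrival time.

The delay between nearest points is inconvenient in itself: it depends on how ties are broken, and
\<open>t\<close> runs through all reals. Both problems disappear with the worst mean delay \<open>max_hops\<close> between
a point within distance \<open>r\<close> of \<open>x\<close> and a point within distance \<open>r\<close> of \<open>y\<close>, where \<open>r\<close> is so large that
every such ball contains a point of the grid. It depends on the set of points only, it
commutes with translations, it is subadditive, and with \<open>n = \<lfloor>t\<rfloor>\<close> its value between \<open>0\<close> and
\<open>n d\<close> differs from the mean delay between the nearest points of \<open>0\<close> and \<open>t d\<close> by at most the two
values at \<open>(0, 0)\<close> and \<open>(n d, n d)\<close>. The latter form a stationary integrable sequence and are
therefore \<open>o(n)\<close>.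

Integrability is where the grid and \<open>\<beta> > 2\<close> enter. Thanks to the grid it suffices to bound the
mean waiting time for a direct transmission over a bounded distance, and this is the inverse of the
success probability in one slot. Success is implied by silence of the finitely many other near
points, moderate noise, moderate interference from the far points and a large fading variable. The
inverse of the probability of this event is at most exponential in the sum, over all points, of a
function that dominates the power \<open>-\<beta>\<close> of the distance from the origin (\<open>mean_hops_le_exp_decay\<close>). This
function is summable over a lattice, and a cell of side \<open>s\<close> contains one grid point and an independent
Poisson number of further points, whence the exponential of the sum is integrable (\<open>load_exp_moment\<close>).

Stationarity of the superposition (\<open>superposition_law_translate\<close>) combines the uniqueness of the law
of a Poisson process with the invariance of the uniform law on a cell under translations modulo the
lattice.
\<close>

section \<open>Subadditive processes over a measure-preserving map\<close>

lemma ratio_shift_tendsto: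
  fixes c :: real
  shows "(\<lambda>n. ereal (c / real (Suc n))) \<longlonglongrightarrow> 0"
proof -
  have "(\<lambda>n. c / real (Suc n)) \<longlonglongrightarrow> 0"
    using tendsto_mult[OF tendsto_const[of c] LIMSEQ_inverse_real_of_nat] by (simp add: field_simps)
  then show ?thesis by (simp add: zero_ereal_def del: of_nat_Suc)
qed

lemma ratio_shift_le:
  fixes a b :: "nat \<Rightarrow> real"
  assumes "\<And>n. a (Suc n) \<le> c + b n" and "\<And>n. 0 \<le> b n" "1 \<le> n"
  shows "ereal (a (Suc n) / real (Suc n)) \<le> ereal (c / real (Suc n)) + ereal (b n / n)"
proof -
  have "a (Suc n) / real (Suc n) \<le> (c + b n) / real (Suc n)" using assms(1)[of n] by (intro divide_right_mono) auto
  also have "\<dots> \<le> c / real (Suc n) + b n / n"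
    using assms by (auto simp: add_divide_distrib intro!: divide_left_mono)
  finally show ?thesis by simp
qed

text \<open>
Shifting the index by one and adding a constant does not affect the limit of ratios. This and
\<open>liminf_ratio_le\<close> make the limits along an orbit monotone.
\<close>

lemma limsup_ratio_le:
  fixes a b :: "nat \<Rightarrow> real"
  assumes "\<And>n. a (Suc n) \<le> c + b n" and "\<And>n. 0 \<le> b n"
  shows "limsup (\<lambda>n. ereal (a n / n)) \<le> limsup (\<lambda>n. ereal (b n / n))"
proof -
  have "limsup (\<lambda>n. ereal (a n / n)) = limsup (\<lambda>n. ereal (a (Suc n) / real (Suc n)))"
    using limsup_shift[of "\<lambda>n. ereal (a n / n)"] by simp
  also have "\<dots> \<le> limsup (\<lambda>n. ereal (c / real (Suc n)) + ereal (b n / n))"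
    by (rule Limsup_mono, rule eventually_mono[OF eventually_ge_at_top[of 1]], rule ratio_shift_le) (use assms in auto)
  also have "\<dots> = 0 + limsup (\<lambda>n. ereal (b n / n))"
    by (rule ereal_limsup_lim_add[OF ratio_shift_tendsto]) simp
  finally show ?thesis by simp
qed

lemma liminf_ratio_le:
  fixes a b :: "nat \<Rightarrow> real"
  assumes "\<And>n. a (Suc n) \<le> c + b n" and "\<And>n. 0 \<le> b n"
  shows "liminf (\<lambda>n. ereal (a n / n)) \<le> liminf (\<lambda>n. ereal (b n / n))"
proof -
  have "liminf (\<lambda>n. ereal (a n / n)) = liminf (\<lambda>n. ereal (a (Suc n) / real (Suc n)))"
    using liminf_shift[of "\<lambda>n. ereal (a n / n)"] by simp
  also have "\<dots> \<le> liminf (\<lambda>n. ereal (c / real (Suc n)) + ereal (b n / n))"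
    by (rule Liminf_mono, rule eventually_mono[OF eventually_ge_at_top[of 1]], rule ratio_shift_le) (use assms in auto)
  also have "\<dots> = 0 + liminf (\<lambda>n. ereal (b n / n))"
    by (rule ereal_liminf_lim_add[OF ratio_shift_tendsto]) simp
  finally show ?thesis by simp
qed

locale measure_preserving = prob_space +
  fixes T :: "'a \<Rightarrow> 'a"
  assumes T_measurable [measurable]: "T \<in> M \<rightarrow>\<^sub>M M"
    and distr_T: "distr M M T = M"
begin

lemma iterate_measurable [measurable]: "(T ^^ n) \<in> M \<rightarrow>\<^sub>M M"
proof (induction n)
  case (Suc n)
  show ?case using measurable_comp[OF Suc T_measurable] by simp
qed simp

lemma distr_iterate: "distr M M (T ^^ n) = M"
proof (induction n)
  case 0
  show ?case by (simp add: distr_id2 id_def)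
next
  case (Suc n)
  have "distr M M (T ^^ Suc n) = distr (distr M M (T ^^ n)) M T"
    by (simp add: distr_distr)
  also have "\<dots> = M" unfolding Suc by (rule distr_T)
  finally show ?case .
qed

lemma integral_iterate:
  fixes f :: "'a \<Rightarrow> real"
  assumes [measurable]: "f \<in> borel_measurable M"
  shows "(\<integral>x. f ((T ^^ n) x) \<partial>M) = (\<integral>x. f x \<partial>M)"
  by (subst (2) distr_iterate[of n, symmetric]) (simp add: integral_distr)

lemma nn_integral_iterate:
  assumes [measurable]: "f \<in> borel_measurable M"
  shows "(\<integral>\<^sup>+x. f ((T ^^ n) x) \<partial>M) = (\<integral>\<^sup>+x. f x \<partial>M)"
  by (subst (2) distr_iterate[of n, symmetric]) (simp add: nn_integral_distr)

lemma integrable_iterate: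
  fixes f :: "'a \<Rightarrow> real"
  assumes "integrable M f"
  shows "integrable M (\<lambda>x. f ((T ^^ n) x))"
proof -
  have "integrable (distr M M (T ^^ n)) f" using assms by (simp add: distr_iterate)
  then show ?thesis by (rule integrable_distr[rotated]) simp
qed

lemma AE_iterate:
  assumes "AE x in M. P x"
  shows "AE x in M. \<forall>n. P ((T ^^ n) x)"
proof -
  obtain N where N: "N \<in> null_sets M" "{x \<in> space M. \<not> P x} \<subseteq> N"
    using AE_E[OF assms] by (metis null_setsI)
  have "AE x in M. x \<notin> N" using N(1) by (rule AE_not_in)
  then have "AE x in distr M M (T ^^ n). x \<notin> N" for n unfolding distr_iterate .
  then have "AE x in M. (T ^^ n) x \<notin> N" for n by (rule AE_distrD[rotated]) simp
  then have "AE x in M. \<forall>n. (T ^^ n) x \<notin> N" by (simp add: AE_all_countable)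
  then show ?thesis
    using AE_space
  proof eventually_elim
    case (elim x)
    have "(T ^^ n) x \<in> space M" for n using measurable_space[OF iterate_measurable elim(2)] .
    then show ?case using N(2) elim(1) by blast
  qed
qed

text \<open>
\<open>\<phi> \<circ> T\<close> has the law of \<open>\<phi>\<close>, so that one cannot dominate the other without being equal. The bounded
transformation by \<open>arctan\<close> turns this into a comparison of finite integrals.
\<close>

lemma superinvariant_imp_invariant:
  fixes \<phi> :: "'a \<Rightarrow> real"
  assumes [measurable]: "\<phi> \<in> borel_measurable M" and le: "AE x in M. \<phi> x \<le> \<phi> (T x)"
  shows "AE x in M. \<forall>n. \<phi> ((T ^^ n) x) = \<phi> x"
proof -
  let ?\<psi> = "\<lambda>x. arctan (\<phi> x)"
  have [measurable]: "arctan \<in> borel_measurable borel"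
    by (intro borel_measurable_continuous_onI continuous_intros)
  have b: "\<bar>?\<psi> x\<bar> \<le> pi" for x
    using arctan_lbound[of "\<phi> x"] arctan_ubound[of "\<phi> x"] by linarith
  have int: "integrable M ?\<psi>" "integrable M (\<lambda>x. ?\<psi> (T x))"
    by (rule integrable_const_bound[where B=pi]; use b in simp)+
  have "(\<integral>x. ?\<psi> (T x) - ?\<psi> x \<partial>M) = 0"
    using integral_iterate[of ?\<psi> 1] int by (simp add: o_def)
  moreover have "AE x in M. 0 \<le> ?\<psi> (T x) - ?\<psi> x"
    using le by eventually_elim (simp add: arctan_le_iff)
  ultimately have "AE x in M. ?\<psi> (T x) - ?\<psi> x = 0"
    by (subst (asm) integral_nonneg_eq_0_iff_AE) (use int in auto)
  then have "AE x in M. \<phi> (T x) = \<phi> x"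
    by eventually_elim (simp add: arctan_eq_iff)
  then have "AE x in M. \<forall>n. \<phi> (T ((T ^^ n) x)) = \<phi> ((T ^^ n) x)" by (rule AE_iterate)
  then show ?thesis
  proof eventually_elim
    case (elim x)
    show ?case
    proof
      fix n show "\<phi> ((T ^^ n) x) = \<phi> x"
        by (induction n) (use elim in auto)
    qed
  qed
qed

text \<open>
Cut the orbit of \<open>x\<close> greedily into blocks. At a point outside \<open>B\<close> a block of length at most \<open>N\<close>
begins on which the average of \<open>g\<close> is at most \<open>\<phi>\<close>; at a point of \<open>B\<close> a single step is taken, which costs at
most \<open>h\<close>. Blocks are only started while more than \<open>N\<close> steps remain; the last \<open>N\<close> steps are
estimated by \<open>h\<close> one by one.
\<close>

lemma block_decomposition:
  fixes g :: "nat \<Rightarrow> 'a \<Rightarrow> real"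
  assumes sub: "\<And>i m n. 1 \<le> m \<Longrightarrow> 1 \<le> n \<Longrightarrow> g (m + n) ((T ^^ i) x) \<le> g m ((T ^^ i) x) + g n ((T ^^ (m + i)) x)"
    and g1: "\<And>i. g 1 ((T ^^ i) x) \<le> h ((T ^^ i) x)" and h: "\<And>i. 0 \<le> h ((T ^^ i) x)"
    and inv: "\<And>i. \<phi> ((T ^^ i) x) = \<phi> x"
    and good: "\<And>i. (T ^^ i) x \<notin> B \<Longrightarrow> \<exists>n. 1 \<le> n \<and> n \<le> N \<and> g n ((T ^^ i) x) \<le> n * \<phi> x"
    and K: "1 \<le> K"
  shows "g K x \<le> (\<Sum>i<K. \<phi> ((T ^^ i) x) + indicator B ((T ^^ i) x) * (h ((T ^^ i) x) + \<bar>\<phi> ((T ^^ i) x)\<bar>))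
       + (\<Sum>i\<in>{K-N..<K}. h ((T ^^ i) x) + \<bar>\<phi> ((T ^^ i) x)\<bar>)"
proof -
  let ?a = "\<lambda>i. \<phi> ((T ^^ i) x) + indicator B ((T ^^ i) x) * (h ((T ^^ i) x) + \<bar>\<phi> ((T ^^ i) x)\<bar>)"
  let ?b = "\<lambda>i. h ((T ^^ i) x) + \<bar>\<phi> ((T ^^ i) x)\<bar>"
  have b0: "0 \<le> ?b i" for i using h[of i] by simp
  have single: "g m ((T ^^ i) x) \<le> (\<Sum>k\<in>{i..<i+m}. h ((T ^^ k) x))" if "1 \<le> m" for m i
    using that
  proof (induction m arbitrary: i rule: nat_induct_at_least)
    case base then show ?case using g1[of i] by simp
  next
    case (Suc m)
    have "g (1 + m) ((T ^^ i) x) \<le> g 1 ((T ^^ i) x) + g m ((T ^^ (1 + i)) x)"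
      by (rule sub) (use Suc in auto)
    also have "\<dots> \<le> h ((T ^^ i) x) + (\<Sum>k\<in>{Suc i..<Suc i + m}. h ((T ^^ k) x))"
      using Suc.IH[of "Suc i"] g1[of i] by simp
    also have "\<dots> = (\<Sum>k\<in>{i..<i + Suc m}. h ((T ^^ k) x))"
      by (subst (2) sum.atLeast_Suc_lessThan) auto
    finally show ?case by simp
  qed
  have "g m ((T ^^ i) x) \<le> (\<Sum>k\<in>{i..<i+m}. ?a k) + (\<Sum>k\<in>{i+m-N..<i+m} \<inter> {i..}. ?b k)" if "1 \<le> m" for m i
    using that
  proof (induction m arbitrary: i rule: less_induct)
    case (less m)
    show ?case
    proof (cases "m \<le> N")
      case True
      then have "{i+m-N..<i+m} \<inter> {i..} = {i..<i+m}" by auto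
      then have "(\<Sum>k\<in>{i..<i+m}. ?a k) + (\<Sum>k\<in>{i+m-N..<i+m} \<inter> {i..}. ?b k) = (\<Sum>k\<in>{i..<i+m}. ?a k + ?b k)"
        by (simp only: sum.distrib)
      moreover have "(\<Sum>k\<in>{i..<i+m}. h ((T ^^ k) x)) \<le> (\<Sum>k\<in>{i..<i+m}. ?a k + ?b k)"
      proof (rule sum_mono)
        fix k
        have "0 \<le> indicator B ((T ^^ k) x) * ?b k" using b0 by simp
        then show "h ((T ^^ k) x) \<le> ?a k + ?b k" by linarith
      qed
      ultimately show ?thesis using single[OF less.prems, of i] by linarith
    next
      case False
      have step: ?thesis if "1 \<le> n" "n < m" and gn: "g n ((T ^^ i) x) \<le> (\<Sum>k\<in>{i..<i+n}. ?a k)" for n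
      proof -
        have "g (n + (m - n)) ((T ^^ i) x) \<le> g n ((T ^^ i) x) + g (m - n) ((T ^^ (n + i)) x)"
          by (rule sub) (use that in auto)
        moreover have "g (m - n) ((T ^^ (n + i)) x) \<le> (\<Sum>k\<in>{n+i..<n+i+(m-n)}. ?a k)
            + (\<Sum>k\<in>{n+i+(m-n)-N..<n+i+(m-n)} \<inter> {n+i..}. ?b k)"
          by (rule less.IH) (use that in auto)
        moreover have "n+i+(m-n) = i + m" using that by simp
        moreover have "(\<Sum>k\<in>{i+m-N..<i+m} \<inter> {n+i..}. ?b k) \<le> (\<Sum>k\<in>{i+m-N..<i+m} \<inter> {i..}. ?b k)"
          by (rule sum_mono2) (use b0 in auto)
        moreover have "(\<Sum>k\<in>{i..<i+n}. ?a k) + (\<Sum>k\<in>{n+i..<i+m}. ?a k) = (\<Sum>k\<in>{i..<i+m}. ?a k)"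
          using that by (subst add.commute[of n]) (simp add: sum.atLeastLessThan_concat)
        moreover have "n + (m - n) = m" using that by simp
        ultimately show ?thesis using gn by simp
      qed
      show ?thesis
      proof (cases "(T ^^ i) x \<in> B")
        case True
        show ?thesis
        proof (cases "m = 1")
          case True
          have "g 1 ((T ^^ i) x) \<le> ?a i" using g1[of i] \<open>(T ^^ i) x \<in> B\<close> by simp
          moreover have "0 \<le> (\<Sum>k\<in>{i+m-N..<i+m} \<inter> {i..}. ?b k)" by (rule sum_nonneg) (use b0 in auto)
          ultimately show ?thesis using True by simp
        next
          case False
          show ?thesis
            by (rule step[of 1]) (use False less.prems g1[of i] True in auto)
        qed
      next
        case nB: False
        then obtain n where n: "1 \<le> n" "n \<le> N" "g n ((T ^^ i) x) \<le> n * \<phi> x" using good by blast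
        have "n * \<phi> x = (\<Sum>k\<in>{i..<i+n}. \<phi> ((T ^^ k) x))" by (simp add: inv)
        also have "\<dots> \<le> (\<Sum>k\<in>{i..<i+n}. ?a k)"
          by (rule sum_mono) (use b0 in auto)
        finally show ?thesis using step[of n] n False by linarith
      qed
    qed
  qed
  from this[OF K, of 0] show ?thesis by (simp add: lessThan_atLeast0)
qed

text \<open>
This is the argument of Katznelson and Weiss. If almost every point starts a block on which
the average of \<open>g\<close> is at most the invariant function \<open>\<phi>\<close>, long orbit segments are covered by such blocks
up to a small proportion, and integration transfers the inequality to means. It is applied twice
below: to a subadditive process with \<open>\<phi>\<close> its lower limit, and to minus an additive process.
\<close>

lemma mean_le_of_good_blocks:
  fixes g :: "nat \<Rightarrow> 'a \<Rightarrow> real"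
  assumes g_int: "\<And>n. 1 \<le> n \<Longrightarrow> integrable M (g n)"
    and sub: "AE x in M. \<forall>m\<ge>1. \<forall>n\<ge>1. g (m + n) x \<le> g m x + g n ((T ^^ m) x)"
    and \<phi>: "integrable M \<phi>" and inv: "AE x in M. \<forall>n. \<phi> ((T ^^ n) x) = \<phi> x"
    and good: "AE x in M. \<exists>n\<ge>1. g n x \<le> n * \<phi> x"
    and low: "\<And>n. 1 \<le> n \<Longrightarrow> \<gamma> * n \<le> (\<integral>x. g n x \<partial>M)"
  shows "\<gamma> \<le> (\<integral>x. \<phi> x \<partial>M)"
proof (rule field_le_epsilon)
  fix \<delta> :: real assume \<delta>: "0 < \<delta>"
  define h where "h x = \<bar>g 1 x\<bar>" for x
  define b where "b x = h x + \<bar>\<phi> x\<bar>" for x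
  have [measurable]: "\<phi> \<in> borel_measurable M" using \<phi> by simp
  have gm[measurable]: "g (Suc n) \<in> borel_measurable M" for n using g_int[of "Suc n"] by auto
  have gm1[measurable]: "g n \<in> borel_measurable M" if "1 \<le> n" for n using g_int[OF that] by auto
  have b_int: "integrable M b" unfolding b_def h_def using g_int[of 1] \<phi> by auto
  have b_nonneg: "0 \<le> b x" for x by (simp add: b_def h_def)
  have [measurable]: "b \<in> borel_measurable M" using b_int by simp
  (* the points without a good block of length at most N; they carry a vanishing part of b as N grows *)
  define B where "B N = {x \<in> space M. \<forall>n<N. real (Suc n) * \<phi> x < g (Suc n) x}" for N :: nat
  have B_meas[measurable]: "B N \<in> sets M" for N
    unfolding B_def by measurable
  have "(\<lambda>N. \<integral>x. indicator (B N) x * b x \<partial>M) \<longlonglongrightarrow> (\<integral>x. 0 \<partial>M)"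
  proof (rule integral_dominated_convergence[where w=b])
    show "AE x in M. (\<lambda>N. indicator (B N) x * b x) \<longlonglongrightarrow> 0"
      using good
    proof eventually_elim
      case (elim x)
      then obtain n where n: "g (Suc n) x \<le> real (Suc n) * \<phi> x"
        by (metis One_nat_def Suc_le_D)
      have "\<forall>\<^sub>F N in sequentially. indicator (B N) x * b x = 0"
        using eventually_gt_at_top[of n]
        by eventually_elim (use n in \<open>force simp: B_def indicator_def\<close>)
      then show ?case by (rule tendsto_eventually)
    qed
    show "AE x in M. norm (indicator (B N) x * b x) \<le> b x" for N
      by (rule AE_I2) (simp add: indicator_def b_nonneg)
  qed (use b_int in auto)
  then have "\<forall>\<^sub>F N in sequentially. (\<integral>x. indicator (B N) x * b x \<partial>M) < \<delta> / 2"
    using \<delta> by (intro order_tendstoD(2)[where y=0]) auto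
  then obtain N where N: "(\<integral>x. indicator (B N) x * b x \<partial>M) < \<delta> / 2"
    by (auto simp: eventually_sequentially)
  (* so long that the last N steps do not matter in the mean *)
  obtain K :: nat where K: "real N * (\<integral>x. b x \<partial>M) * 2 / \<delta> < real K" using reals_Archimedean2 by blast
  have ib: "0 \<le> (\<integral>x. b x \<partial>M)" by (rule integral_nonneg_AE) (simp add: b_nonneg)
  have K1: "1 \<le> K"
  proof -
    have "0 \<le> real N * (\<integral>x. b x \<partial>M) * 2 / \<delta>" using ib \<delta> by simp
    then have "0 < real K" using K by linarith
    then show ?thesis by simp
  qed
  have ind_int: "integrable M (\<lambda>x. indicator (B N) x * b x)"
    by (rule Bochner_Integration.integrable_bound[OF b_int]) (auto simp: indicator_def b_nonneg)
  let ?R = "\<lambda>x. (\<Sum>i<K. \<phi> ((T ^^ i) x) + indicator (B N) ((T ^^ i) x) * b ((T ^^ i) x))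
       + (\<Sum>i\<in>{K-N..<K}. b ((T ^^ i) x))"
  have a_int: "integrable M (\<lambda>x. \<phi> x + indicator (B N) x * b x)" using \<phi> ind_int by auto
  note a_it = integrable_iterate[OF a_int] integrable_iterate[OF b_int]
  have "AE x in M. g K x \<le> ?R x"
    using AE_iterate[OF sub] inv AE_space
  proof eventually_elim
    case (elim x)
    have sp: "(T ^^ i) x \<in> space M" for i using measurable_space[OF iterate_measurable elim(3)] .
    show ?case unfolding b_def
    proof (rule block_decomposition)
      fix i m n :: nat assume "1 \<le> m" "1 \<le> n"
      then show "g (m + n) ((T ^^ i) x) \<le> g m ((T ^^ i) x) + g n ((T ^^ (m + i)) x)"
        using elim(1) by (simp add: funpow_add)
    next
      fix i assume "(T ^^ i) x \<notin> B N"
      then show "\<exists>n. 1 \<le> n \<and> n \<le> N \<and> g n ((T ^^ i) x) \<le> n * \<phi> x"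
        using sp[of i] elim(2) by (auto simp: B_def not_less simp del: of_nat_Suc) (metis Suc_leI le_add1 plus_1_eq_Suc One_nat_def)
    qed (use elim K1 in \<open>auto simp: h_def\<close>)
  qed
  then have "(\<integral>x. g K x \<partial>M) \<le> (\<integral>x. ?R x \<partial>M)"
    by (intro integral_mono_AE g_int K1) (use a_it in auto)
  also have "(\<integral>x. ?R x \<partial>M) = (\<Sum>i<K. \<integral>x. \<phi> x + indicator (B N) x * b x \<partial>M) + (\<Sum>i\<in>{K-N..<K}. \<integral>x. b x \<partial>M)"
  proof -
    have "(\<integral>x. ?R x \<partial>M) = (\<Sum>i<K. \<integral>x. \<phi> ((T ^^ i) x) + indicator (B N) ((T ^^ i) x) * b ((T ^^ i) x) \<partial>M)
       + (\<Sum>i\<in>{K-N..<K}. \<integral>x. b ((T ^^ i) x) \<partial>M)"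
      using a_it by (subst Bochner_Integration.integral_add) (auto intro!: Bochner_Integration.integrable_sum
           simp del: Bochner_Integration.integral_add)
    then show ?thesis
      by (simp add: integral_iterate[of "\<lambda>x. \<phi> x + indicator (B N) x * b x"] integral_iterate[of b] del: sum_constant)
  qed
  also have "\<dots> \<le> K * (\<integral>x. \<phi> x \<partial>M) + K * (\<delta> / 2) + N * (\<integral>x. b x \<partial>M)"
  proof -
    have "(\<integral>x. \<phi> x + indicator (B N) x * b x \<partial>M) = (\<integral>x. \<phi> x \<partial>M) + (\<integral>x. indicator (B N) x * b x \<partial>M)"
      using \<phi> ind_int by (rule Bochner_Integration.integral_add)
    moreover have "K * (\<integral>x. indicator (B N) x * b x \<partial>M) \<le> K * (\<delta> / 2)"
      by (rule mult_left_mono) (use N in auto)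
    moreover have "(\<Sum>i\<in>{K-N..<K}. \<integral>x. b x \<partial>M) \<le> N * (\<integral>x. b x \<partial>M)"
      using ib by (auto intro!: mult_right_mono)
    ultimately show ?thesis by (simp add: distrib_left)
  qed
  also have "N * (\<integral>x. b x \<partial>M) \<le> K * (\<delta> / 2)"
    using K \<delta> by (simp add: field_simps)
  finally have "\<gamma> * K \<le> K * (\<integral>x. \<phi> x \<partial>M) + K * \<delta>" using low[OF K1] by (simp add: mult.commute[of \<delta>])
  then have "K * \<gamma> \<le> K * ((\<integral>x. \<phi> x \<partial>M) + \<delta>)" by (simp add: algebra_simps)
  then show "\<gamma> \<le> (\<integral>x. \<phi> x \<partial>M) + \<delta>" using K1 by simp
qed


text \<open>
The half of Birkhoff's theorem that is needed for the upper limit. Wherever \<open>c\<close> is a truncation of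
the upper limit of the averages, blocks with average at least \<open>c - \<epsilon>\<close> exist, and \<open>f \<ge> 0\<close> allows to
ignore the steps outside the blocks.
\<close>

lemma additive_limsup_le:
  fixes f :: "'a \<Rightarrow> real"
  assumes f: "integrable M f" and f0: "\<And>x. 0 \<le> f x"
  shows "(\<integral>\<^sup>+x. e2ennreal (limsup (\<lambda>n. ereal ((\<Sum>i<n. f ((T ^^ i) x)) / n))) \<partial>M) \<le> ennreal (\<integral>x. f x \<partial>M)"
proof -
  have [measurable]: "f \<in> borel_measurable M" using f by simp
  define s where "s n x = (\<Sum>i<n. f ((T ^^ i) x))" for n x
  define L where "L x = limsup (\<lambda>n. ereal (s n x / n))" for x
  define Lc where "Lc c x = real_of_ereal (min (L x) (ereal (real c)))" for c :: nat and x
  have [measurable]: "s n \<in> borel_measurable M" for n unfolding s_def by measurable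
  have [measurable]: "L \<in> borel_measurable M" unfolding L_def by measurable
  have [measurable]: "Lc c \<in> borel_measurable M" for c unfolding Lc_def by measurable
  have s0: "0 \<le> s n x" for n x unfolding s_def by (intro sum_nonneg f0)
  have L0: "0 \<le> L x" for x
    unfolding L_def by (rule le_Limsup) (auto simp: s0)
  have Lc_ereal: "ereal (Lc c x) = min (L x) (ereal (real c))" for c x
    using L0[of x] by (cases "L x") (auto simp: Lc_def min_def)
  have Lc0: "0 \<le> Lc c x" and Lc_le: "Lc c x \<le> c" for c x
    using Lc_ereal[of c x] L0[of x] by (auto simp: min_def split: if_splits) (metis ereal_less_eq(3,5) of_nat_0_le_iff)+
  have Lc_int: "integrable M (Lc c)" for c
    by (rule integrable_const_bound[where B=c]) (use Lc0 Lc_le in auto)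
  have s_int: "integrable M (s n)" for n
    unfolding s_def by (intro Bochner_Integration.integrable_sum integrable_iterate f)
  have s_mean: "(\<integral>x. s n x \<partial>M) = n * (\<integral>x. f x \<partial>M)" for n
    unfolding s_def by (subst Bochner_Integration.integral_sum)
      (auto simp: integral_iterate intro!: integrable_iterate f)
  have s_add: "s (m + n) x = s m x + s n ((T ^^ m) x)" for m n x
  proof -
    have "s (m + n) x = s m x + (\<Sum>i\<in>{m..<m+n}. f ((T ^^ i) x))"
      unfolding s_def by (subst lessThan_atLeast0, subst sum.atLeastLessThan_concat[symmetric, of 0 m])
        (auto simp: lessThan_atLeast0)
    also have "(\<Sum>i\<in>{m..<m+n}. f ((T ^^ i) x)) = s n ((T ^^ m) x)"
      unfolding s_def by (rule sum.reindex_bij_witness[of _ "\<lambda>i. i + m" "\<lambda>i. i - m"])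
        (auto simp: funpow_add[symmetric] simp flip: comp_apply[of "_ ^^ _" "_ ^^ _"])
    finally show ?thesis .
  qed
  have "L x \<le> L (T x)" for x
    unfolding L_def
    by (rule limsup_ratio_le[where c="f x"]) (use s_add[of 1 _ x] s0 in \<open>simp_all add: s_def\<close>)
  then have "ereal (Lc c x) \<le> ereal (Lc c (T x))" for c x
    unfolding Lc_ereal by (meson min.mono order_refl)
  then have inv: "AE x in M. \<forall>n. Lc c ((T ^^ n) x) = Lc c x" for c
    by (intro superinvariant_imp_invariant) auto
  have key: "(\<integral>x. Lc c x \<partial>M) \<le> (\<integral>x. f x \<partial>M)" for c
  proof (rule field_le_epsilon)
    fix \<epsilon> :: real assume \<epsilon>: "0 < \<epsilon>"
    have "- (\<integral>x. f x \<partial>M) \<le> (\<integral>x. \<epsilon> - Lc c x \<partial>M)"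
    proof (rule mean_le_of_good_blocks[where g="\<lambda>n x. - s n x"])
      show "AE x in M. \<exists>n\<ge>1. - s n x \<le> n * (\<epsilon> - Lc c x)"
      proof (rule AE_I2)
        fix x
        have "ereal (Lc c x - \<epsilon>) < ereal (Lc c x)" using \<epsilon> by simp
        also have "\<dots> \<le> L x" by (simp add: Lc_ereal)
        finally have "\<exists>\<^sub>F n in sequentially. ereal (Lc c x - \<epsilon>) < ereal (s n x / n)"
          unfolding L_def frequently_def not_less by (metis Limsup_bounded linorder_not_less)
        then obtain n where "1 \<le> n" "Lc c x - \<epsilon> < s n x / n"
          unfolding frequently_sequentially by (metis less_ereal.simps(1))
        then show "\<exists>n\<ge>1. - s n x \<le> n * (\<epsilon> - Lc c x)"
          by (intro exI[of _ n]) (auto simp: field_simps)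
      qed
      show "AE x in M. \<forall>n. \<epsilon> - Lc c ((T ^^ n) x) = \<epsilon> - Lc c x" using inv by eventually_elim simp
    qed (use s_int Lc_int s_add s_mean in auto)
    then show "(\<integral>x. Lc c x \<partial>M) \<le> (\<integral>x. f x \<partial>M) + \<epsilon>"
      using Lc_int by (simp add: prob_space)
  qed
  have "e2ennreal (L x) = (SUP c. ennreal (Lc c x))" for x
  proof (cases "L x")
    case (real r)
    then have r: "0 \<le> r" using L0[of x] by simp
    obtain c :: nat where c: "r \<le> c" using real_arch_simple by blast
    have "Lc c' x \<le> r" for c' using Lc_ereal[of c' x] real by (metis ereal_less_eq(3) min.cobounded1)
    moreover have "Lc c x = r" using Lc_ereal[of c x] real c by (simp add: min_def)
    ultimately have "(SUP c. ennreal (Lc c x)) = ennreal r"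
      by (intro antisym SUP_least SUP_upper2[of c]) (auto intro: ennreal_leI)
    then show ?thesis using real by (simp add: e2ennreal_ereal)
  next
    case PInf
    then have "Lc c x = c" for c using Lc_ereal[of c x] by simp
    then show ?thesis using PInf by (simp add: ennreal_of_nat_eq_real_of_nat[symmetric] ennreal_SUP_of_nat_eq_top e2ennreal_infty)
  next
    case MInf
    then show ?thesis using L0[of x] by simp
  qed
  moreover have "(\<integral>\<^sup>+x. (SUP c. ennreal (Lc c x)) \<partial>M) = (SUP c. \<integral>\<^sup>+x. ennreal (Lc c x) \<partial>M)"
  proof (rule nn_integral_monotone_convergence_SUP)
    show "incseq (\<lambda>c x. ennreal (Lc c x))"
    proof (intro incseq_SucI le_funI ennreal_leI)
      fix c x
      have "ereal (Lc c x) \<le> ereal (Lc (Suc c) x)" unfolding Lc_ereal by (rule min.mono) auto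
      then show "Lc c x \<le> Lc (Suc c) x" by simp
    qed
  qed simp
  moreover have "(\<integral>\<^sup>+x. ennreal (Lc c x) \<partial>M) \<le> ennreal (\<integral>x. f x \<partial>M)" for c
    using key[of c] by (subst nn_integral_eq_integral[OF Lc_int]) (auto simp: Lc0 intro: ennreal_leI)
  ultimately show ?thesis unfolding L_def s_def by (simp add: SUP_least)
qed

text \<open>
By stationarity the probabilities of \<open>f (T\<^sup>n x) > \<epsilon> n\<close> sum up to at most the mean of \<open>f / \<epsilon>\<close>, and the
Borel--Cantelli lemma applies.
\<close>

lemma iterate_over_time_tendsto_0:
  fixes f :: "'a \<Rightarrow> real"
  assumes f: "integrable M f" and f0: "\<And>x. 0 \<le> f x"
  shows "AE x in M. (\<lambda>n. f ((T ^^ n) x) / n) \<longlonglongrightarrow> 0"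
proof -
  have [measurable]: "f \<in> borel_measurable M" using f by simp
  have "AE x in M. \<forall>\<^sub>F n in sequentially. f ((T ^^ n) x) \<le> Suc n / Suc k" for k :: nat
  proof -
    define A where "A n = {x \<in> space M. Suc n / Suc k < f ((T ^^ n) x)}" for n :: nat
    have [measurable]: "A n \<in> sets M" for n unfolding A_def by measurable
    have "summable (\<lambda>n. measure M (A n))"
    proof (rule summableI_nonneg_bounded)
      fix N
      have count: "(\<Sum>n<N. indicator {y. real (Suc n) < y} y) \<le> y" if "0 \<le> y" for y :: real
      proof -
        have "(\<Sum>n<N. indicator {y. real (Suc n) < y} y) = real (card {n. n < N \<and> real (Suc n) < y})"
          by (simp add: indicator_def sum.If_cases Int_def)
        also have "\<dots> \<le> real (card {..<nat \<lfloor>y\<rfloor>})"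
          by (intro of_nat_mono card_mono) (auto, linarith)
        also have "\<dots> \<le> y" using that by simp
        finally show ?thesis .
      qed
      have "measure M (A n) = (\<integral>x. indicator {y. real (Suc n) < y} (f x * Suc k) \<partial>M)" for n
      proof -
        have "measure M (A n) = (\<integral>x. indicator (A n) x \<partial>M)" by simp
        also have "\<dots> = (\<integral>x. indicator {y. real (Suc n) < y} (f ((T ^^ n) x) * Suc k) \<partial>M)"
          by (rule Bochner_Integration.integral_cong) (auto simp: A_def indicator_def field_simps)
        also have "\<dots> = (\<integral>x. indicator {y. real (Suc n) < y} (f x * Suc k) \<partial>M)"
          by (rule integral_iterate[of "\<lambda>x. indicator {y. real (Suc n) < y} (f x * Suc k)"]) measurable
        finally show ?thesis .
      qed
      then have "(\<Sum>n<N. measure M (A n)) = (\<Sum>n<N. \<integral>x. indicator {y. real (Suc n) < y} (f x * Suc k) \<partial>M)"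
        by simp
      also have "\<dots> = (\<integral>x. (\<Sum>n<N. indicator {y. real (Suc n) < y} (f x * Suc k)) \<partial>M)"
        by (rule Bochner_Integration.integral_sum[symmetric], rule integrable_const_bound[where B=1]) (auto simp: indicator_def)
      also have "\<dots> \<le> (\<integral>x. f x * Suc k \<partial>M)"
        by (rule integral_mono, intro Bochner_Integration.integrable_sum integrable_const_bound[where B=1])
           (use f f0 count in \<open>auto simp: indicator_def\<close>)
      finally show "(\<Sum>n<N. measure M (A n)) \<le> (\<integral>x. f x * Suc k \<partial>M)" .
    qed simp
    then have "AE x in M. \<forall>\<^sub>F n in sequentially. x \<in> space M - A n"
      by (intro borel_cantelli_AE1) (auto simp: emeasure_eq_measure)
    then show ?thesis
      by eventually_elim (auto simp: A_def not_less elim!: eventually_mono)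
  qed
  then have "AE x in M. \<forall>k::nat. \<forall>\<^sub>F n in sequentially. f ((T ^^ n) x) \<le> Suc n / Suc k"
    by (simp add: AE_all_countable)
  then show ?thesis
  proof eventually_elim
    case (elim x)
    show ?case
    proof (rule LIMSEQ_I)
      fix r :: real assume r: "0 < r"
      then obtain k :: nat where k: "2 / r < Suc k" using reals_Archimedean2 by (meson less_trans of_nat_less_iff lessI)
      have "\<forall>\<^sub>F n in sequentially. norm (f ((T ^^ n) x) / n - 0) < r"
        using elim[rule_format, of k] eventually_ge_at_top[of 1]
      proof eventually_elim
        case (elim n)
        have "f ((T ^^ n) x) \<le> (2 * n) / Suc k" using elim by (elim order_trans) (auto intro!: divide_right_mono)
        also have "\<dots> < r * n"
        proof -
          have "2 * real n < (r * Suc k) * n" using k r elim(2) by (intro mult_strict_right_mono) (auto simp: divide_less_eq mult.commute)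
          then show ?thesis by (simp add: divide_less_eq mult_ac del: of_nat_Suc)
        qed
        finally show ?case using elim(2) f0 by (simp add: field_simps)
      qed
      then show "\<exists>no. \<forall>n\<ge>no. norm (f ((T ^^ n) x) / n - 0) < r" by (simp add: eventually_sequentially)
    qed
  qed
qed


text \<open>
Division of the time \<open>K m + r\<close> by \<open>K\<close>: \<open>m\<close> blocks of length \<open>K\<close>, whose costs form an additive
process for \<open>T ^^ K\<close>, and \<open>r\<close> single steps.
\<close>

lemma subadditive_block_bound:
  fixes g :: "nat \<Rightarrow> 'a \<Rightarrow> real"
  assumes sub: "\<And>i m n. g (m + n) ((T ^^ i) x) \<le> g m ((T ^^ i) x) + g n ((T ^^ (m + i)) x)" and g0: "g 0 x = 0"
  shows "g (K * m + r) x \<le> (\<Sum>i<m. g K (((T ^^ K) ^^ i) x)) + (\<Sum>j\<in>{K*m..<K*m+r}. g 1 ((T ^^ j) x))"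
proof (induction r)
  case 0
  show ?case
  proof (induction m)
    case (Suc m)
    have "g (K * m + K) ((T ^^ 0) x) \<le> g (K * m) ((T ^^ 0) x) + g K ((T ^^ (K * m + 0)) x)" by (rule sub)
    then show ?case using Suc by (simp add: algebra_simps funpow_mult)
  qed (simp add: g0)
next
  case (Suc r)
  have "g (K * m + r + 1) ((T ^^ 0) x) \<le> g (K * m + r) ((T ^^ 0) x) + g 1 ((T ^^ (K * m + r + 0)) x)" by (rule sub)
  then show ?case using Suc by simp
qed

lemma measure_preserving_iterate: "measure_preserving M (T ^^ K)"
  by unfold_locales (simp_all add: distr_iterate)

text \<open>
Let \<open>\<gamma>\<close> be the infimum of the means of \<open>g n / n\<close>. Good blocks for the lower limit show that its mean is at
least \<open>\<gamma>\<close>. Comparison with the additive process of blocks of length \<open>K\<close> shows that the mean of the upper limit is at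
most the mean of \<open>g K / K\<close>, for every \<open>K\<close>, and hence at most \<open>\<gamma>\<close>. So both limits agree. Convergence of
the means together with almost sure convergence of nonnegative functions gives convergence in \<open>L\<^sub>1\<close>.
\<close>

theorem subadditive_ergodic:
  fixes g :: "nat \<Rightarrow> 'a \<Rightarrow> real"
  assumes g_int: "\<And>n. integrable M (g n)" and g_nonneg: "\<And>n x. 0 \<le> g n x" and g_0: "\<And>x. g 0 x = 0"
    and sub: "AE x in M. \<forall>m n. g (m + n) x \<le> g m x + g n ((T ^^ m) x)"
  shows "\<exists>\<kappa>. integrable M \<kappa> \<and> (\<forall>x. 0 \<le> \<kappa> x) \<and> (AE x in M. (\<lambda>n. g n x / n) \<longlonglongrightarrow> \<kappa> x) \<and>
    (\<lambda>n. \<integral>x. \<bar>g n x / n - \<kappa> x\<bar> \<partial>M) \<longlonglongrightarrow> 0"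
proof -
  have [measurable]: "g n \<in> borel_measurable M" for n using g_int[of n] by simp
  define lo where "lo x = liminf (\<lambda>n. ereal (g n x / n))" for x
  define up where "up x = limsup (\<lambda>n. ereal (g n x / n))" for x
  define \<kappa> where "\<kappa> x = real_of_ereal (lo x)" for x
  define a where "a n = (\<integral>x. g n x \<partial>M)" for n
  define \<gamma> where "\<gamma> = (INF n\<in>{1..}. a n / n)"
  have [measurable]: "lo \<in> borel_measurable M" "up \<in> borel_measurable M" unfolding lo_def up_def by measurable
  have [measurable]: "\<kappa> \<in> borel_measurable M" unfolding \<kappa>_def by measurable
  have lo0: "0 \<le> lo x" for x unfolding lo_def by (rule Liminf_bounded) (auto simp: g_nonneg)
  have lo_up: "lo x \<le> up x" for x unfolding lo_def up_def by (rule Liminf_le_Limsup) simp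
  have \<kappa>0: "0 \<le> \<kappa> x" for x using lo0[of x] by (simp add: \<kappa>_def real_of_ereal_pos)
  have a0: "0 \<le> a n" for n unfolding a_def by (intro integral_nonneg_AE AE_I2 g_nonneg)
  have bdd: "bdd_below ((\<lambda>n. a n / n) ` {1..})" by (rule bdd_belowI[of _ 0]) (auto simp: a0)
  have \<gamma>_le: "\<gamma> \<le> a n / n" if "1 \<le> n" for n unfolding \<gamma>_def by (rule cINF_lower[OF bdd]) (use that in auto)
  have block: "AE x in M. \<forall>K m r. g (K * m + r) x \<le> (\<Sum>i<m. g K (((T ^^ K) ^^ i) x)) + (\<Sum>j\<in>{K*m..<K*m+r}. g 1 ((T ^^ j) x))"
    using AE_iterate[OF sub]
  proof eventually_elim
    case (elim x)
    then show ?case by (intro allI subadditive_block_bound) (auto simp: g_0 funpow_add)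
  qed
  have a_block: "a (K * m + r) \<le> m * a K + r * a 1" for K m r
  proof -
    have "a (K * m + r) \<le> (\<integral>x. (\<Sum>i<m. g K (((T ^^ K) ^^ i) x)) + (\<Sum>j\<in>{K*m..<K*m+r}. g 1 ((T ^^ j) x)) \<partial>M)"
      unfolding a_def using block
      by (intro integral_mono_AE) (auto intro!: g_int integrable_iterate Bochner_Integration.integrable_sum
            Bochner_Integration.integrable_add simp: funpow_mult elim!: eventually_mono)
    also have "\<dots> = (\<Sum>i<m. \<integral>x. g K (((T ^^ K) ^^ i) x) \<partial>M) + (\<Sum>j\<in>{K*m..<K*m+r}. \<integral>x. g 1 ((T ^^ j) x) \<partial>M)"
      by (subst Bochner_Integration.integral_add) (auto intro!: g_int integrable_iterate Bochner_Integration.integrable_sum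
          Bochner_Integration.integral_sum arg_cong2[where f="(+)"] simp: funpow_mult)
    also have "\<dots> = m * a K + r * a 1"
      by (simp add: funpow_mult integral_iterate a_def)
    finally show ?thesis .
  qed
  have a_linear: "a n \<le> n * a 1" for n using a_block[of 0 0 n] by simp
  have lo_finite: "AE x in M. lo x \<noteq> \<infinity>"
  proof -
    have "(\<integral>\<^sup>+x. e2ennreal (lo x) \<partial>M) \<le> (\<integral>\<^sup>+x. liminf (\<lambda>n. ennreal (g n x / n)) \<partial>M)"
    proof (rule nn_integral_mono)
      fix x
      have "e2ennreal (lo x) = (SUP n. e2ennreal (INF k\<in>{n..}. ereal (g k x / k)))"
        unfolding lo_def liminf_SUP_INF
        by (rule sup_continuousD[OF sup_continuous_e2ennreal[OF sup_continuous_id], simplified])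
           (auto intro!: incseq_SucI INF_superset_mono)
      also have "\<dots> \<le> (SUP n. INF k\<in>{n..}. ennreal (g k x / k))"
        by (intro SUP_mono' INF_greatest) (auto simp: e2ennreal_ereal[symmetric] intro!: e2ennreal_mono INF_lower simp del: e2ennreal_ereal)
      finally show "e2ennreal (lo x) \<le> liminf (\<lambda>n. ennreal (g n x / n))" unfolding liminf_SUP_INF .
    qed
    also have "\<dots> \<le> liminf (\<lambda>n. \<integral>\<^sup>+x. ennreal (g n x / n) \<partial>M)"
      by (rule nn_integral_liminf) measurable
    also have "\<dots> \<le> liminf (\<lambda>n. ennreal (a 1))"
    proof (rule Liminf_mono, rule always_eventually, rule allI)
      fix n
      have "(\<integral>\<^sup>+x. ennreal (g n x / n) \<partial>M) = ennreal (a n / n)"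
        unfolding a_def by (subst nn_integral_eq_integral) (auto intro!: g_int simp: g_nonneg)
      also have "\<dots> \<le> ennreal (a 1)"
        using a_linear[of n] a0[of 1] by (cases "n = 0") (auto intro!: ennreal_leI simp: field_simps)
      finally show "(\<integral>\<^sup>+x. ennreal (g n x / n) \<partial>M) \<le> ennreal (a 1)" .
    qed
    also have "\<dots> < \<infinity>" by (simp add: Liminf_const)
    finally have "AE x in M. e2ennreal (lo x) \<noteq> \<infinity>" by (intro nn_integral_PInf_AE) auto
    then show ?thesis by eventually_elim (auto simp: e2ennreal_infty)
  qed
  then have lo_\<kappa>: "AE x in M. lo x = ereal (\<kappa> x)"
    by eventually_elim (use lo0 in \<open>force simp: \<kappa>_def ereal_real'\<close>)
  have up_int: "(\<integral>\<^sup>+x. e2ennreal (up x) \<partial>M) \<le> ennreal (a K / K)" if K: "1 \<le> K" for K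
  proof -
    interpret S: measure_preserving M "T ^^ K" by (rule measure_preserving_iterate)
    define F where "F x = limsup (\<lambda>m. ereal ((\<Sum>i<m. g K (((T ^^ K) ^^ i) x)) / m))" for x
    have [measurable]: "F \<in> borel_measurable M" unfolding F_def by measurable
    have F: "(\<integral>\<^sup>+x. e2ennreal (F x) \<partial>M) \<le> ennreal (a K)"
      unfolding F_def a_def by (rule S.additive_limsup_le[OF g_int]) (rule g_nonneg)
    have F0: "0 \<le> F x" for x unfolding F_def
      by (rule le_Limsup, simp, intro always_eventually allI) (simp add: g_nonneg sum_nonneg)
    have "AE x in M. up x \<le> F x / K"
      using block iterate_over_time_tendsto_0[OF g_int g_nonneg, of 1]
    proof eventually_elim
      case (elim x)
      (* fewer than K single steps remain, each of cost o(n) *)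
      have tail: "(\<lambda>n. (\<Sum>j\<in>{K*(n div K)..<n}. g 1 ((T ^^ j) x)) / n) \<longlonglongrightarrow> 0"
      proof (rule LIMSEQ_I)
        fix \<epsilon> :: real assume \<epsilon>: "0 < \<epsilon>"
        have "\<forall>\<^sub>F n in sequentially. g 1 ((T ^^ n) x) / n < \<epsilon> / (2 * K)"
          using elim(2) \<epsilon> K by (intro order_tendstoD(2)) auto
        then obtain J where J: "\<And>j. J \<le> j \<Longrightarrow> g 1 ((T ^^ j) x) / j < \<epsilon> / (2 * K)" by (auto simp: eventually_sequentially)
        have "norm ((\<Sum>j\<in>{K*(n div K)..<n}. g 1 ((T ^^ j) x)) / n - 0) < \<epsilon>" if n: "K * (J + 1) \<le> n" for n
        proof -
          have n0: "0 < n" using n K by (metis add_gr_0 less_le_trans mult_pos_pos zero_less_one Suc_le_eq One_nat_def)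
          have "J + 1 \<le> n div K" using n K by (metis div_le_mono nonzero_mult_div_cancel_left not_one_le_zero)
          then have "K * (J + 1) \<le> K * (n div K)" by (rule mult_le_mono2)
          moreover have "J + 1 \<le> K * (J + 1)" using mult_le_mono1[OF K, of "J + 1"] by simp
          ultimately have J': "J + 1 \<le> K * (n div K)" by linarith
          have "(\<Sum>j\<in>{K*(n div K)..<n}. g 1 ((T ^^ j) x)) \<le> (\<Sum>j\<in>{K*(n div K)..<n}. \<epsilon> / (2 * K) * n)"
          proof (rule sum_mono)
            fix j assume j: "j \<in> {K*(n div K)..<n}"
            then have "g 1 ((T ^^ j) x) / j < \<epsilon> / (2 * K)" using J' by (intro J) auto
            then have "g 1 ((T ^^ j) x) \<le> \<epsilon> / (2 * K) * j" using j J' by (simp add: divide_less_eq)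
            also have "\<dots> \<le> \<epsilon> / (2 * K) * n" using j \<epsilon> by (intro mult_left_mono) auto
            finally show "g 1 ((T ^^ j) x) \<le> \<epsilon> / (2 * K) * n" .
          qed
          also have "\<dots> = real (n mod K) * (\<epsilon> / (2 * K) * n)"
            by (simp add: minus_mult_div_eq_mod)
          also have "\<dots> \<le> real K * (\<epsilon> / (2 * K) * n)"
            using K \<epsilon> by (intro mult_right_mono) (auto intro: less_imp_le simp: mod_less_divisor)
          also have "\<dots> < \<epsilon> * n" using K \<epsilon> n0 by (simp add: field_simps)
          finally show ?thesis using n0 by (simp add: divide_less_eq abs_of_nonneg sum_nonneg g_nonneg)
        qed
        then show "\<exists>no. \<forall>n\<ge>no. norm ((\<Sum>j\<in>{K*(n div K)..<n}. g 1 ((T ^^ j) x)) / n - 0) < \<epsilon>" by blast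
      qed
      show ?case
      proof (cases "F x")
        case (real r)
        show ?thesis
        proof (rule ereal_le_epsilon2)
          fix \<delta> :: real assume "0 < \<delta>"
          define \<epsilon> where "\<epsilon> = \<delta> / 2"
          have \<epsilon>: "0 < \<epsilon>" and \<delta>: "\<delta> = 2 * \<epsilon>" using \<open>0 < \<delta>\<close> by (simp_all add: \<epsilon>_def)
          have "F x < ereal (r + \<epsilon>)" using real \<epsilon> by simp
          then have ev: "\<forall>\<^sub>F m in sequentially. ereal ((\<Sum>i<m. g K (((T ^^ K) ^^ i) x)) / m) < ereal (r + \<epsilon>)"
            unfolding F_def by (rule Limsup_lessD)
          have "filterlim (\<lambda>n. n div K) sequentially sequentially"
            unfolding filterlim_at_top
          proof
            fix Z
            show "\<forall>\<^sub>F n in sequentially. Z \<le> n div K"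
              using eventually_ge_at_top[of "Z * K"]
            proof eventually_elim
              case (elim n)
              have "Z * K div K \<le> n div K" using elim by (rule div_le_mono)
              then show ?case using K by simp
            qed
          qed
          then have "\<forall>\<^sub>F n in sequentially. ereal ((\<Sum>i<n div K. g K (((T ^^ K) ^^ i) x)) / (n div K)) < ereal (r + \<epsilon>)"
            by (rule eventually_compose_filterlim[OF ev])
          moreover have "\<forall>\<^sub>F n in sequentially. (\<Sum>j\<in>{K*(n div K)..<n}. g 1 ((T ^^ j) x)) / n < \<epsilon>"
            using tail \<epsilon> by (rule order_tendstoD)
          ultimately have "\<forall>\<^sub>F n in sequentially. ereal (g n x / n) \<le> ereal ((r + \<epsilon>) / K + \<epsilon>)"
            using eventually_ge_at_top[of K]
          proof eventually_elim
            case (elim n)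
            let ?m = "n div K"
            have m: "1 \<le> ?m" using elim K by (simp add: Suc_le_eq div_greater_zero_iff)
            have "g n x \<le> (\<Sum>i<?m. g K (((T ^^ K) ^^ i) x)) + (\<Sum>j\<in>{K*?m..<n}. g 1 ((T ^^ j) x))"
              using \<open>\<forall>K m r. _\<close>[rule_format, of K ?m "n mod K"] by simp
            also have "(\<Sum>i<?m. g K (((T ^^ K) ^^ i) x)) \<le> (r + \<epsilon>) * ?m" using elim(1) m by (simp add: divide_less_eq)
            also have "\<dots> \<le> (r + \<epsilon>) * (n / K)"
              using F0[of x] real \<epsilon> by (intro mult_left_mono of_nat_div_le_of_nat) auto
            also have "(\<Sum>j\<in>{K*?m..<n}. g 1 ((T ^^ j) x)) \<le> \<epsilon> * n" using elim(2,3) K by (simp add: divide_less_eq)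
            finally have "g n x \<le> ((r + \<epsilon>) / K + \<epsilon>) * n" by (simp add: distrib_right)
            then show ?case using elim(3) K by (simp add: divide_le_eq)
          qed
          then have "up x \<le> ereal ((r + \<epsilon>) / K + \<epsilon>)" unfolding up_def by (rule Limsup_bounded)
          also have "\<dots> \<le> ereal (r / K + 2 * \<epsilon>)"
          proof -
            have "\<epsilon> / K \<le> \<epsilon> / 1" using K \<epsilon> by (intro divide_left_mono) auto
            then show ?thesis by (simp add: add_divide_distrib)
          qed
          finally have "up x \<le> ereal (r / K + 2 * \<epsilon>)" .
          then show "up x \<le> F x / ereal (real K) + ereal \<delta>" using real K by (simp add: \<delta>)
        qed
      next
        case PInf
        then show ?thesis using K by simp
      next
        case MInf
        then show ?thesis using F0[of x] by simp
      qed
    qed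
    then have "(\<integral>\<^sup>+x. e2ennreal (up x) \<partial>M) \<le> (\<integral>\<^sup>+x. e2ennreal (F x) / ennreal K \<partial>M)"
    proof (intro nn_integral_mono_AE, eventually_elim)
      case (elim x)
      have "e2ennreal (up x) \<le> e2ennreal (F x / K)" by (rule e2ennreal_mono[OF elim(2)])
      also have "\<dots> = e2ennreal (F x) / ennreal K"
        using F0[of x] K by (cases "F x") (auto simp: divide_ennreal ennreal_top_divide e2ennreal_infty)
      finally show ?case .
    qed
    also have "\<dots> = (\<integral>\<^sup>+x. e2ennreal (F x) \<partial>M) / ennreal K" by (rule nn_integral_divide) simp
    also have "\<dots> \<le> ennreal (a K) / ennreal K" by (rule divide_right_mono_ennreal[OF F])
    also have "\<dots> = ennreal (a K / K)" using K a0 by (simp add: divide_ennreal)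
    finally show ?thesis .
  qed
  have \<kappa>_int: "integrable M \<kappa>"
  proof (rule integrableI_nonneg)
    have "(\<integral>\<^sup>+x. ennreal (\<kappa> x) \<partial>M) = (\<integral>\<^sup>+x. e2ennreal (lo x) \<partial>M)"
      using lo_\<kappa> by (intro nn_integral_cong_AE) (auto elim!: eventually_mono)
    also have "\<dots> \<le> (\<integral>\<^sup>+x. e2ennreal (up x) \<partial>M)" by (intro nn_integral_mono e2ennreal_mono lo_up)
    also have "\<dots> < \<infinity>" using up_int[of 1] by (rule order_le_less_trans) simp_all
    finally show "(\<integral>\<^sup>+x. ennreal (\<kappa> x) \<partial>M) < \<infinity>" .
  qed (use \<kappa>0 in auto)
  have lo_T: "AE x in M. lo x \<le> lo (T x)"
    using sub
  proof eventually_elim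
    case (elim x)
    show ?case unfolding lo_def
      by (rule liminf_ratio_le[where c="g 1 x"]) (use elim[rule_format, of 1] in \<open>auto simp: g_nonneg\<close>)
  qed
  have "AE x in M. \<kappa> x \<le> \<kappa> (T x)"
    using lo_T lo_\<kappa> AE_iterate[OF lo_\<kappa>]
  proof eventually_elim
    case (elim x)
    then show ?case using elim(3)[rule_format, of 1] by simp
  qed
  then have \<kappa>_inv: "AE x in M. \<forall>n. \<kappa> ((T ^^ n) x) = \<kappa> x" by (rule superinvariant_imp_invariant[rotated]) simp
  have \<gamma>_le_\<kappa>: "\<gamma> \<le> (\<integral>x. \<kappa> x \<partial>M)"
  proof (rule field_le_epsilon)
    fix \<epsilon> :: real assume \<epsilon>: "0 < \<epsilon>"
    have "\<gamma> \<le> (\<integral>x. \<kappa> x + \<epsilon> \<partial>M)"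
    proof (rule mean_le_of_good_blocks[where g=g])
      show "AE x in M. \<exists>n\<ge>1. g n x \<le> n * (\<kappa> x + \<epsilon>)"
        using lo_\<kappa>
      proof eventually_elim
        case (elim x)
        have "liminf (\<lambda>n. ereal (g n x / n)) < ereal (\<kappa> x + \<epsilon>)" using elim \<epsilon> by (simp add: lo_def)
        then have "\<exists>\<^sub>F n in sequentially. ereal (g n x / n) < ereal (\<kappa> x + \<epsilon>)"
          unfolding frequently_def not_less by (metis Liminf_bounded linorder_not_less)
        then obtain n where "1 \<le> n" "g n x / n < \<kappa> x + \<epsilon>"
          unfolding frequently_sequentially by (metis less_ereal.simps(1))
        then show ?case by (intro exI[of _ n]) (auto simp: field_simps)
      qed
      show "AE x in M. \<forall>n. \<kappa> ((T ^^ n) x) + \<epsilon> = \<kappa> x + \<epsilon>" using \<kappa>_inv by eventually_elim simp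
      show "AE x in M. \<forall>m\<ge>1. \<forall>n\<ge>1. g (m + n) x \<le> g m x + g n ((T ^^ m) x)" using sub by eventually_elim simp
    next
      fix n :: nat assume "1 \<le> n"
      then show "\<gamma> * n \<le> (\<integral>x. g n x \<partial>M)" using \<gamma>_le[of n] by (simp add: a_def field_simps)
    qed (use g_int \<kappa>_int in auto)
    then show "\<gamma> \<le> (\<integral>x. \<kappa> x \<partial>M) + \<epsilon>" using \<kappa>_int by (simp add: prob_space)
  qed
  have \<gamma>0: "0 \<le> \<gamma>" unfolding \<gamma>_def by (rule cINF_greatest) (auto simp: a0)
  have up_\<gamma>: "(\<integral>\<^sup>+x. e2ennreal (up x) \<partial>M) \<le> ennreal \<gamma>"
  proof (rule ennreal_le_epsilon)
    fix \<epsilon> :: real assume \<epsilon>: "0 < \<epsilon>"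
    have "\<exists>K\<in>{1..}. a K / K < \<gamma> + \<epsilon>"
      using cINF_less_iff[OF _ bdd, of "\<gamma> + \<epsilon>"] \<epsilon> by (auto simp: \<gamma>_def)
    then obtain K where "1 \<le> K" "a K / K < \<gamma> + \<epsilon>" by auto
    then show "(\<integral>\<^sup>+x. e2ennreal (up x) \<partial>M) \<le> ennreal \<gamma> + ennreal \<epsilon>"
      using up_int[of K] \<epsilon> \<gamma>0 by (auto intro: order_trans ennreal_leI simp flip: ennreal_plus)
  qed
  define u where "u x = real_of_ereal (up x)" for x
  have [measurable]: "u \<in> borel_measurable M" unfolding u_def by measurable
  have "AE x in M. e2ennreal (up x) \<noteq> \<infinity>"
    by (rule nn_integral_PInf_AE) (use up_\<gamma> in \<open>auto simp: top_unique\<close>)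
  then have up_u: "AE x in M. up x = ereal (u x)"
  proof eventually_elim
    case (elim x)
    then show ?case using lo0[of x] lo_up[of x] by (cases "up x") (auto simp: u_def e2ennreal_infty)
  qed
  have u0: "0 \<le> u x" for x using lo0[of x] lo_up[of x] by (simp add: u_def real_of_ereal_pos)
  have u_nn: "(\<integral>\<^sup>+x. ennreal (u x) \<partial>M) \<le> ennreal \<gamma>"
    using up_\<gamma> by (subst nn_integral_cong_AE[of _ "\<lambda>x. e2ennreal (up x)"]) (use up_u in \<open>auto elim!: eventually_mono\<close>)
  then have u_int: "integrable M u"
    by (intro integrableI_nonneg) (auto simp: u0 order_le_less_trans)
  have u_le: "(\<integral>x. u x \<partial>M) \<le> \<gamma>"
    using u_nn \<gamma>0 by (subst (asm) nn_integral_eq_integral[OF u_int]) (auto simp: u0)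
  have \<kappa>_le_u: "AE x in M. \<kappa> x \<le> u x"
    using lo_\<kappa> up_u
  proof eventually_elim
    case (elim x)
    then show ?case using lo_up[of x] by simp
  qed
  have \<kappa>_eq: "(\<integral>x. \<kappa> x \<partial>M) = \<gamma>"
    using integral_mono_AE[OF \<kappa>_int u_int \<kappa>_le_u] u_le \<gamma>_le_\<kappa> by linarith
  have "(\<integral>x. u x - \<kappa> x \<partial>M) = 0"
    using integral_mono_AE[OF \<kappa>_int u_int \<kappa>_le_u] u_le \<gamma>_le_\<kappa> u_int \<kappa>_int by simp
  then have "AE x in M. u x - \<kappa> x = 0"
    by (subst (asm) integral_nonneg_eq_0_iff_AE) (use u_int \<kappa>_int \<kappa>_le_u in auto)
  then have conv: "AE x in M. (\<lambda>n. g n x / n) \<longlonglongrightarrow> \<kappa> x"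
    using lo_\<kappa> up_u
  proof eventually_elim
    case (elim x)
    have "(\<lambda>n. ereal (g n x / n)) \<longlonglongrightarrow> ereal (\<kappa> x)"
      by (rule Liminf_eq_Limsup) (use elim in \<open>simp_all add: lo_def up_def\<close>)
    then show ?case by simp
  qed
  have a_lim: "(\<lambda>n. a n / n) \<longlonglongrightarrow> \<gamma>"
  proof (rule LIMSEQ_I)
    fix \<epsilon> :: real assume \<epsilon>: "0 < \<epsilon>"
    have "\<exists>K\<in>{1..}. a K / K < \<gamma> + \<epsilon> / 2"
      using cINF_less_iff[OF _ bdd, of "\<gamma> + \<epsilon> / 2"] \<epsilon> by (auto simp: \<gamma>_def)
    then obtain K where K: "1 \<le> K" "a K / K < \<gamma> + \<epsilon> / 2" by auto
    obtain n0 :: nat where n0: "K * a 1 * 2 / \<epsilon> < n0" using reals_Archimedean2 by blast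
    have "norm (a n / n - \<gamma>) < \<epsilon>" if n: "max 1 n0 \<le> n" for n
    proof -
      have "a n \<le> (n div K) * a K + (n mod K) * a 1" using a_block[of K "n div K" "n mod K"] by simp
      also have "(n div K) * a K \<le> n / K * a K"
        by (intro mult_right_mono a0 of_nat_div_le_of_nat)
      also have "(n mod K) * a 1 \<le> K * a 1" using K by (intro mult_right_mono a0) (auto intro: less_imp_le)
      also have "K * a 1 < n * \<epsilon> / 2"
        using n0 n \<epsilon> by (simp add: field_simps) (meson le_less_trans less_le_trans mult_le_cancel_left_pos of_nat_le_iff order_less_le_trans)
      also have "n / K * a K \<le> n * (\<gamma> + \<epsilon> / 2)"
        using mult_left_mono[OF less_imp_le[OF K(2)], of "real n"] by (simp add: field_simps)
      finally have "a n < n * (\<gamma> + \<epsilon>)" by (simp add: algebra_simps)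
      then have "a n / n < \<gamma> + \<epsilon>" using n by (simp add: field_simps)
      then show ?thesis using \<gamma>_le[of n] n by (simp add: abs_real_def)
    qed
    then show "\<exists>no. \<forall>n\<ge>no. norm (a n / n - \<gamma>) < \<epsilon>" by blast
  qed
  have "(\<lambda>n. \<integral>x. max 0 (\<kappa> x - g n x / n) \<partial>M) \<longlonglongrightarrow> (\<integral>x. 0 \<partial>M)"
  proof (rule integral_dominated_convergence[where w=\<kappa>])
    show "AE x in M. (\<lambda>n. max 0 (\<kappa> x - g n x / n)) \<longlonglongrightarrow> 0"
      using conv
    proof eventually_elim
      case (elim x)
      have "(\<lambda>n. max 0 (\<kappa> x - g n x / n)) \<longlonglongrightarrow> max 0 (\<kappa> x - \<kappa> x)" by (intro tendsto_intros elim)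
      then show ?case by simp
    qed
    show "AE x in M. norm (max 0 (\<kappa> x - g n x / n)) \<le> \<kappa> x" for n
      by (rule AE_I2) (use g_nonneg \<kappa>0 in auto)
  qed (use \<kappa>_int in auto)
  (* the absolute value is twice the negative part, which is dominated by \<kappa>, plus the difference *)
  then have "(\<lambda>n. 2 * (\<integral>x. max 0 (\<kappa> x - g n x / n) \<partial>M) + (a n / n - \<gamma>)) \<longlonglongrightarrow> 2 * 0 + (\<gamma> - \<gamma>)"
    by (intro tendsto_intros a_lim) simp
  moreover have "(\<integral>x. \<bar>g n x / n - \<kappa> x\<bar> \<partial>M) = 2 * (\<integral>x. max 0 (\<kappa> x - g n x / n) \<partial>M) + (a n / n - \<gamma>)" for n
  proof -
    have m: "integrable M (\<lambda>x. max 0 (\<kappa> x - g n x / n))"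
      by (intro integrable_max) (use g_int \<kappa>_int in auto)
    have "(\<integral>x. \<bar>g n x / n - \<kappa> x\<bar> \<partial>M) = (\<integral>x. 2 * max 0 (\<kappa> x - g n x / n) + (g n x / n - \<kappa> x) \<partial>M)"
      by (rule Bochner_Integration.integral_cong) (auto simp: max_def)
    also have "\<dots> = 2 * (\<integral>x. max 0 (\<kappa> x - g n x / n) \<partial>M) + (a n / n - \<gamma>)"
      using m g_int \<kappa>_int by (simp add: a_def \<kappa>_eq)
    finally show ?thesis .
  qed
  ultimately have "(\<lambda>n. \<integral>x. \<bar>g n x / n - \<kappa> x\<bar> \<partial>M) \<longlonglongrightarrow> 0" by simp
  then show ?thesis using \<kappa>_int \<kappa>0 conv by blast
qed

end

section \<open>Rearranging independent marks\<close>

text \<open>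
Reading coordinates of two independent copies of an i.i.d. family, no coordinate twice, produces
the same i.i.d. family. The choice of \<open>c\<close>, \<open>f\<close> and \<open>g\<close> covers concatenation in time,
permutation of indices, and the replacement of all coordinates but one.
\<close>

lemma distr_iid_rearrange:
  fixes N :: "'b measure" and f g :: "'i \<Rightarrow> 'j"
  assumes N: "prob_space N" and f: "inj_on f {i. c i}" and g: "inj_on g {i. \<not> c i}"
  defines "P \<equiv> (\<Pi>\<^sub>M _\<in>UNIV. N)" and "Q \<equiv> (\<Pi>\<^sub>M _\<in>UNIV. N)"
  shows "distr (P \<Otimes>\<^sub>M P) Q (\<lambda>(u, v) i. if c i then u (f i) else v (g i)) = Q"
proof (rule measure_eqI_PiM_infinite[symmetric, where I=UNIV and M="\<lambda>_. N"])
  interpret P: prob_space P unfolding P_def by (intro prob_space_PiM N)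
  interpret Q: prob_space Q unfolding Q_def by (intro prob_space_PiM N)
  let ?t = "\<lambda>(u, v) i. if c i then u (f i) else v (g i)"
  show "finite_measure Q" by unfold_locales
  have t: "?t \<in> P \<Otimes>\<^sub>M P \<rightarrow>\<^sub>M Q"
    unfolding Q_def P_def
  proof (rule measurable_PiM_single')
    fix i :: 'i
    show "(\<lambda>z. ?t z i) \<in> (\<Pi>\<^sub>M _\<in>UNIV. N) \<Otimes>\<^sub>M (\<Pi>\<^sub>M _\<in>UNIV. N) \<rightarrow>\<^sub>M N"
      by (cases "c i") (simp_all add: case_prod_beta')
  qed (auto simp: space_pair_measure space_PiM PiE_iff)
  fix A J assume J: "finite J" and A: "\<And>i::'i. i \<in> J \<Longrightarrow> A i \<in> sets N"
  let ?J1 = "{i\<in>J. c i}" and ?J2 = "{i\<in>J. \<not> c i}"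
  let ?A1 = "\<lambda>j. A (the_inv_into ?J1 f j)" and ?A2 = "\<lambda>j. A (the_inv_into ?J2 g j)"
  have f1: "inj_on f ?J1" and g1: "inj_on g ?J2" using f g by (auto intro: inj_on_subset)
  have A1: "?A1 (f i) = A i" if "i \<in> ?J1" for i using the_inv_into_f_f[OF f1 that] by simp
  have A2: "?A2 (g i) = A i" if "i \<in> ?J2" for i using the_inv_into_f_f[OF g1 that] by simp
  let ?X = "prod_emb UNIV (\<lambda>_. N) J (Pi\<^sub>E J A)"
  let ?X1 = "prod_emb UNIV (\<lambda>_. N) (f ` ?J1) (Pi\<^sub>E (f ` ?J1) ?A1)"
  let ?X2 = "prod_emb UNIV (\<lambda>_. N) (g ` ?J2) (Pi\<^sub>E (g ` ?J2) ?A2)"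
  have X: "?X \<in> sets Q" unfolding Q_def using J A by (intro sets_PiM_I) auto
  have X12: "?X1 \<in> sets P" "?X2 \<in> sets P" unfolding P_def using J A A1 A2 by (intro sets_PiM_I; auto)+
  have "?t -` ?X \<inter> space (P \<Otimes>\<^sub>M P) = ?X1 \<times> ?X2"
    using A1 A2
    by (fastforce simp: P_def prod_emb_def space_pair_measure space_PiM PiE_iff)
  then have "emeasure (distr (P \<Otimes>\<^sub>M P) Q ?t) ?X = emeasure P ?X1 * emeasure P ?X2"
    using X X12 t by (simp add: emeasure_distr P.emeasure_pair_measure_Times)
  also have "emeasure P ?X1 = (\<Prod>j\<in>f ` ?J1. emeasure N (?A1 j))"
    unfolding P_def by (rule emeasure_PiM_emb) (use J A A1 N in auto)
  also have "\<dots> = (\<Prod>i\<in>?J1. emeasure N (A i))"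
    by (subst prod.reindex[OF f1]) (use A1 in \<open>auto intro!: prod.cong\<close>)
  also have "emeasure P ?X2 = (\<Prod>j\<in>g ` ?J2. emeasure N (?A2 j))"
    unfolding P_def by (rule emeasure_PiM_emb) (use J A A2 N in auto)
  also have "\<dots> = (\<Prod>i\<in>?J2. emeasure N (A i))"
    by (subst prod.reindex[OF g1]) (use A2 in \<open>auto intro!: prod.cong\<close>)
  also have "(\<Prod>i\<in>?J1. emeasure N (A i)) * (\<Prod>i\<in>?J2. emeasure N (A i)) = (\<Prod>i\<in>?J1 \<union> ?J2. emeasure N (A i))"
    using J by (intro prod.union_disjoint[symmetric]) auto
  also have "?J1 \<union> ?J2 = J" by auto
  also have "(\<Prod>i\<in>J. emeasure N (A i)) = emeasure Q ?X"
    unfolding Q_def by (rule emeasure_PiM_emb[symmetric]) (use J A N in auto)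
  finally show "emeasure Q ?X = emeasure (distr (P \<Otimes>\<^sub>M P) Q ?t) ?X" ..
qed (simp_all add: Q_def)

lemma distr_pair_rearrange:
  assumes "prob_space P" "prob_space Q"
    and s [measurable]: "s \<in> P \<Otimes>\<^sub>M P \<rightarrow>\<^sub>M P" and t [measurable]: "t \<in> Q \<Otimes>\<^sub>M Q \<rightarrow>\<^sub>M Q"
    and ds: "distr (P \<Otimes>\<^sub>M P) P s = P" and dt: "distr (Q \<Otimes>\<^sub>M Q) Q t = Q"
  shows "distr ((P \<Otimes>\<^sub>M Q) \<Otimes>\<^sub>M (P \<Otimes>\<^sub>M Q)) (P \<Otimes>\<^sub>M Q)
     (\<lambda>z. (s (fst (fst z), fst (snd z)), t (snd (fst z), snd (snd z)))) = P \<Otimes>\<^sub>M Q"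
proof (rule pair_measure_eqI[symmetric])
  interpret P: prob_space P by fact
  interpret Q: prob_space Q by fact
  interpret PQ: pair_prob_space P Q ..
  show "sigma_finite_measure P" "sigma_finite_measure Q" by unfold_locales
  fix A B assume [measurable]: "A \<in> sets P" "B \<in> sets Q"
  let ?r = "\<lambda>z. (s (fst (fst z), fst (snd z)), t (snd (fst z), snd (snd z)))"
  let ?a = "\<lambda>a c. indicator A (s (a, c)) :: ennreal" and ?b = "\<lambda>b d. indicator B (t (b, d)) :: ennreal"
  have "emeasure (distr ((P \<Otimes>\<^sub>M Q) \<Otimes>\<^sub>M (P \<Otimes>\<^sub>M Q)) (P \<Otimes>\<^sub>M Q) ?r) (A \<times> B)
      = (\<integral>\<^sup>+z. indicator (A \<times> B) (?r z) \<partial>((P \<Otimes>\<^sub>M Q) \<Otimes>\<^sub>M (P \<Otimes>\<^sub>M Q)))"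
    by (subst nn_integral_distr[symmetric, where M'="P \<Otimes>\<^sub>M Q"]) auto
  also have "\<dots> = (\<integral>\<^sup>+x. \<integral>\<^sup>+y. ?a (fst x) (fst y) * ?b (snd x) (snd y) \<partial>(P \<Otimes>\<^sub>M Q) \<partial>(P \<Otimes>\<^sub>M Q))"
    by (subst PQ.nn_integral_fst[symmetric]) (auto intro!: nn_integral_cong simp: indicator_times)
  also have "\<dots> = (\<integral>\<^sup>+x. (\<integral>\<^sup>+c. ?a (fst x) c \<partial>P) * (\<integral>\<^sup>+d. ?b (snd x) d \<partial>Q) \<partial>(P \<Otimes>\<^sub>M Q))"
  proof (rule nn_integral_cong)
    fix x assume "x \<in> space (P \<Otimes>\<^sub>M Q)"
    then have [measurable]: "fst x \<in> space P" "snd x \<in> space Q" by (auto simp: space_pair_measure)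
    have "(\<integral>\<^sup>+y. ?a (fst x) (fst y) * ?b (snd x) (snd y) \<partial>(P \<Otimes>\<^sub>M Q)) = (\<integral>\<^sup>+c. \<integral>\<^sup>+d. ?a (fst x) c * ?b (snd x) d \<partial>Q \<partial>P)"
      by (subst Q.nn_integral_fst[symmetric]) auto
    also have "\<dots> = (\<integral>\<^sup>+c. ?a (fst x) c \<partial>P) * (\<integral>\<^sup>+d. ?b (snd x) d \<partial>Q)"
      by (simp add: nn_integral_cmult nn_integral_multc)
    finally show "(\<integral>\<^sup>+y. ?a (fst x) (fst y) * ?b (snd x) (snd y) \<partial>(P \<Otimes>\<^sub>M Q)) = (\<integral>\<^sup>+c. ?a (fst x) c \<partial>P) * (\<integral>\<^sup>+d. ?b (snd x) d \<partial>Q)" .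
  qed
  also have "\<dots> = (\<integral>\<^sup>+a. \<integral>\<^sup>+b. (\<integral>\<^sup>+c. ?a a c \<partial>P) * (\<integral>\<^sup>+d. ?b b d \<partial>Q) \<partial>Q \<partial>P)"
    by (subst Q.nn_integral_fst[symmetric]) auto
  also have "\<dots> = (\<integral>\<^sup>+a. \<integral>\<^sup>+c. ?a a c \<partial>P \<partial>P) * (\<integral>\<^sup>+b. \<integral>\<^sup>+d. ?b b d \<partial>Q \<partial>Q)"
    by (simp add: nn_integral_cmult nn_integral_multc)
  also have "(\<integral>\<^sup>+a. \<integral>\<^sup>+c. ?a a c \<partial>P \<partial>P) = emeasure (distr (P \<Otimes>\<^sub>M P) P s) A"
    by (subst P.nn_integral_fst) (auto simp: nn_integral_indicator[symmetric] nn_integral_distr simp del: nn_integral_indicator)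
  also have "(\<integral>\<^sup>+b. \<integral>\<^sup>+d. ?b b d \<partial>Q \<partial>Q) = emeasure (distr (Q \<Otimes>\<^sub>M Q) Q t) B"
    by (subst Q.nn_integral_fst) (auto simp: nn_integral_indicator[symmetric] nn_integral_distr simp del: nn_integral_indicator)
  finally show "emeasure P A * emeasure Q B = emeasure (distr ((P \<Otimes>\<^sub>M Q) \<Otimes>\<^sub>M (P \<Otimes>\<^sub>M Q)) (P \<Otimes>\<^sub>M Q) ?r) (A \<times> B)"
    unfolding ds dt ..
qed simp

type_synonym marks = "(nat \<times> int \<Rightarrow> bool) \<times> (nat \<times> int \<Rightarrow> real) \<times> (nat \<times> nat \<times> int \<Rightarrow> real)"

definition splice :: "('i \<Rightarrow> bool) \<Rightarrow> ('i \<Rightarrow> 'i) \<Rightarrow> ('i \<Rightarrow> 'i) \<Rightarrow> ('i \<Rightarrow> 'b) \<times> ('i \<Rightarrow> 'b) \<Rightarrow> 'i \<Rightarrow> 'b" where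
  "splice c f g = (\<lambda>(u, v) i. if c i then u (f i) else v (g i))"

lemma measurable_splice [measurable]:
  "splice c f g \<in> (\<Pi>\<^sub>M _\<in>UNIV. N) \<Otimes>\<^sub>M (\<Pi>\<^sub>M _\<in>UNIV. N) \<rightarrow>\<^sub>M (\<Pi>\<^sub>M _\<in>UNIV. N)"
  unfolding splice_def
proof (rule measurable_PiM_single')
  fix i
  show "(\<lambda>z. (case z of (u, v) \<Rightarrow> \<lambda>i. if c i then u (f i) else v (g i)) i) \<in> (\<Pi>\<^sub>M _\<in>UNIV. N) \<Otimes>\<^sub>M (\<Pi>\<^sub>M _\<in>UNIV. N) \<rightarrow>\<^sub>M N"
    by (cases "c i") (simp_all add: case_prod_beta')
qed (auto simp: space_pair_measure space_PiM PiE_iff)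

lemma distr_splice:
  assumes "prob_space N" "inj_on f {i. c i}" "inj_on g {i. \<not> c i}"
  shows "distr ((\<Pi>\<^sub>M _\<in>UNIV. N) \<Otimes>\<^sub>M (\<Pi>\<^sub>M _\<in>UNIV. N)) (\<Pi>\<^sub>M _\<in>UNIV. N) (splice c f g) = (\<Pi>\<^sub>M _\<in>UNIV. N)"
  unfolding splice_def by (rule distr_iid_rearrange) (use assms in auto)

text \<open>
The medium access indicators and the noise powers have the same index set, so that they share
\<open>c\<close>, \<open>f\<close> and \<open>g\<close>.
\<close>

definition splice_marks :: "(nat \<times> int \<Rightarrow> bool) \<Rightarrow> (nat \<times> int \<Rightarrow> nat \<times> int) \<Rightarrow> (nat \<times> int \<Rightarrow> nat \<times> int) \<Rightarrow>
   (nat \<times> nat \<times> int \<Rightarrow> bool) \<Rightarrow> (nat \<times> nat \<times> int \<Rightarrow> nat \<times> nat \<times> int) \<Rightarrow> (nat \<times> nat \<times> int \<Rightarrow> nat \<times> nat \<times> int) \<Rightarrow>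
   marks \<times> marks \<Rightarrow> marks" where
  "splice_marks c f g c' f' g' = (\<lambda>((e, W, F), (e', W', F')). (splice c f g (e, e'), splice c f g (W, W'), splice c' f' g' (F, F')))"

lemma distr_splice_marks:
  assumes "prob_space \<W>" "prob_space \<F>"
    and "inj_on f {i. c i}" "inj_on g {i. \<not> c i}" "inj_on f' {i. c' i}" "inj_on g' {i. \<not> c' i}"
  shows "distr (marks_law p \<W> \<F> \<Otimes>\<^sub>M marks_law p \<W> \<F>) (marks_law p \<W> \<F>) (splice_marks c f g c' f' g') = marks_law p \<W> \<F>"
proof -
  let ?E = "\<Pi>\<^sub>M _\<in>(UNIV :: (nat \<times> int) set). measure_pmf (bernoulli_pmf p)"
  let ?W = "\<Pi>\<^sub>M _\<in>(UNIV :: (nat \<times> int) set). \<W>" and ?F = "\<Pi>\<^sub>M _\<in>(UNIV :: (nat \<times> nat \<times> int) set). \<F>"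
  have E: "prob_space ?E" and W: "prob_space ?W" and F: "prob_space ?F"
    using assms by (auto intro!: prob_space_PiM prob_space_measure_pmf)
  have WF: "prob_space (?W \<Otimes>\<^sub>M ?F)" using W F by (rule prob_space_pair)
  have dWF: "distr ((?W \<Otimes>\<^sub>M ?F) \<Otimes>\<^sub>M (?W \<Otimes>\<^sub>M ?F)) (?W \<Otimes>\<^sub>M ?F)
     (\<lambda>z. (splice c f g (fst (fst z), fst (snd z)), splice c' f' g' (snd (fst z), snd (snd z)))) = ?W \<Otimes>\<^sub>M ?F"
    by (rule distr_pair_rearrange[OF W F]) (use assms in \<open>simp_all add: distr_splice\<close>)
  have m: "(\<lambda>z. (splice c f g (fst (fst z), fst (snd z)), splice c' f' g' (snd (fst z), snd (snd z)))) \<in>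
      (?W \<Otimes>\<^sub>M ?F) \<Otimes>\<^sub>M (?W \<Otimes>\<^sub>M ?F) \<rightarrow>\<^sub>M ?W \<Otimes>\<^sub>M ?F"
    by measurable
  have "distr ((?E \<Otimes>\<^sub>M (?W \<Otimes>\<^sub>M ?F)) \<Otimes>\<^sub>M (?E \<Otimes>\<^sub>M (?W \<Otimes>\<^sub>M ?F))) (?E \<Otimes>\<^sub>M (?W \<Otimes>\<^sub>M ?F))
     (\<lambda>z. (splice c f g (fst (fst z), fst (snd z)), (\<lambda>z. (splice c f g (fst (fst z), fst (snd z)), splice c' f' g' (snd (fst z), snd (snd z)))) (snd (fst z), snd (snd z))))
      = ?E \<Otimes>\<^sub>M (?W \<Otimes>\<^sub>M ?F)"
    by (rule distr_pair_rearrange[OF E WF _ m _ dWF]) (use assms in \<open>simp_all add: distr_splice prob_space_measure_pmf\<close>)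
  then show ?thesis
    unfolding marks_law_def splice_marks_def by (simp add: case_prod_beta')
qed

section \<open>Paths between indexed points\<close>

definition conn :: "(real \<Rightarrow> real) \<Rightarrow> real \<Rightarrow> (nat \<Rightarrow> real^2) \<Rightarrow> marks \<Rightarrow> nat \<Rightarrow> nat \<Rightarrow> int \<Rightarrow> bool" where
  "conn l T X mk i j n = connected_at l T X (fst mk) (fst (snd mk)) (snd (snd mk)) i j n"

text \<open>
Paths are described by indices instead of points; the duration of a path is its number of edges,
since every edge of the graph advances time by one.
\<close>

primrec hop :: "(real \<Rightarrow> real) \<Rightarrow> real \<Rightarrow> (nat \<Rightarrow> real^2) \<Rightarrow> marks \<Rightarrow> int \<Rightarrow> nat \<Rightarrow> nat \<Rightarrow> nat \<Rightarrow> bool" where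
  "hop l T X mk n 0 i j \<longleftrightarrow> i = j"
| "hop l T X mk n (Suc k) i j \<longleftrightarrow> (\<exists>m. hop l T X mk n k i m \<and> conn l T X mk m j (n + int k))"

definition delay :: "(real \<Rightarrow> real) \<Rightarrow> real \<Rightarrow> (nat \<Rightarrow> real^2) \<Rightarrow> marks \<Rightarrow> int \<Rightarrow> nat \<Rightarrow> nat \<Rightarrow> ennreal" where
  "delay l T X mk n i j = (INF k. if 1 \<le> k \<and> hop l T X mk n k i j then of_nat k else \<infinity>)"

lemma conn_refl: "conn l T X mk i i n"
  by (simp add: conn_def connected_at_def)

text \<open>
A vertex may wait, because every point is connected to itself at all times.
\<close>

lemma hop_mono: "hop l T X mk n k i j \<Longrightarrow> k \<le> m \<Longrightarrow> hop l T X mk n m i j"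
proof -
  assume h: "hop l T X mk n k i j" and "k \<le> m"
  from this(2) show ?thesis
    by (induction rule: dec_induct) (use h in \<open>auto intro!: exI[of _ j] conn_refl\<close>)
qed

lemma hop_stay: "hop l T X mk n k i i"
  using hop_mono[of l T X mk n 0 i i k] by simp

lemma hop_trans:
  "hop l T X mk n k i j \<Longrightarrow> hop l T X mk (n + int k) m j a \<Longrightarrow> hop l T X mk n (k + m) i a"
  by (induction m arbitrary: a) (auto simp: algebra_simps)

lemma delay_le: "1 \<le> k \<Longrightarrow> hop l T X mk n k i j \<Longrightarrow> delay l T X mk n i j \<le> of_nat k"
  unfolding delay_def by (rule INF_lower2[of k]) auto

lemma delay_cases:
  obtains k where "1 \<le> k" "hop l T X mk n k i j" "\<And>m. 1 \<le> m \<Longrightarrow> m < k \<Longrightarrow> \<not> hop l T X mk n m i j" "delay l T X mk n i j = of_nat k"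
  | "\<And>k. 1 \<le> k \<Longrightarrow> \<not> hop l T X mk n k i j" "delay l T X mk n i j = \<infinity>"
proof (cases "\<exists>k. 1 \<le> k \<and> hop l T X mk n k i j")
  case True
  define k where "k = (LEAST k. 1 \<le> k \<and> hop l T X mk n k i j)"
  have k: "1 \<le> k" "hop l T X mk n k i j" using LeastI_ex[OF True] by (simp_all add: k_def)
  have min: "k \<le> m" if "1 \<le> m" "hop l T X mk n m i j" for m
    unfolding k_def by (rule Least_le) (use that in simp)
  have "delay l T X mk n i j = of_nat k"
    unfolding delay_def by (intro antisym INF_lower2[of k] INF_greatest) (use k min in auto)
  then show ?thesis using that(1)[of k] k min by force
next
  case False
  then show ?thesis using that(2) by (auto simp: delay_def)
qed

lemma delay_trans:
  assumes "1 \<le> k" "hop l T X mk n k i j"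
  shows "delay l T X mk n i a \<le> of_nat k + delay l T X mk (n + int k) j a"
proof (cases rule: delay_cases[of l T X mk "n + int k" j a])
  case (1 m)
  then have "delay l T X mk n i a \<le> of_nat (k + m)"
    using hop_trans[OF assms(2) 1(2)] assms(1) by (intro delay_le) auto
  then show ?thesis using 1 by simp
qed simp

lemma delay_self: "delay l T X mk n i i = 1"
proof (rule antisym)
  show "delay l T X mk n i i \<le> 1" using delay_le[OF order_refl hop_stay, of l T X mk n i] by simp
  show "1 \<le> delay l T X mk n i i"
    unfolding delay_def by (rule INF_greatest) (use of_nat_mono[of 1] in force)
qed

section \<open>Relation with the graph\<close>

lemma relpow_sinr_graph_iff_hop:
  assumes "inj X"
  shows "((X i, n), (X j, m)) \<in> sinr_graph l T X e W F ^^ k \<longleftrightarrow> m = n + int k \<and> hop l T X (e, W, F) n k i j"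
proof (induction k arbitrary: j m)
  case 0
  show ?case using assms by (auto simp: inj_eq)
next
  case (Suc k)
  show ?case
    unfolding relpow_sinr_graph_Suc Suc sinr_graph_iff hop.simps conn_def fst_conv snd_conv
    by (auto simp: inj_eq[OF assms])
qed

lemma path_delay_eq_delay:
  assumes "inj X" "nearest X x = X i" "nearest X y = X j"
  shows "ennreal_of_enat (path_delay l T X e W F x y n) = delay l T X (e, W, F) n i j"
proof -
  let ?S = "{k. 1 \<le> k \<and> hop l T X (e, W, F) n k i j}"
  have "{k. \<exists>h::nat. 1 \<le> h \<and> ((nearest X x, n), (nearest X y, n + int h)) \<in> sinr_graph l T X e W F ^^ k} = ?S"
    unfolding assms(2,3) relpow_sinr_graph_iff_hop[OF assms(1)] by auto
  then have pd: "path_delay l T X e W F x y n = (INF k\<in>?S. enat k)" unfolding path_delay_def by simp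
  show ?thesis
  proof (cases rule: delay_cases[of l T X "(e, W, F)" n i j])
    case (1 k)
    have "(INF k\<in>?S. enat k) = enat k"
      by (intro antisym INF_lower2[of k] INF_greatest) (use 1 in \<open>auto simp: not_less[symmetric]\<close>)
    then show ?thesis using 1 pd by simp
  next
    case 2
    then have S: "?S = {}" by auto
    show ?thesis unfolding pd S 2(2) by (simp add: top_enat_def)
  qed
qed

section \<open>Measurability\<close>

lemma measurable_conn [measurable (raw)]:
  assumes "\<And>i. (\<lambda>a. X a i) \<in> borel_measurable S" "l \<in> borel_measurable borel"
    and "mk \<in> S \<rightarrow>\<^sub>M marks_law p \<W> \<F>" and sets: "sets \<W> = sets borel" "sets \<F> = sets borel"
  shows "Measurable.pred S (\<lambda>a. conn l T (X a) (mk a) i j n)"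
proof -
  note [measurable_cong] = sets
  note m = assms(3)[unfolded marks_law_def] and component = measurable_compose[OF _ measurable_component_singleton[OF UNIV_I]]
  have e: "(\<lambda>a. fst (mk a) i) \<in> S \<rightarrow>\<^sub>M count_space UNIV" for i
    using component[OF measurable_compose[OF m measurable_fst]] by simp
  have W: "(\<lambda>a. fst (snd (mk a)) i) \<in> S \<rightarrow>\<^sub>M \<W>" for i
    by (rule component[OF measurable_compose[OF measurable_compose[OF m measurable_snd] measurable_fst]])
  have F: "(\<lambda>a. snd (snd (mk a)) i) \<in> S \<rightarrow>\<^sub>M \<F>" for i
    by (rule component[OF measurable_compose[OF measurable_compose[OF m measurable_snd] measurable_snd]])
  show ?thesis unfolding conn_def
    by (rule measurable_connected_at) (use assms(1,2) e W F in \<open>simp_all add: pred_def measurable_cong_sets[OF refl sets(1)] measurable_cong_sets[OF refl sets(2)]\<close>)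
qed

lemma measurable_hop [measurable (raw)]:
  assumes "\<And>i. (\<lambda>a. X a i) \<in> borel_measurable S" "l \<in> borel_measurable borel"
    and "mk \<in> S \<rightarrow>\<^sub>M marks_law p \<W> \<F>" and sets: "sets \<W> = sets borel" "sets \<F> = sets borel"
  shows "Measurable.pred S (\<lambda>a. hop l T (X a) (mk a) n k i j)"
proof (induction k arbitrary: j)
  case (Suc k)
  note [measurable] = Suc measurable_conn[OF assms]
  show ?case by simp
qed simp

lemma measurable_delay [measurable (raw)]:
  assumes "\<And>i. (\<lambda>a. X a i) \<in> borel_measurable S" "l \<in> borel_measurable borel"
    and "mk \<in> S \<rightarrow>\<^sub>M marks_law p \<W> \<F>" and sets: "sets \<W> = sets borel" "sets \<F> = sets borel"
  shows "(\<lambda>a. delay l T (X a) (mk a) n i j) \<in> borel_measurable S"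
proof -
  note [measurable] = measurable_hop[OF assms]
  show ?thesis unfolding delay_def by measurable
qed

section \<open>Splicing marks\<close>

text \<open>
Marks of the first family before time \<open>k\<close>, followed by those of the second family from their time
\<open>0\<close> on.
\<close>

definition splice_time :: "nat \<Rightarrow> marks \<times> marks \<Rightarrow> marks" where
  "splice_time k = splice_marks (\<lambda>i. snd i < int k) id (\<lambda>i. (fst i, snd i - int k))
     (\<lambda>i. snd (snd i) < int k) id (\<lambda>i. (fst i, fst (snd i), snd (snd i) - int k))"

lemma conn_splice_time_less: "n < int k \<Longrightarrow> conn l T X (splice_time k (u, v)) i j n = conn l T X u i j n"
  by (simp add: conn_def connected_at_def sinr_def interference_def splice_time_def splice_marks_def splice_def case_prod_beta' cong: if_cong)

lemma conn_splice_time_ge: "int k \<le> n \<Longrightarrow> conn l T X (splice_time k (u, v)) i j n = conn l T X v i j (n - int k)"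
  by (simp add: conn_def connected_at_def sinr_def interference_def splice_time_def splice_marks_def splice_def case_prod_beta' cong: if_cong)

lemma hop_splice_time_before:
  "m \<le> k \<Longrightarrow> hop l T X (splice_time k (u, v)) 0 m i j = hop l T X u 0 m i j"
  by (induction m arbitrary: j) (simp_all add: conn_splice_time_less)

lemma hop_splice_time_after:
  "hop l T X (splice_time k (u, v)) (int k) m i j = hop l T X v 0 m i j"
  by (induction m arbitrary: j) (simp_all add: conn_splice_time_ge)

lemma delay_splice_time: "delay l T X (splice_time k (u, v)) (int k) i j = delay l T X v 0 i j"
  by (simp add: delay_def hop_splice_time_after)

definition permute :: "(nat \<Rightarrow> nat) \<Rightarrow> marks \<Rightarrow> marks" where
  "permute \<sigma> mk = splice_marks (\<lambda>_. True) (\<lambda>i. (\<sigma> (fst i), snd i)) id (\<lambda>_. True) (\<lambda>i. (\<sigma> (fst i), \<sigma> (fst (snd i)), snd (snd i))) id (mk, mk)"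

text \<open>
The interference is a sum of nonnegative terms over all indices, hence invariant under
their permutation.
\<close>

lemma conn_permute:
  assumes "bij \<sigma>"
  shows "conn l T (X \<circ> \<sigma>) (permute \<sigma> mk) i j n = conn l T X mk (\<sigma> i) (\<sigma> j) n"
proof -
  let ?e = "fst mk" and ?F = "snd (snd mk)"
  have "(\<Sum>k. if \<sigma> k \<noteq> \<sigma> i \<and> ?e (\<sigma> k, n) then ennreal (?F (\<sigma> k, \<sigma> j, n)) / ennreal (l (dist (X (\<sigma> k)) (X (\<sigma> j)))) else 0)
     = (\<Sum>k. if k \<noteq> \<sigma> i \<and> ?e (k, n) then ennreal (?F (k, \<sigma> j, n)) / ennreal (l (dist (X k) (X (\<sigma> j)))) else 0)"
    unfolding nn_integral_count_space_nat[symmetric]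
    by (rule nn_integral_bij_count_space[OF assms, of "\<lambda>k. if k \<noteq> \<sigma> i \<and> ?e (k, n) then
        ennreal (?F (k, \<sigma> j, n)) / ennreal (l (dist (X k) (X (\<sigma> j)))) else 0"])
  then show ?thesis
    by (simp add: conn_def connected_at_def sinr_def interference_def permute_def splice_marks_def splice_def case_prod_beta'
        inj_eq[OF bij_is_inj[OF assms]] cong: if_cong)
qed

lemma hop_permute:
  assumes "bij \<sigma>"
  shows "hop l T (X \<circ> \<sigma>) (permute \<sigma> mk) n k i j = hop l T X mk n k (\<sigma> i) (\<sigma> j)"
proof (induction k arbitrary: j)
  case 0
  show ?case by (simp add: inj_eq[OF bij_is_inj[OF assms]])
next
  case (Suc k)
  have "(\<exists>m. hop l T X mk n k (\<sigma> i) (\<sigma> m) \<and> conn l T X mk (\<sigma> m) (\<sigma> j) (n + int k)) \<longleftrightarrow>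
      (\<exists>m. hop l T X mk n k (\<sigma> i) m \<and> conn l T X mk m (\<sigma> j) (n + int k))"
  proof (intro iffI; elim exE)
    fix m assume m: "hop l T X mk n k (\<sigma> i) m \<and> conn l T X mk m (\<sigma> j) (n + int k)"
    obtain m' where "m = \<sigma> m'" using bij_is_surj[OF assms] by (rule surjE)
    then show "\<exists>m. hop l T X mk n k (\<sigma> i) (\<sigma> m) \<and> conn l T X mk (\<sigma> m) (\<sigma> j) (n + int k)" using m by blast
  qed blast
  then show ?case unfolding hop.simps Suc conn_permute[OF assms] .
qed

lemma delay_permute:
  "bij \<sigma> \<Longrightarrow> delay l T (X \<circ> \<sigma>) (permute \<sigma> mk) n i j = delay l T X mk n (\<sigma> i) (\<sigma> j)"
  by (simp add: delay_def hop_permute)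

lemma hop_translate: "hop l T (\<lambda>i. X i + v) mk n k i j = hop l T X mk n k i j"
  by (induction k arbitrary: j) (simp_all add: conn_def connected_at_def sinr_def interference_def cong: if_cong)

section \<open>Mean delays\<close>

locale sinr_model =
  fixes p :: real and \<W> \<F> :: "real measure" and l :: "real \<Rightarrow> real" and T :: real
  assumes W_prob: "prob_space \<W>" and F_prob: "prob_space \<F>"
    and W_sets: "sets \<W> = sets borel" and F_sets: "sets \<F> = sets borel"
    and l_measurable [measurable]: "l \<in> borel_measurable borel"
begin

abbreviation K :: "marks measure" where "K \<equiv> marks_law p \<W> \<F>"

lemma K_prob: "prob_space K"
  unfolding marks_law_def using W_prob F_prob
  by (intro prob_space_pair prob_space_PiM prob_space_measure_pmf)

sublocale K: prob_space K by (rule K_prob)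

sublocale KK: pair_prob_space K K ..

lemma measurable_splice_marks [measurable]: "splice_marks c f g c' f' g' \<in> K \<Otimes>\<^sub>M K \<rightarrow>\<^sub>M K"
  unfolding splice_marks_def marks_law_def case_prod_beta' by measurable

lemma nn_integral_splice_marks:
  assumes "inj_on f {i. c i}" "inj_on g {i. \<not> c i}" "inj_on f' {i. c' i}" "inj_on g' {i. \<not> c' i}"
    and [measurable]: "h \<in> borel_measurable K"
  shows "(\<integral>\<^sup>+mk. h mk \<partial>K) = (\<integral>\<^sup>+u. \<integral>\<^sup>+v. h (splice_marks c f g c' f' g' (u, v)) \<partial>K \<partial>K)"
proof -
  have "(\<integral>\<^sup>+mk. h mk \<partial>K) = (\<integral>\<^sup>+mk. h mk \<partial>distr (K \<Otimes>\<^sub>M K) K (splice_marks c f g c' f' g'))"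
    using distr_splice_marks[OF W_prob F_prob assms(1-4)] by simp
  also have "\<dots> = (\<integral>\<^sup>+z. h (splice_marks c f g c' f' g' z) \<partial>(K \<Otimes>\<^sub>M K))" by (rule nn_integral_distr) simp_all
  also have "\<dots> = (\<integral>\<^sup>+u. \<integral>\<^sup>+v. h (splice_marks c f g c' f' g' (u, v)) \<partial>K \<partial>K)"
    by (rule K.nn_integral_fst[symmetric]) simp
  finally show ?thesis .
qed

lemma nn_integral_splice_time:
  assumes "h \<in> borel_measurable K"
  shows "(\<integral>\<^sup>+mk. h mk \<partial>K) = (\<integral>\<^sup>+u. \<integral>\<^sup>+v. h (splice_time k (u, v)) \<partial>K \<partial>K)"
  unfolding splice_time_def
  by (rule nn_integral_splice_marks) (auto simp: inj_on_def assms prod_eq_iff)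

lemma measurable_permute [measurable]: "permute \<sigma> \<in> K \<rightarrow>\<^sub>M K"
  unfolding permute_def by measurable

lemma nn_integral_permute:
  assumes \<sigma>: "inj \<sigma>" and [measurable]: "h \<in> borel_measurable K"
  shows "(\<integral>\<^sup>+mk. h (permute \<sigma> mk) \<partial>K) = (\<integral>\<^sup>+mk. h mk \<partial>K)"
proof -
  have "(\<integral>\<^sup>+mk. h mk \<partial>K) = (\<integral>\<^sup>+u. \<integral>\<^sup>+v. h (splice_marks (\<lambda>_. True) (\<lambda>i. (\<sigma> (fst i), snd i)) id
      (\<lambda>_. True) (\<lambda>i. (\<sigma> (fst i), \<sigma> (fst (snd i)), snd (snd i))) id (u, v)) \<partial>K \<partial>K)"
    by (rule nn_integral_splice_marks) (use \<sigma> in \<open>auto simp: inj_on_def prod_eq_iff\<close>)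
  also have "\<dots> = (\<integral>\<^sup>+u. \<integral>\<^sup>+v. h (permute \<sigma> u) \<partial>K \<partial>K)"
    by (intro nn_integral_cong) (simp add: permute_def splice_marks_def splice_def case_prod_beta')
  finally have "(\<integral>\<^sup>+mk. h mk \<partial>K) = (\<integral>\<^sup>+u. \<integral>\<^sup>+v. h (permute \<sigma> u) \<partial>K \<partial>K)" .
  then show ?thesis by (simp add: K.emeasure_space_1)
qed

definition mean_hops :: "(nat \<Rightarrow> real^2) \<Rightarrow> nat \<Rightarrow> nat \<Rightarrow> ennreal" where
  "mean_hops X i j = (\<integral>\<^sup>+mk. delay l T X mk 0 i j \<partial>K)"

lemma borel_measurable_delay [measurable]:
  "(\<lambda>mk. delay l T X mk n i j) \<in> borel_measurable K"
  by (rule measurable_delay[OF _ _ measurable_ident_sets[OF refl] W_sets F_sets]) auto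

lemma pred_hop [measurable]: "Measurable.pred K (\<lambda>mk. hop l T X mk n k i j)"
  by (rule measurable_hop[OF _ _ measurable_ident_sets[OF refl] W_sets F_sets]) auto

lemma pred_conn [measurable]: "Measurable.pred K (\<lambda>mk. conn l T X mk i j n)"
  by (rule measurable_conn[OF _ _ measurable_ident_sets[OF refl] W_sets F_sets]) auto

lemma measurable_splice_time [measurable]: "splice_time k \<in> K \<Otimes>\<^sub>M K \<rightarrow>\<^sub>M K"
  unfolding splice_time_def by measurable

lemma mean_hops_self: "mean_hops X i i = 1"
  by (simp add: mean_hops_def delay_self K.emeasure_space_1)

text \<open>
Decompose according to the first arrival time \<open>k\<close> at \<open>j\<close>, and splice at time \<open>k\<close>. Whether \<open>k\<close> is the
first arrival time is decided by the marks before the cut, the remaining delay by those after the cut.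
\<close>

lemma mean_hops_triangle: "mean_hops X i a \<le> mean_hops X i j + mean_hops X j a"
proof (cases "mean_hops X i j = \<infinity>")
  case False
  define first where "first k mk \<longleftrightarrow> 1 \<le> k \<and> hop l T X mk 0 k i j \<and> (\<forall>m. 1 \<le> m \<longrightarrow> m < k \<longrightarrow> \<not> hop l T X mk 0 m i j)" for k mk
  have [measurable]: "Measurable.pred K (first k)" for k unfolding first_def by measurable
  let ?I = "\<lambda>k mk. if first k mk then 1 else 0 :: ennreal"
  have first_splice: "first k (splice_time k (u, v)) \<longleftrightarrow> first k u" for k u v
    unfolding first_def by (auto simp: hop_splice_time_before)
  have first_unique: "first k mk \<Longrightarrow> first m mk \<Longrightarrow> k = m" for k m mk
    unfolding first_def by (cases k m rule: linorder_cases) auto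
  have sum1: "(\<Sum>k. ?I k mk * c k) = c k0" if "first k0 mk" for k0 mk and c :: "nat \<Rightarrow> ennreal"
  proof -
    have "(\<Sum>k. ?I k mk * c k) = (\<Sum>k\<in>{k0}. ?I k mk * c k)"
      by (rule suminf_finite) (use that in \<open>auto dest: first_unique[of _ mk k0]\<close>)
    then show ?thesis using that by simp
  qed
  have sum_delay: "(\<Sum>k. ?I k mk * of_nat k) \<le> delay l T X mk 0 i j" for mk
  proof (cases rule: delay_cases[of l T X mk 0 i j])
    case (1 k)
    then have "first k mk" by (auto simp: first_def)
    then show ?thesis using 1 sum1[of k mk of_nat] by simp
  qed simp
  have sum_le1: "(\<Sum>k. ?I k mk) \<le> 1" for mk
  proof (cases "\<exists>k. first k mk")
    case True then show ?thesis using sum1[of _ mk "\<lambda>_. 1"] by auto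
  qed simp
  have "AE mk in K. delay l T X mk 0 i j \<noteq> \<infinity>"
    using False unfolding mean_hops_def by (intro nn_integral_PInf_AE) auto
  then have "AE mk in K. delay l T X mk 0 i a \<le> (\<Sum>k. ?I k mk * (of_nat k + delay l T X mk (int k) j a))"
  proof eventually_elim
    case (elim mk)
    show ?case
    proof (cases rule: delay_cases[of l T X mk 0 i j])
      case (1 k)
      then have "first k mk" by (auto simp: first_def)
      then show ?thesis using delay_trans[OF 1(1,2), of a] sum1[of k mk "\<lambda>k. of_nat k + delay l T X mk (int k) j a"] by simp
    qed (use elim in simp)
  qed
  then have "mean_hops X i a \<le> (\<integral>\<^sup>+mk. (\<Sum>k. ?I k mk * (of_nat k + delay l T X mk (int k) j a)) \<partial>K)"
    unfolding mean_hops_def by (rule nn_integral_mono_AE)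
  also have "\<dots> = (\<Sum>k. \<integral>\<^sup>+mk. ?I k mk * (of_nat k + delay l T X mk (int k) j a) \<partial>K)"
    by (rule nn_integral_suminf) measurable
  also have "\<dots> = (\<Sum>k. (\<integral>\<^sup>+u. ?I k u \<partial>K) * of_nat k + (\<integral>\<^sup>+u. ?I k u \<partial>K) * mean_hops X j a)"
  proof (rule suminf_cong)
    fix k
    have "(\<integral>\<^sup>+mk. ?I k mk * (of_nat k + delay l T X mk (int k) j a) \<partial>K)
       = (\<integral>\<^sup>+u. \<integral>\<^sup>+v. ?I k u * (of_nat k + delay l T X v 0 j a) \<partial>K \<partial>K)"
      by (subst nn_integral_splice_time[where k=k]) (simp_all add: first_splice delay_splice_time)
    also have "\<dots> = (\<integral>\<^sup>+u. ?I k u \<partial>K) * (of_nat k + mean_hops X j a)"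
      by (simp add: nn_integral_cmult nn_integral_multc nn_integral_add mean_hops_def K.emeasure_space_1)
    finally show "(\<integral>\<^sup>+mk. ?I k mk * (of_nat k + delay l T X mk (int k) j a) \<partial>K)
       = (\<integral>\<^sup>+u. ?I k u \<partial>K) * of_nat k + (\<integral>\<^sup>+u. ?I k u \<partial>K) * mean_hops X j a" by (simp add: distrib_left)
  qed
  also have "\<dots> = (\<integral>\<^sup>+mk. (\<Sum>k. ?I k mk * of_nat k) \<partial>K) + (\<integral>\<^sup>+mk. (\<Sum>k. ?I k mk) \<partial>K) * mean_hops X j a"
    by (simp add: suminf_add[symmetric] nn_integral_suminf nn_integral_multc)
  also have "\<dots> \<le> mean_hops X i j + 1 * mean_hops X j a"
  proof (intro add_mono mult_right_mono)
    show "(\<integral>\<^sup>+mk. (\<Sum>k. ?I k mk * of_nat k) \<partial>K) \<le> mean_hops X i j"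
      unfolding mean_hops_def by (rule nn_integral_mono) (rule sum_delay)
    have "(\<integral>\<^sup>+mk. (\<Sum>k. ?I k mk) \<partial>K) \<le> (\<integral>\<^sup>+mk. 1 \<partial>K)" by (rule nn_integral_mono) (rule sum_le1)
    then show "(\<integral>\<^sup>+mk. (\<Sum>k. ?I k mk) \<partial>K) \<le> 1" by (simp add: K.emeasure_space_1)
  qed simp
  finally show ?thesis by simp
qed simp

lemma mean_hops_permute:
  assumes "bij \<sigma>"
  shows "mean_hops (X \<circ> \<sigma>) i j = mean_hops X (\<sigma> i) (\<sigma> j)"
  unfolding mean_hops_def
  by (subst nn_integral_permute[OF bij_is_inj[OF assms], symmetric]) (simp_all add: delay_permute[OF assms])

lemma mean_hops_translate: "mean_hops (\<lambda>i. X i + v) i j = mean_hops X i j"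
  by (simp add: mean_hops_def delay_def hop_translate)

lemma measurable_mean_hops:
  assumes "\<And>i. (\<lambda>a. X a i) \<in> borel_measurable S"
  shows "(\<lambda>a. mean_hops (X a) i j) \<in> borel_measurable S"
  unfolding mean_hops_def
proof (rule K.borel_measurable_nn_integral)
  have "(\<lambda>z. delay l T (X (fst z)) (snd z) 0 i j) \<in> borel_measurable (S \<Otimes>\<^sub>M K)"
    by (rule measurable_delay[OF _ _ _ W_sets F_sets]) (use assms in auto)
  then show "(\<lambda>(a, mk). delay l T (X a) mk 0 i j) \<in> borel_measurable (S \<Otimes>\<^sub>M K)" by (simp add: case_prod_beta')
qed

end

section \<open>The space of locally finite configurations\<close>

definition loc_finite :: "(real^2) set \<Rightarrow> bool" where
  "loc_finite S \<longleftrightarrow> (\<forall>B. bounded B \<longrightarrow> finite (S \<inter> B))"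

definition conf :: "(real^2) set measure" where
  "conf = sigma {S. loc_finite S} {{S. loc_finite S \<and> card (S \<inter> B) = k} | B k. B \<in> sets borel \<and> bounded B}"

lemma loc_finiteD: "loc_finite S \<Longrightarrow> bounded B \<Longrightarrow> finite (S \<inter> B)"
  by (simp add: loc_finite_def)

lemma space_conf [simp]: "space conf = {S. loc_finite S}"
  by (simp add: conf_def space_measure_of_conv)

lemma sets_conf: "sets conf = sigma_sets {S. loc_finite S}
    {{S. loc_finite S \<and> card (S \<inter> B) = k} | B k. B \<in> sets borel \<and> bounded B}"
  unfolding conf_def by (rule sets_measure_of) auto

lemma measurable_card_conf:
  assumes "B \<in> sets borel" "bounded B"
  shows "(\<lambda>S. card (S \<inter> B)) \<in> conf \<rightarrow>\<^sub>M count_space UNIV"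
proof (subst measurable_count_space_eq2_countable)
  show "(\<lambda>S. card (S \<inter> B)) \<in> space conf \<rightarrow> UNIV \<and> (\<forall>a\<in>UNIV. (\<lambda>S. card (S \<inter> B)) -` {a} \<inter> space conf \<in> sets conf)"
  proof (intro conjI ballI)
    fix a
    have "(\<lambda>S. card (S \<inter> B)) -` {a} \<inter> space conf = {S. loc_finite S \<and> card (S \<inter> B) = a}" by auto
    then show "(\<lambda>S. card (S \<inter> B)) -` {a} \<inter> space conf \<in> sets conf"
      unfolding sets_conf using assms by (intro sigma_sets.Basic) auto
  qed simp
qed

lemma measurable_confI:
  assumes "\<And>\<omega>. \<omega> \<in> space M \<Longrightarrow> loc_finite (\<Psi> \<omega>)"
    and "\<And>B. B \<in> sets borel \<Longrightarrow> bounded B \<Longrightarrow> (\<lambda>\<omega>. card (\<Psi> \<omega> \<inter> B)) \<in> M \<rightarrow>\<^sub>M count_space UNIV"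
  shows "\<Psi> \<in> M \<rightarrow>\<^sub>M conf"
  unfolding conf_def
proof (rule measurable_measure_of)
  fix A assume "A \<in> {{S. loc_finite S \<and> card (S \<inter> B) = k} | B k. B \<in> sets borel \<and> bounded B}"
  then obtain B k where A: "A = {S. loc_finite S \<and> card (S \<inter> B) = k}" and B: "B \<in> sets borel" "bounded B" by auto
  note [measurable] = assms(2)[OF B]
  have "\<Psi> -` A \<inter> space M = {\<omega> \<in> space M. card (\<Psi> \<omega> \<inter> B) = k}" using assms(1) by (auto simp: A)
  also have "\<dots> \<in> sets M" by measurable
  finally show "\<Psi> -` A \<inter> space M \<in> sets M" .
qed (use assms(1) in auto)

lemma process_algebra_eq_vimage:
  assumes "\<And>\<omega>. \<omega> \<in> space M \<Longrightarrow> loc_finite (\<Psi> \<omega>)"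
  shows "sets (process_algebra M \<Psi>) = sets (vimage_algebra (space M) \<Psi> conf)"
proof -
  have "vimage_algebra (space M) \<Psi> conf = sigma (space M)
    {\<Psi> -` A \<inter> space M | A. A \<in> {{S. loc_finite S \<and> card (S \<inter> B) = k} | B k. B \<in> sets borel \<and> bounded B}}"
    unfolding conf_def by (rule vimage_algebra_sigma) (use assms in auto)
  also have "{\<Psi> -` A \<inter> space M | A. A \<in> {{S. loc_finite S \<and> card (S \<inter> B) = k} | B k. B \<in> sets borel \<and> bounded B}}
     = {{\<omega> \<in> space M. card (\<Psi> \<omega> \<inter> B) = k} | B k. B \<in> sets borel \<and> bounded B}" (is "?L = ?R")
  proof
    show "?L \<subseteq> ?R"
    proof
      fix Z assume "Z \<in> ?L"
      then obtain B k where Z: "Z = \<Psi> -` {S. loc_finite S \<and> card (S \<inter> B) = k} \<inter> space M" and B: "B \<in> sets borel" "bounded B" by auto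
      have "Z = {\<omega> \<in> space M. card (\<Psi> \<omega> \<inter> B) = k}" using assms by (auto simp: Z)
      then show "Z \<in> ?R" using B by blast
    qed
    show "?R \<subseteq> ?L"
    proof
      fix Z assume "Z \<in> ?R"
      then obtain B k where Z: "Z = {\<omega> \<in> space M. card (\<Psi> \<omega> \<inter> B) = k}" and B: "B \<in> sets borel" "bounded B" by auto
      have "Z = \<Psi> -` {S. loc_finite S \<and> card (S \<inter> B) = k} \<inter> space M" using assms by (auto simp: Z)
      then show "Z \<in> ?L" using B by blast
    qed
  qed
  finally show ?thesis by (simp add: process_algebra_def)
qed

section \<open>Factorization of measurable functions\<close>

text \<open>
The level sets of \<open>X\<close> are preimages of measurable sets \<open>A r\<close>, and \<open>X\<close> is the infimum of the
rationals \<open>r\<close> whose set is hit.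
\<close>

lemma factor_real:
  fixes X :: "'w \<Rightarrow> real"
  assumes X: "X \<in> borel_measurable (vimage_algebra \<Omega> \<Phi> N)" and \<Phi>: "\<Phi> \<in> \<Omega> \<rightarrow> space N"
  obtains f where "f \<in> borel_measurable N" "\<And>\<omega>. \<omega> \<in> \<Omega> \<Longrightarrow> X \<omega> = f (\<Phi> \<omega>)"
proof -
  have "\<exists>A. A \<in> sets N \<and> {\<omega> \<in> \<Omega>. X \<omega> < of_rat r} = \<Phi> -` A \<inter> \<Omega>" for r :: rat
  proof -
    have "{\<omega> \<in> space (vimage_algebra \<Omega> \<Phi> N). X \<omega> < of_rat r} \<in> sets (vimage_algebra \<Omega> \<Phi> N)"
      using X by measurable
    then show ?thesis using \<Phi> by (auto simp: sets_vimage_algebra2)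
  qed
  then obtain A where A[measurable]: "\<And>r. A r \<in> sets N" and XA: "\<And>r. {\<omega> \<in> \<Omega>. X \<omega> < of_rat r} = \<Phi> -` A r \<inter> \<Omega>" by metis
  define h where "h y = (INF r. if y \<in> A r then ereal (of_rat r) else \<infinity>)" for y
  have [measurable]: "h \<in> borel_measurable N" unfolding h_def by measurable
  show ?thesis
  proof (rule that)
    show "(\<lambda>y. real_of_ereal (h y)) \<in> borel_measurable N" by measurable
    fix \<omega> assume \<omega>: "\<omega> \<in> \<Omega>"
    have iff: "\<Phi> \<omega> \<in> A r \<longleftrightarrow> X \<omega> < of_rat r" for r using XA[of r] \<omega> by blast
    have "h (\<Phi> \<omega>) = ereal (X \<omega>)"
    proof (rule antisym)
      show "ereal (X \<omega>) \<le> h (\<Phi> \<omega>)" unfolding h_def by (rule INF_greatest) (auto simp: iff)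
      show "h (\<Phi> \<omega>) \<le> ereal (X \<omega>)"
      proof (rule ereal_le_epsilon2)
        fix \<epsilon> :: real assume "0 < \<epsilon>"
        then obtain r where r: "X \<omega> < of_rat r" "of_rat r < X \<omega> + \<epsilon>" using of_rat_dense[of "X \<omega>" "X \<omega> + \<epsilon>"] by auto
        have "h (\<Phi> \<omega>) \<le> ereal (of_rat r)" unfolding h_def by (rule INF_lower2[of r]) (auto simp: iff r)
        then show "h (\<Phi> \<omega>) \<le> ereal (X \<omega>) + ereal \<epsilon>" using r by (metis ereal_less_eq(3) less_imp_le order_trans plus_ereal.simps(1))
      qed
    qed
    then show "X \<omega> = real_of_ereal (h (\<Phi> \<omega>))" by simp
  qed
qed

lemma factor_euclidean:
  fixes X :: "'w \<Rightarrow> 'b::euclidean_space"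
  assumes X[measurable]: "X \<in> borel_measurable (vimage_algebra \<Omega> \<Phi> N)" and \<Phi>: "\<Phi> \<in> \<Omega> \<rightarrow> space N"
  obtains f where "f \<in> borel_measurable N" "\<And>\<omega>. \<omega> \<in> \<Omega> \<Longrightarrow> X \<omega> = f (\<Phi> \<omega>)"
proof -
  have "\<exists>f. f \<in> borel_measurable N \<and> (\<forall>\<omega>\<in>\<Omega>. X \<omega> \<bullet> b = f (\<Phi> \<omega>))" for b
  proof -
    have "(\<lambda>\<omega>. X \<omega> \<bullet> b) \<in> borel_measurable (vimage_algebra \<Omega> \<Phi> N)" by measurable
    from factor_real[OF this \<Phi>] show ?thesis by metis
  qed
  then obtain f where [measurable]: "\<And>b. f b \<in> borel_measurable N" and f: "\<And>b \<omega>. \<omega> \<in> \<Omega> \<Longrightarrow> X \<omega> \<bullet> b = f b (\<Phi> \<omega>)" by metis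
  show ?thesis
  proof (rule that)
    show "(\<lambda>y. \<Sum>b\<in>Basis. f b y *\<^sub>R b) \<in> borel_measurable N" by measurable
    show "X \<omega> = (\<Sum>b\<in>Basis. f b (\<Phi> \<omega>) *\<^sub>R b)" if "\<omega> \<in> \<Omega>" for \<omega>
      by (simp add: f[OF that, symmetric] euclidean_representation)
  qed
qed

section \<open>The law of a Poisson process\<close>

text \<open>
The events that prescribe the numbers of points in finitely many bounded sets form a generator that
is closed under intersection.
\<close>

lemma conf_law_eqI:
  assumes P: "prob_space P" and Q: "prob_space Q" and sP: "sets P = sets conf" and sQ: "sets Q = sets conf"
    and eq: "\<And>J. finite J \<Longrightarrow> (\<And>B k. (B, k) \<in> J \<Longrightarrow> B \<in> sets borel \<and> bounded B) \<Longrightarrow>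
       emeasure P {S. loc_finite S \<and> (\<forall>(B, k)\<in>J. card (S \<inter> B) = k)} = emeasure Q {S. loc_finite S \<and> (\<forall>(B, k)\<in>J. card (S \<inter> B) = k)}"
  shows "P = Q"
proof -
  define Ev where "Ev J = {S. loc_finite S \<and> (\<forall>(B, k)\<in>J. card (S \<inter> B) = k)}" for J :: "((real^2) set \<times> nat) set"
  define E where "E = {Ev J | J. finite J \<and> (\<forall>(B, k)\<in>J. B \<in> sets borel \<and> bounded B)}"
  let ?G = "{{S. loc_finite S \<and> card (S \<inter> B) = k} | B k. B \<in> sets borel \<and> bounded B}"
  have sets: "sigma_sets {S. loc_finite S} E = sets conf"
    unfolding sets_conf
  proof (rule sigma_sets_eqI)
    fix A assume "A \<in> E"
    then obtain J where A: "A = Ev J" and J0: "finite J" "\<forall>(B, k)\<in>J. B \<in> sets borel \<and> bounded B"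
      unfolding E_def by blast
    have J: "finite J" "\<And>x. x \<in> J \<Longrightarrow> fst x \<in> sets borel \<and> bounded (fst x)" using J0 by auto
    have "A = {S \<in> space conf. \<forall>x\<in>J. card (S \<inter> fst x) = snd x}" by (auto simp: A Ev_def)
    also have "\<dots> \<in> sets conf"
    proof (rule sets.sets_Collect_finite_All[OF _ J(1)])
      fix x assume "x \<in> J"
      then have [measurable]: "(\<lambda>S. card (S \<inter> fst x)) \<in> conf \<rightarrow>\<^sub>M count_space UNIV"
        using J(2)[of x] by (intro measurable_card_conf) auto
      show "{S \<in> space conf. card (S \<inter> fst x) = snd x} \<in> sets conf" by measurable
    qed
    finally show "A \<in> sigma_sets {S. loc_finite S} ?G" by (simp add: sets_conf)
  next
    fix A assume "A \<in> ?G"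
    then obtain B k where "A = Ev {(B, k)}" "B \<in> sets borel" "bounded B" by (auto simp: Ev_def)
    then have "A \<in> E" unfolding E_def by (intro CollectI exI[of _ "{(B, k)}"]) auto
    then show "A \<in> sigma_sets {S. loc_finite S} E" by (rule sigma_sets.Basic)
  qed
  interpret P: prob_space P by fact
  show ?thesis
  proof (rule measure_eqI_generator_eq[where E=E and \<Omega>="{S. loc_finite S}" and A="\<lambda>_. Ev {}"])
    show "Int_stable E"
    proof (rule Int_stableI)
      fix a b assume "a \<in> E" "b \<in> E"
      then obtain J J' where "a = Ev J" "b = Ev J'" "finite J" "finite J'" "\<forall>(B, k)\<in>J. B \<in> sets borel \<and> bounded B" "\<forall>(B, k)\<in>J'. B \<in> sets borel \<and> bounded B"
        unfolding E_def by blast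
      moreover from this have "a \<inter> b = Ev (J \<union> J')" by (auto simp: Ev_def ball_Un)
      ultimately show "a \<inter> b \<in> E" unfolding E_def by (intro CollectI exI[of _ "J \<union> J'"]) auto
    qed
    show "range (\<lambda>_. Ev {}) \<subseteq> E" unfolding E_def by (auto intro!: exI[of _ "{}"])
    show "emeasure P X = emeasure Q X" if "X \<in> E" for X
      using that eq by (auto simp: E_def Ev_def)
    show "sets P = sigma_sets {S. loc_finite S} E" "sets Q = sigma_sets {S. loc_finite S} E"
      using sP sQ sets by simp_all
    show "E \<subseteq> Pow {S. loc_finite S}" "(\<Union>i::nat. Ev {}) = {S. loc_finite S}" by (auto simp: E_def Ev_def)
  qed simp
qed

lemma poisson_process_loc_finite:
  "poisson_process M \<nu> \<Psi> \<Longrightarrow> \<omega> \<in> space M \<Longrightarrow> loc_finite (\<Psi> \<omega>)"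
  by (simp add: poisson_process_def loc_finite_def)

lemma poisson_process_measurable: "poisson_process M \<nu> \<Psi> \<Longrightarrow> \<Psi> \<in> M \<rightarrow>\<^sub>M conf"
  by (rule measurable_confI) (auto simp: poisson_process_def loc_finite_def)

lemma poisson_count_law:
  assumes "prob_space M" "poisson_process M \<nu> \<Psi>" "prob_space M'" "poisson_process M' \<nu> \<Psi>'" "B \<in> sets borel" "bounded B"
  shows "distr M (count_space UNIV) (\<lambda>\<omega>. card (\<Psi> \<omega> \<inter> B)) = distr M' (count_space UNIV) (\<lambda>\<omega>. card (\<Psi>' \<omega> \<inter> B))"
proof (rule measure_eqI_countable[where A=UNIV])
  interpret M: prob_space M by fact
  interpret M': prob_space M' by fact
  have m: "(\<lambda>\<omega>. card (\<Psi> \<omega> \<inter> B)) \<in> M \<rightarrow>\<^sub>M count_space UNIV" "(\<lambda>\<omega>. card (\<Psi>' \<omega> \<inter> B)) \<in> M' \<rightarrow>\<^sub>M count_space UNIV"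
    using assms by (auto simp: poisson_process_def)
  fix k :: nat
  have "measure M {\<omega> \<in> space M. card (\<Psi> \<omega> \<inter> B) = k} = measure M' {\<omega> \<in> space M'. card (\<Psi>' \<omega> \<inter> B) = k}"
    using assms by (auto simp: poisson_process_def)
  moreover have "f -` {k} \<inter> space N = {\<omega> \<in> space N. f \<omega> = k}" for f :: "'x \<Rightarrow> nat" and N by auto
  ultimately show "emeasure (distr M (count_space UNIV) (\<lambda>\<omega>. card (\<Psi> \<omega> \<inter> B))) {k} = emeasure (distr M' (count_space UNIV) (\<lambda>\<omega>. card (\<Psi>' \<omega> \<inter> B))) {k}"
    using m by (simp add: emeasure_distr M.emeasure_eq_measure M'.emeasure_eq_measure vimage_def Int_def conj_commute)
qed simp_all

lemma poisson_vector_law: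
  fixes m :: nat and B :: "nat \<Rightarrow> (real^2) set"
  assumes "prob_space M" "poisson_process M \<nu> \<Psi>" "\<forall>i<m. B i \<in> sets borel \<and> bounded (B i)" "disjoint_family_on B {..<m}" "0 < m"
  shows "distr M (\<Pi>\<^sub>M i\<in>{..<m}. count_space UNIV) (\<lambda>\<omega>. \<lambda>i\<in>{..<m}. card (\<Psi> \<omega> \<inter> B i))
     = (\<Pi>\<^sub>M i\<in>{..<m}. distr M (count_space UNIV) (\<lambda>\<omega>. card (\<Psi> \<omega> \<inter> B i)))"
proof -
  interpret prob_space M by fact
  have "indep_vars (\<lambda>_. count_space UNIV) (\<lambda>i \<omega>. card (\<Psi> \<omega> \<inter> B i)) {..<m}"
    using assms(2)[unfolded poisson_process_def, THEN conjunct2, THEN conjunct2, rule_format, of m B] assms(3,4) by simp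
  then show ?thesis
    using assms by (subst (asm) indep_vars_iff_distr_eq_PiM') (auto simp: poisson_process_def)
qed

text \<open>
The definition of a Poisson process speaks of disjoint sets only. For finitely many arbitrary sets, the
numbers of points are sums of those in the atoms of the algebra generated by the sets, which are
disjoint.
\<close>

theorem poisson_law_unique:
  assumes M: "prob_space M" "poisson_process M \<nu> \<Psi>" and M': "prob_space M'" "poisson_process M' \<nu> \<Psi>'"
  shows "distr M conf \<Psi> = distr M' conf \<Psi>'"
proof (rule conf_law_eqI)
  note \<Psi>[measurable] = poisson_process_measurable[OF M(2)] poisson_process_measurable[OF M'(2)]
  interpret M: prob_space M by fact
  interpret M': prob_space M' by fact
  show "prob_space (distr M conf \<Psi>)" "prob_space (distr M' conf \<Psi>')"
    by (rule M.prob_space_distr M'.prob_space_distr; simp)+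
  fix J :: "((real^2) set \<times> nat) set"
  assume J: "finite J" "\<And>B k. (B, k) \<in> J \<Longrightarrow> B \<in> sets borel \<and> bounded B"
  define BB where "BB = fst ` J"
  have BB: "finite BB" "\<And>B. B \<in> BB \<Longrightarrow> B \<in> sets borel \<and> bounded B" using J by (auto simp: BB_def)
  define m where "m = card (Pow BB)"
  have m: "0 < m" using BB(1) by (auto simp: m_def card_gt_0_iff)
  obtain h where h: "bij_betw h {..<m} (Pow BB)"
    using ex_bij_betw_nat_finite[of "Pow BB"] BB(1) by (auto simp: m_def lessThan_atLeast0)
  define C where "C i = {x \<in> \<Union>BB. \<forall>B\<in>BB. x \<in> B \<longleftrightarrow> B \<in> h i}" for i
  have C_meas: "C i \<in> sets borel" for i
  proof -
    have neg: "{x \<in> space borel. x \<in> B \<longleftrightarrow> B \<in> h i} \<in> sets borel" if "B \<in> BB" for B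
    proof (cases "B \<in> h i")
      case True
      then have "{x \<in> space borel. x \<in> B \<longleftrightarrow> B \<in> h i} = B" by auto
      then show ?thesis using BB(2)[OF that] by simp
    next
      case False
      then have "{x \<in> space borel. x \<in> B \<longleftrightarrow> B \<in> h i} = - B" by auto
      then show ?thesis using BB(2)[OF that] by (simp only: borel_comp)
    qed
    have "{x \<in> \<Union>BB. \<forall>B\<in>BB. x \<in> B \<longleftrightarrow> B \<in> h i} = \<Union>BB \<inter> {x \<in> space borel. \<forall>B\<in>BB. x \<in> B \<longleftrightarrow> B \<in> h i}" by auto
    also have "\<dots> \<in> sets borel"
      using BB by (intro sets.Int sets.finite_Union sets.sets_Collect_finite_All neg) auto
    finally show ?thesis by (simp add: C_def)
  qed
  have C_bounded: "bounded (C i)" for i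
  proof -
    have "bounded (\<Union>BB)" using BB by (intro bounded_Union) auto
    then show ?thesis by (rule bounded_subset) (auto simp: C_def)
  qed
  have disj: "C i \<inter> C j = {}" if "i < m" "j < m" "i \<noteq> j" for i j
  proof -
    have "h i \<noteq> h j" "h i \<subseteq> BB" "h j \<subseteq> BB" using inj_onD[OF bij_betw_imp_inj_on[OF h]] bij_betw_apply[OF h] that by auto
    then obtain B where "B \<in> BB" "(B \<in> h i) \<noteq> (B \<in> h j)" by blast
    then show ?thesis by (auto simp: C_def)
  qed
  then have disj': "disjoint_family_on C {..<m}" by (auto simp: disjoint_family_on_def)
  have B_union: "B = (\<Union>i\<in>{i\<in>{..<m}. B \<in> h i}. C i)" if B: "B \<in> BB" for B
  proof
    show "B \<subseteq> (\<Union>i\<in>{i\<in>{..<m}. B \<in> h i}. C i)"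
    proof
      fix x assume x: "x \<in> B"
      have "{B\<in>BB. x \<in> B} \<in> h ` {..<m}" using h by (auto simp: bij_betw_def)
      then obtain i where i: "i < m" "h i = {B\<in>BB. x \<in> B}" by force
      have "x \<in> C i" unfolding C_def i(2) using B x by blast
      moreover have "B \<in> h i" unfolding i(2) using B x by simp
      ultimately show "x \<in> (\<Union>i\<in>{i\<in>{..<m}. B \<in> h i}. C i)" using i(1) by blast
    qed
    show "(\<Union>i\<in>{i\<in>{..<m}. B \<in> h i}. C i) \<subseteq> B" using B by (auto simp: C_def)
  qed
  have card_B: "card (S \<inter> B) = (\<Sum>i\<in>{i\<in>{..<m}. B \<in> h i}. card (S \<inter> C i))" if "B \<in> BB" "loc_finite S" for S B
  proof -
    have "card (S \<inter> B) = card (\<Union>i\<in>{i\<in>{..<m}. B \<in> h i}. S \<inter> C i)"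
      using arg_cong[OF B_union[OF that(1)], of "\<lambda>Y. card (S \<inter> Y)"] by (simp only: Int_UN_distrib)
    also have "\<dots> = (\<Sum>i\<in>{i\<in>{..<m}. B \<in> h i}. card (S \<inter> C i))"
      by (rule card_UN_disjoint) (use disj loc_finiteD[OF that(2) C_bounded] in auto)
    finally show ?thesis .
  qed
  let ?N = "\<Pi>\<^sub>M i\<in>{..<m}. count_space (UNIV :: nat set)"
  define Z where "Z = {n \<in> space ?N. \<forall>x\<in>J. (\<Sum>i\<in>{i\<in>{..<m}. fst x \<in> h i}. n i) = snd x}"
  have Z: "Z \<in> sets ?N"
    unfolding Z_def
  proof (rule sets.sets_Collect_finite_All[OF _ J(1)])
    fix x assume "x \<in> J"
    have [measurable]: "(\<lambda>n. \<Sum>i\<in>{i\<in>{..<m}. fst x \<in> h i}. n i) \<in> ?N \<rightarrow>\<^sub>M count_space UNIV"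
      by measurable
    show "{n \<in> space ?N. (\<Sum>i\<in>{i\<in>{..<m}. fst x \<in> h i}. n i) = snd x} \<in> sets ?N"
      by measurable
  qed
  have ev: "emeasure (distr L conf \<Theta>) {S. loc_finite S \<and> (\<forall>(B, k)\<in>J. card (S \<inter> B) = k)}
      = emeasure (distr L ?N (\<lambda>\<omega>. \<lambda>i\<in>{..<m}. card (\<Theta> \<omega> \<inter> C i))) Z" if L: "poisson_process L \<nu> \<Theta>" for L :: "'c measure" and \<Theta>
  proof -
    note [measurable] = poisson_process_measurable[OF L]
    have c[measurable]: "(\<lambda>\<omega>. card (\<Theta> \<omega> \<inter> C i)) \<in> L \<rightarrow>\<^sub>M count_space UNIV" for i
      using L C_meas C_bounded by (auto simp: poisson_process_def)
    have "{S. loc_finite S \<and> (\<forall>(B, k)\<in>J. card (S \<inter> B) = k)} = {S \<in> space conf. \<forall>x\<in>J. card (S \<inter> fst x) = snd x}" by auto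
    also have "\<dots> \<in> sets conf"
    proof (rule sets.sets_Collect_finite_All[OF _ J(1)])
      fix x assume "x \<in> J"
      then have [measurable]: "(\<lambda>S. card (S \<inter> fst x)) \<in> conf \<rightarrow>\<^sub>M count_space UNIV"
        using J(2)[of "fst x" "snd x"] by (intro measurable_card_conf) auto
      show "{S \<in> space conf. card (S \<inter> fst x) = snd x} \<in> sets conf" by measurable
    qed
    finally have s: "{S. loc_finite S \<and> (\<forall>(B, k)\<in>J. card (S \<inter> B) = k)} \<in> sets conf" .
    have "\<Theta> -` {S. loc_finite S \<and> (\<forall>(B, k)\<in>J. card (S \<inter> B) = k)} \<inter> space L = (\<lambda>\<omega>. \<lambda>i\<in>{..<m}. card (\<Theta> \<omega> \<inter> C i)) -` Z \<inter> space L"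
    proof -
      have eqv: "(\<forall>(B, k)\<in>J. card (\<Theta> \<omega> \<inter> B) = k) \<longleftrightarrow> (\<forall>x\<in>J. (\<Sum>i\<in>{i\<in>{..<m}. fst x \<in> h i}. card (\<Theta> \<omega> \<inter> C i)) = snd x)" if "\<omega> \<in> space L" for \<omega>
      proof -
        have "card (\<Theta> \<omega> \<inter> fst x) = (\<Sum>i\<in>{i\<in>{..<m}. fst x \<in> h i}. card (\<Theta> \<omega> \<inter> C i))" if "x \<in> J" for x
          by (rule card_B) (use that poisson_process_loc_finite[OF L \<open>\<omega> \<in> space L\<close>] in \<open>auto simp: BB_def\<close>)
        then show ?thesis by (simp add: case_prod_beta')
      qed
      show ?thesis
      proof (rule set_eqI)
        fix \<omega>
        show "\<omega> \<in> \<Theta> -` {S. loc_finite S \<and> (\<forall>(B, k)\<in>J. card (S \<inter> B) = k)} \<inter> space L \<longleftrightarrow>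
            \<omega> \<in> (\<lambda>\<omega>. \<lambda>i\<in>{..<m}. card (\<Theta> \<omega> \<inter> C i)) -` Z \<inter> space L"
        proof (cases "\<omega> \<in> space L")
          case True
          then show ?thesis using eqv[OF True] poisson_process_loc_finite[OF L True] by (simp add: Z_def space_PiM)
        qed simp
      qed
    qed
    then show ?thesis using s Z by (simp add: emeasure_distr)
  qed
  have "distr M ?N (\<lambda>\<omega>. \<lambda>i\<in>{..<m}. card (\<Psi> \<omega> \<inter> C i)) = (\<Pi>\<^sub>M i\<in>{..<m}. distr M (count_space UNIV) (\<lambda>\<omega>. card (\<Psi> \<omega> \<inter> C i)))"
    by (rule poisson_vector_law[OF M]) (use C_meas C_bounded disj' m in auto)
  also have "\<dots> = (\<Pi>\<^sub>M i\<in>{..<m}. distr M' (count_space UNIV) (\<lambda>\<omega>. card (\<Psi>' \<omega> \<inter> C i)))"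
    by (simp only: poisson_count_law[OF M M' C_meas C_bounded])
  also have "\<dots> = distr M' ?N (\<lambda>\<omega>. \<lambda>i\<in>{..<m}. card (\<Psi>' \<omega> \<inter> C i))"
    by (rule poisson_vector_law[OF M', symmetric]) (use C_meas C_bounded disj' m in auto)
  finally show "emeasure (distr M conf \<Psi>) {S. loc_finite S \<and> (\<forall>(B, k)\<in>J. card (S \<inter> B) = k)}
      = emeasure (distr M' conf \<Psi>') {S. loc_finite S \<and> (\<forall>(B, k)\<in>J. card (S \<inter> B) = k)}"
    using ev[OF M(2)] ev[OF M'(2)] by simp
qed simp_all

section \<open>Translations\<close>

lemma card_translate_Int: "card ((\<lambda>x. x - v) ` S \<inter> B) = card (S \<inter> (\<lambda>x. x + v) ` B)" for v :: "real^2"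
proof -
  have "(\<lambda>x. x - v) ` S \<inter> B = (\<lambda>x. x - v) ` (S \<inter> (\<lambda>x. x + v) ` B)" by force
  then show ?thesis by (simp add: card_image inj_on_def)
qed

lemma loc_finite_translate: "loc_finite S \<Longrightarrow> loc_finite ((\<lambda>x. x - v) ` S)"
  unfolding loc_finite_def
proof (intro allI impI)
  fix B :: "(real^2) set" assume S: "\<forall>B. bounded B \<longrightarrow> finite (S \<inter> B)" and "bounded B"
  then have "bounded ((\<lambda>x. v + x) ` B)" by (simp add: bounded_translation)
  then have "finite ((\<lambda>x. x - v) ` (S \<inter> (\<lambda>x. v + x) ` B))" using S by blast
  moreover have "(\<lambda>x. x - v) ` S \<inter> B \<subseteq> (\<lambda>x. x - v) ` (S \<inter> (\<lambda>x. v + x) ` B)" by force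
  ultimately show "finite ((\<lambda>x. x - v) ` S \<inter> B)" by (rule finite_subset[rotated])
qed

lemma translate_borel: "B \<in> sets borel \<Longrightarrow> (\<lambda>x. x + v) ` B \<in> sets borel" for B :: "(real^2) set"
proof -
  assume [measurable]: "B \<in> sets borel"
  have "(\<lambda>x. x + v) ` B = (\<lambda>x. x - v) -` B \<inter> space borel" by force
  also have "\<dots> \<in> sets borel" by measurable
  finally show ?thesis .
qed

lemma measure_translate: "B \<in> sets borel \<Longrightarrow> measure lborel ((\<lambda>x. x + v) ` B) = measure lborel B" for B :: "(real^2) set"
proof -
  assume [measurable]: "B \<in> sets borel"
  have "emeasure lborel B = emeasure (distr lborel borel ((+) (- v))) B" by (simp add: lborel_distr_plus)
  also have "\<dots> = emeasure lborel ((\<lambda>x. x + v) ` B)"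
  proof -
    have "(+) (- v) -` B \<inter> space lborel = (\<lambda>x. x + v) ` B" by force
    then show ?thesis by (simp add: emeasure_distr)
  qed
  finally show ?thesis by (simp add: measure_def)
qed

lemma bounded_translate: "bounded B \<Longrightarrow> bounded ((\<lambda>x. x + v) ` B)" for B :: "(real^2) set"
  using bounded_translation[of B v] by (simp add: add.commute)

lemma measurable_translate [measurable]: "(\<lambda>S. (\<lambda>x. x - v) ` S) \<in> conf \<rightarrow>\<^sub>M conf"
proof (rule measurable_confI)
  fix B :: "(real^2) set" assume "B \<in> sets borel" "bounded B"
  then show "(\<lambda>S. card ((\<lambda>x. x - v) ` S \<inter> B)) \<in> conf \<rightarrow>\<^sub>M count_space UNIV"
    unfolding card_translate_Int by (intro measurable_card_conf translate_borel bounded_translate)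
qed (simp add: loc_finite_translate)

lemma poisson_process_translate:
  assumes "poisson_process M \<nu> \<Psi>"
  shows "poisson_process M \<nu> (\<lambda>\<omega>. (\<lambda>x. x - v) ` \<Psi> \<omega>)"
  unfolding poisson_process_def
proof (intro conjI ballI allI impI)
  fix \<omega> and B :: "(real^2) set" assume "\<omega> \<in> space M" "bounded B"
  then show "finite ((\<lambda>x. x - v) ` \<Psi> \<omega> \<inter> B)"
    using loc_finite_translate[OF poisson_process_loc_finite[OF assms]] by (simp add: loc_finite_def)
next
  fix B :: "(real^2) set" assume "B \<in> sets borel" "bounded B"
  then have B: "(\<lambda>x. x + v) ` B \<in> sets borel" "bounded ((\<lambda>x. x + v) ` B)" "measure lborel ((\<lambda>x. x + v) ` B) = measure lborel B"
    by (auto intro: translate_borel bounded_translate measure_translate)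
  show "(\<lambda>\<omega>. card ((\<lambda>x. x - v) ` \<Psi> \<omega> \<inter> B)) \<in> M \<rightarrow>\<^sub>M count_space UNIV"
    unfolding card_translate_Int using assms B by (simp add: poisson_process_def)
  show "measure M {\<omega> \<in> space M. card ((\<lambda>x. x - v) ` \<Psi> \<omega> \<inter> B) = k} = (\<nu> * measure lborel B) ^ k / fact k * exp (- (\<nu> * measure lborel B))" for k
    unfolding card_translate_Int using assms[unfolded poisson_process_def, THEN conjunct2, THEN conjunct1, rule_format, OF B(1,2)] B(3) by metis
next
  fix B :: "nat \<Rightarrow> (real^2) set" and m
  assume B: "(\<forall>i<m. B i \<in> sets borel \<and> bounded (B i)) \<and> disjoint_family_on B {..<m}"
  show "prob_space.indep_vars M (\<lambda>_. count_space UNIV) (\<lambda>i \<omega>. card ((\<lambda>x. x - v) ` \<Psi> \<omega> \<inter> B i)) {..<m}"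
    unfolding card_translate_Int
  proof (rule assms[unfolded poisson_process_def, THEN conjunct2, THEN conjunct2, rule_format])
    show "(\<forall>i<m. (\<lambda>x. x + v) ` B i \<in> sets borel \<and> bounded ((\<lambda>x. x + v) ` B i)) \<and> disjoint_family_on (\<lambda>i. (\<lambda>x. x + v) ` B i) {..<m}"
      using B by (auto simp: disjoint_family_on_def intro!: translate_borel bounded_translate) blast
  qed
qed

lemma poisson_law_translate:
  assumes "prob_space M" "poisson_process M \<nu> \<Psi>"
  shows "distr M conf (\<lambda>\<omega>. (\<lambda>x. x - v) ` \<Psi> \<omega>) = distr M conf \<Psi>"
  by (rule poisson_law_unique[OF assms(1) poisson_process_translate[OF assms(2)] assms])

section \<open>Superposition with a shifted grid\<close>

text \<open>
The integer points of the plane, indexed by a countable type.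
\<close>

definition lattice_vec :: "int \<times> int \<Rightarrow> real^2" where
  "lattice_vec z = (\<chi> i. if i = 1 then of_int (fst z) else of_int (snd z))"

lemma lattice_vec_nth [simp]: "lattice_vec z $ 1 = of_int (fst z)" "lattice_vec z $ 2 = of_int (snd z)"
  by (simp_all add: lattice_vec_def)

lemma lattice_vec_add: "lattice_vec z + lattice_vec z' = lattice_vec (fst z + fst z', snd z + snd z')"
  by (simp add: vec_eq_iff forall_2)

lemma inj_lattice_vec: "inj lattice_vec"
  by (rule injI) (auto simp: vec_eq_iff forall_2 prod_eq_iff)

lemma range_lattice_vec: "range lattice_vec = {z. \<forall>i. z $ i \<in> \<int>}"
proof (rule antisym)
  show "{z. \<forall>i. z $ i \<in> \<int>} \<subseteq> range lattice_vec"
  proof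
    fix z :: "real^2" assume "z \<in> {z. \<forall>i. z $ i \<in> \<int>}"
    then have "z = lattice_vec (\<lfloor>z $ 1\<rfloor>, \<lfloor>z $ 2\<rfloor>)" by (auto simp: vec_eq_iff forall_2 elim!: Ints_cases)
    then show "z \<in> range lattice_vec" by blast
  qed
qed (auto simp: forall_2)

lemma shifted_grid_eq: "shifted_grid s u = range (\<lambda>z. s *\<^sub>R lattice_vec z + u)"
proof -
  have "shifted_grid s u = (\<lambda>z. s *\<^sub>R z + u) ` {z. \<forall>i. z $ i \<in> \<int>}" by (auto simp: shifted_grid_def)
  then show ?thesis by (simp add: range_lattice_vec[symmetric] image_image)
qed

lemma shifted_grid_translate: "(\<lambda>x. x - v) ` shifted_grid s u = shifted_grid s (u - v)"
  by (simp add: shifted_grid_eq image_image algebra_simps)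

lemma shifted_grid_periodic: "shifted_grid s (u + s *\<^sub>R lattice_vec z) = shifted_grid s u"
proof -
  have sub: "shifted_grid s (u + s *\<^sub>R lattice_vec z) \<subseteq> shifted_grid s u" for u z
  proof
    fix x assume "x \<in> shifted_grid s (u + s *\<^sub>R lattice_vec z)"
    then obtain z' where "x = s *\<^sub>R lattice_vec z' + (u + s *\<^sub>R lattice_vec z)" by (auto simp: shifted_grid_eq)
    also have "\<dots> = s *\<^sub>R (lattice_vec z' + lattice_vec z) + u" by (simp add: algebra_simps)
    finally show "x \<in> shifted_grid s u" unfolding lattice_vec_add by (auto simp: shifted_grid_eq)
  qed
  have "u = (u + s *\<^sub>R lattice_vec z) + s *\<^sub>R lattice_vec (- fst z, - snd z)"
    by (simp add: vec_eq_iff forall_2)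
  then show ?thesis using sub[of u z] sub[of "u + s *\<^sub>R lattice_vec z" "(- fst z, - snd z)"] by (metis antisym)
qed

lemma inj_grid: "0 < s \<Longrightarrow> inj (\<lambda>z. s *\<^sub>R lattice_vec z + u)"
  using inj_lattice_vec by (auto simp: inj_def)

lemma finite_grid_bounded:
  assumes "0 < s" "bounded B"
  shows "finite {z. s *\<^sub>R lattice_vec z + u \<in> B}"
proof -
  obtain r where r: "\<And>x. x \<in> B \<Longrightarrow> norm x \<le> r" using assms(2) by (auto simp: bounded_iff)
  define N where "N = \<lceil>(r + norm u) / s\<rceil>"
  have "{z. s *\<^sub>R lattice_vec z + u \<in> B} \<subseteq> {-N..N} \<times> {-N..N}"
  proof
    fix z assume "z \<in> {z. s *\<^sub>R lattice_vec z + u \<in> B}"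
    then have "norm (s *\<^sub>R lattice_vec z + u) \<le> r" using r by auto
    then have "s * norm (lattice_vec z) \<le> r + norm u"
      using norm_triangle_ineq2[of "s *\<^sub>R lattice_vec z" "- u"] assms by simp
    then have n: "norm (lattice_vec z) \<le> (r + norm u) / s" using assms by (simp add: field_simps)
    have "\<bar>lattice_vec z $ i\<bar> \<le> (r + norm u) / s" for i using component_le_norm_cart[of "lattice_vec z" i] n by linarith
    from this[of 1] this[of 2] have "\<bar>real_of_int (fst z)\<bar> \<le> N" "\<bar>real_of_int (snd z)\<bar> \<le> N"
      unfolding N_def by (simp_all; linarith)+
    then have "\<bar>fst z\<bar> \<le> N" "\<bar>snd z\<bar> \<le> N" by linarith+
    then show "z \<in> {-N..N} \<times> {-N..N}" by (cases z) auto
  qed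
  then show ?thesis by (rule finite_subset) simp
qed

lemma loc_finite_shifted_grid: "0 < s \<Longrightarrow> loc_finite (shifted_grid s u)"
  unfolding loc_finite_def
proof (intro allI impI)
  fix B :: "(real^2) set" assume "0 < s" "bounded B"
  then have "finite ((\<lambda>z. s *\<^sub>R lattice_vec z + u) ` {z. s *\<^sub>R lattice_vec z + u \<in> B})" by (intro finite_imageI finite_grid_bounded)
  moreover have "shifted_grid s u \<inter> B \<subseteq> (\<lambda>z. s *\<^sub>R lattice_vec z + u) ` {z. s *\<^sub>R lattice_vec z + u \<in> B}" by (auto simp: shifted_grid_eq)
  ultimately show "finite (shifted_grid s u \<inter> B)" by (rule finite_subset[rotated])
qed

lemma loc_finite_Un: "loc_finite S \<Longrightarrow> loc_finite S' \<Longrightarrow> loc_finite (S \<union> S')"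
  by (auto simp: loc_finite_def Int_Un_distrib2)

text \<open>
A locally finite set is closed, so that membership of \<open>x\<close> is expressed by the numbers of points
in arbitrarily small balls near \<open>x\<close>, whose centres range over a countable set.
\<close>

lemma pred_mem_conf [measurable]: "Measurable.pred (conf \<Otimes>\<^sub>M borel) (\<lambda>z. snd z \<in> fst z)"
proof -
  obtain D :: "(real^2) set" where D: "countable D" "\<And>X. open X \<Longrightarrow> X \<noteq> {} \<Longrightarrow> \<exists>d\<in>D. d \<in> X"
    using countable_dense_setE by blast
  have iff: "snd z \<in> fst z \<longleftrightarrow> (\<forall>n::nat. \<exists>q\<in>D. dist (snd z) q < 1 / Suc n \<and> card (fst z \<inter> ball q (1 / Suc n)) \<noteq> 0)"
    if "z \<in> space (conf \<Otimes>\<^sub>M borel)" for z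
  proof
    let ?S = "fst z" and ?x = "snd z"
    have S: "loc_finite ?S" using that by (auto simp: space_pair_measure)
    { assume x: "?x \<in> ?S"
      show "\<forall>n::nat. \<exists>q\<in>D. dist ?x q < 1 / Suc n \<and> card (?S \<inter> ball q (1 / Suc n)) \<noteq> 0"
      proof
        fix n :: nat
        have "ball ?x (1 / Suc n) \<noteq> {}" by simp
        then obtain q where q: "q \<in> D" "dist ?x q < 1 / Suc n" using D(2)[of "ball ?x (1 / Suc n)"] by auto
        then have "?x \<in> ?S \<inter> ball q (1 / Suc n)" using x by (simp add: dist_commute)
        then have "card (?S \<inter> ball q (1 / Suc n)) \<noteq> 0" using loc_finiteD[OF S, of "ball q (1 / Suc n)"] by auto
        then show "\<exists>q\<in>D. dist ?x q < 1 / Suc n \<and> card (?S \<inter> ball q (1 / Suc n)) \<noteq> 0" using q by blast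
      qed }
    { assume near: "\<forall>n::nat. \<exists>q\<in>D. dist ?x q < 1 / Suc n \<and> card (?S \<inter> ball q (1 / Suc n)) \<noteq> 0"
      show "?x \<in> ?S"
      proof (rule ccontr)
        assume nx: "?x \<notin> ?S"
        have "finite (?S \<inter> cball ?x 2)" by (rule loc_finiteD[OF S]) simp
        from finite_set_avoid[OF this, of ?x] obtain \<delta> where \<delta>: "0 < \<delta>" "\<And>y. y \<in> ?S \<inter> cball ?x 2 \<Longrightarrow> \<delta> \<le> dist ?x y"
          using nx by (metis IntD1)
        obtain n :: nat where n: "2 / \<delta> < Suc n" using reals_Archimedean2 by (meson less_trans of_nat_less_iff lessI)
        from near obtain q where q: "dist ?x q < 1 / Suc n" "card (?S \<inter> ball q (1 / Suc n)) \<noteq> 0" by blast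
        then have "?S \<inter> ball q (1 / Suc n) \<noteq> {}" by auto
        then obtain y where y: "y \<in> ?S" "dist q y < 1 / Suc n" by auto
        have "dist ?x y < 2 / Suc n" using dist_triangle[of ?x y q] q(1) y(2) by simp
        moreover have "2 / real (Suc n) \<le> 2" by (simp add: divide_le_eq)
        moreover have "2 / real (Suc n) < \<delta>" using n \<delta>(1) by (simp add: field_simps)
        ultimately show False using \<delta>(2)[of y] y(1) by simp
      qed }
  qed
  have [measurable]: "(\<lambda>z. card (fst z \<inter> ball q r)) \<in> conf \<Otimes>\<^sub>M borel \<rightarrow>\<^sub>M count_space UNIV" for q :: "real^2" and r
    by (rule measurable_compose[OF measurable_fst measurable_card_conf]) auto
  show ?thesis
    by (subst measurable_cong[OF iff]) (use D(1) in \<open>measurable\<close>)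
qed

text \<open>
Grid points that belong to the configuration already must not be counted twice. The remaining
grid points are counted through their indices.
\<close>

lemma measurable_Un_grid:
  assumes s: "0 < s"
  shows "(\<lambda>z. fst z \<union> shifted_grid s (snd z)) \<in> conf \<Otimes>\<^sub>M borel \<rightarrow>\<^sub>M conf"
proof (rule measurable_confI)
  fix z assume "z \<in> space (conf \<Otimes>\<^sub>M (borel :: (real^2) measure))"
  then show "loc_finite (fst z \<union> shifted_grid s (snd z))"
    by (intro loc_finite_Un loc_finite_shifted_grid s) (auto simp: space_pair_measure)
next
  fix B :: "(real^2) set" assume B[measurable]: "B \<in> sets borel" and bB: "bounded B"
  define pt where "pt n u = s *\<^sub>R lattice_vec (from_nat n) + u" for n u
  define new where "new z = {n. to_nat (from_nat n :: int \<times> int) = n \<and> pt n (snd z) \<in> B \<and> pt n (snd z) \<notin> fst z}" for z :: "(real^2) set \<times> (real^2)"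
  have [measurable]: "(\<lambda>z. card (fst z \<inter> B)) \<in> conf \<Otimes>\<^sub>M (borel :: (real^2) measure) \<rightarrow>\<^sub>M count_space UNIV"
    by (rule measurable_compose[OF measurable_fst measurable_card_conf]) (use B bB in auto)
  have [measurable]: "{z \<in> space (conf \<Otimes>\<^sub>M borel). n \<in> new z} \<in> sets (conf \<Otimes>\<^sub>M borel)" for n
  proof -
    have "(\<lambda>z. (fst z, pt n (snd z))) \<in> conf \<Otimes>\<^sub>M borel \<rightarrow>\<^sub>M conf \<Otimes>\<^sub>M borel" unfolding pt_def by measurable
    from measurable_compose[OF this pred_mem_conf]
    have [measurable]: "Measurable.pred (conf \<Otimes>\<^sub>M borel) (\<lambda>z. pt n (snd z) \<in> fst z)" by simp
    have [measurable]: "Measurable.pred (conf \<Otimes>\<^sub>M borel) (\<lambda>z. pt n (snd z) \<in> B)" unfolding pt_def by measurable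
    show ?thesis unfolding new_def mem_Collect_eq by measurable
  qed
  have eq: "card ((fst z \<union> shifted_grid s (snd z)) \<inter> B) = card (fst z \<inter> B) + card (new z)"
    if "z \<in> space (conf \<Otimes>\<^sub>M borel)" for z
  proof -
    have S: "loc_finite (fst z)" using that by (auto simp: space_pair_measure)
    have new: "(\<lambda>n. pt n (snd z)) ` new z = (shifted_grid s (snd z) - fst z) \<inter> B"
    proof (intro antisym subsetI)
      fix x assume "x \<in> (shifted_grid s (snd z) - fst z) \<inter> B"
      then obtain k where k: "x = s *\<^sub>R lattice_vec k + snd z" "x \<notin> fst z" "x \<in> B" by (auto simp: shifted_grid_eq)
      then have "x = pt (to_nat k) (snd z)" "to_nat k \<in> new z" by (auto simp: pt_def new_def)
      then show "x \<in> (\<lambda>n. pt n (snd z)) ` new z" by blast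
    qed (auto simp: new_def pt_def shifted_grid_eq)
    have inj: "inj_on (\<lambda>n. pt n (snd z)) (new z)"
    proof (rule inj_onI)
      fix n m assume nm: "n \<in> new z" "m \<in> new z" "pt n (snd z) = pt m (snd z)"
      then have "(from_nat n :: int \<times> int) = from_nat m"
        unfolding pt_def by (blast dest: injD[OF inj_grid[OF s]])
      then show "n = m" using nm(1,2) unfolding new_def by (metis (mono_tags, lifting) mem_Collect_eq)
    qed
    have "(fst z \<union> shifted_grid s (snd z)) \<inter> B = (fst z \<inter> B) \<union> (\<lambda>n. pt n (snd z)) ` new z"
      unfolding new by blast
    moreover have "(fst z \<inter> B) \<inter> (\<lambda>n. pt n (snd z)) ` new z = {}" unfolding new by blast
    moreover have "finite ((\<lambda>n. pt n (snd z)) ` new z)"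
      unfolding new by (rule finite_subset[OF _ loc_finiteD[OF loc_finite_shifted_grid[OF s, of "snd z"] bB]]) blast
    ultimately show ?thesis
      using loc_finiteD[OF S bB] card_image[OF inj] by (simp add: card_Un_disjoint)
  qed
  show "(\<lambda>z. card ((fst z \<union> shifted_grid s (snd z)) \<inter> B)) \<in> conf \<Otimes>\<^sub>M borel \<rightarrow>\<^sub>M count_space UNIV"
    by (subst measurable_cong[OF eq]) measurable
qed

section \<open>Stationarity\<close>

text \<open>
The half-open cells, in contrast to closed ones, form a partition of the plane.
\<close>

definition cell :: "real \<Rightarrow> int \<times> int \<Rightarrow> (real^2) set" where
  "cell s z = {x. \<lfloor>x $ 1 / s\<rfloor> = fst z \<and> \<lfloor>x $ 2 / s\<rfloor> = snd z}"

lemma cell_borel [measurable]: "cell s z \<in> sets borel"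
proof -
  have "cell s z = {x \<in> space borel. \<lfloor>x $ 1 / s\<rfloor> = fst z \<and> \<lfloor>x $ 2 / s\<rfloor> = snd z}" by (simp add: cell_def)
  also have "\<dots> \<in> sets borel" by measurable
  finally show ?thesis .
qed

lemma add_lattice_mem_cell:
  assumes "0 < s"
  shows "x + s *\<^sub>R lattice_vec k \<in> cell s z \<longleftrightarrow> x \<in> cell s (fst z - fst k, snd z - snd k)"
  using assms by (auto simp: cell_def add_divide_distrib)

lemma cell_iff:
  assumes "0 < s"
  shows "x \<in> cell s z \<longleftrightarrow> s * fst z \<le> x $ 1 \<and> x $ 1 < s * (fst z + 1) \<and> s * snd z \<le> x $ 2 \<and> x $ 2 < s * (snd z + 1)"
  using assms by (auto simp: cell_def floor_eq_iff field_simps)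

text \<open>
Both \<open>Q\<close> and its translate \<open>Q - v\<close> are fundamental domains of the lattice. Cut \<open>Q - v\<close> along the
lattice translates of \<open>Q\<close>, move every piece into \<open>Q\<close>, and use the periodicity of \<open>H\<close>; the pieces
fill \<open>Q\<close>.
\<close>

lemma nn_integral_periodic_translate:
  fixes H :: "real^2 \<Rightarrow> ennreal"
  assumes s: "0 < s" and H[measurable]: "H \<in> borel_measurable borel"
    and per: "\<And>u z. H (u + s *\<^sub>R lattice_vec z) = H u"
  shows "(\<integral>\<^sup>+u. H (u - v) * indicator (cell s (0, 0)) u \<partial>lborel) = (\<integral>\<^sup>+u. H u * indicator (cell s (0, 0)) u \<partial>lborel)"
proof -
  let ?Q = "cell s (0, 0)"
  let ?C = "count_space (UNIV :: (int \<times> int) set)"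
  have one: "(\<integral>\<^sup>+z. indicator ?Q (x + s *\<^sub>R lattice_vec z) \<partial>?C) = 1" for x
  proof -
    have "(\<integral>\<^sup>+z. indicator ?Q (x + s *\<^sub>R lattice_vec z) \<partial>?C) = (\<integral>\<^sup>+z. indicator {(- \<lfloor>x $ 1 / s\<rfloor>, - \<lfloor>x $ 2 / s\<rfloor>)} z \<partial>?C)"
    proof (intro nn_integral_cong)
      fix z :: "int \<times> int"
      have "x + s *\<^sub>R lattice_vec z \<in> ?Q \<longleftrightarrow> z \<in> {(- \<lfloor>x $ 1 / s\<rfloor>, - \<lfloor>x $ 2 / s\<rfloor>)}"
        unfolding add_lattice_mem_cell[OF s] by (auto simp: cell_def prod_eq_iff)
      then show "indicator ?Q (x + s *\<^sub>R lattice_vec z) = (indicator {(- \<lfloor>x $ 1 / s\<rfloor>, - \<lfloor>x $ 2 / s\<rfloor>)} z :: ennreal)"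
        unfolding indicator_def by simp
    qed
    then show ?thesis by simp
  qed
  have lborel_shift: "(\<integral>\<^sup>+u. f (u + w) \<partial>lborel) = (\<integral>\<^sup>+u. f u \<partial>lborel)" if "f \<in> borel_measurable borel" for f :: "real^2 \<Rightarrow> ennreal" and w
    by (subst (2) lborel_distr_plus[of w, symmetric]) (use that in \<open>simp add: nn_integral_distr add.commute\<close>)
  have [measurable]: "Measurable.pred borel (\<lambda>u. u + w \<in> ?Q)" for w by measurable
  have "(\<integral>\<^sup>+u. H (u - v) * indicator ?Q u \<partial>lborel) = (\<integral>\<^sup>+u. H (u + v - v) * indicator ?Q (u + v) \<partial>lborel)"
    by (rule lborel_shift[symmetric]) measurable
  also have "\<dots> = (\<integral>\<^sup>+u. \<integral>\<^sup>+z. H u * indicator ?Q (u + v) * indicator ?Q (u + s *\<^sub>R lattice_vec z) \<partial>?C \<partial>lborel)"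
    by (simp add: nn_integral_cmult one)
  also have "\<dots> = (\<integral>\<^sup>+z. \<integral>\<^sup>+u. H u * indicator ?Q (u + v) * indicator ?Q (u + s *\<^sub>R lattice_vec z) \<partial>lborel \<partial>?C)"
    by (rule nn_integral_count_space_nn_integral) auto
  also have "\<dots> = (\<integral>\<^sup>+z. \<integral>\<^sup>+u. H u * indicator ?Q (u - s *\<^sub>R lattice_vec z + v) * indicator ?Q u \<partial>lborel \<partial>?C)"
  proof (rule nn_integral_cong)
    fix z
    have "(\<integral>\<^sup>+u. H u * indicator ?Q (u + v) * indicator ?Q (u + s *\<^sub>R lattice_vec z) \<partial>lborel)
       = (\<integral>\<^sup>+u. H (u + s *\<^sub>R lattice_vec z) * indicator ?Q (u + s *\<^sub>R lattice_vec z - s *\<^sub>R lattice_vec z + v) * indicator ?Q (u + s *\<^sub>R lattice_vec z) \<partial>lborel)"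
      by (simp add: per)
    also have "\<dots> = (\<integral>\<^sup>+u. H u * indicator ?Q (u - s *\<^sub>R lattice_vec z + v) * indicator ?Q u \<partial>lborel)"
      by (rule lborel_shift) measurable
    finally show "(\<integral>\<^sup>+u. H u * indicator ?Q (u + v) * indicator ?Q (u + s *\<^sub>R lattice_vec z) \<partial>lborel)
       = (\<integral>\<^sup>+u. H u * indicator ?Q (u - s *\<^sub>R lattice_vec z + v) * indicator ?Q u \<partial>lborel)" .
  qed
  also have "\<dots> = (\<integral>\<^sup>+u. \<integral>\<^sup>+z. H u * indicator ?Q (u - s *\<^sub>R lattice_vec z + v) * indicator ?Q u \<partial>?C \<partial>lborel)"
    by (rule nn_integral_count_space_nn_integral[symmetric]) auto
  also have "\<dots> = (\<integral>\<^sup>+u. H u * indicator ?Q u * (\<integral>\<^sup>+z. indicator ?Q (u + v - s *\<^sub>R lattice_vec z) \<partial>?C) \<partial>lborel)"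
    by (intro nn_integral_cong) (simp add: nn_integral_cmult[symmetric] algebra_simps)
  also have "(\<lambda>u. \<integral>\<^sup>+z. indicator ?Q (u + v - s *\<^sub>R lattice_vec z) \<partial>?C) = (\<lambda>u. \<integral>\<^sup>+z. indicator ?Q (u + v + s *\<^sub>R lattice_vec z) \<partial>?C)"
  proof
    fix u
    have "bij (\<lambda>z::int \<times> int. (- fst z, - snd z))" by (rule involuntory_imp_bij) simp
    then have "(\<integral>\<^sup>+z. indicator ?Q (u + v + s *\<^sub>R lattice_vec (- fst z, - snd z)) \<partial>?C) = (\<integral>\<^sup>+z. indicator ?Q (u + v + s *\<^sub>R lattice_vec z) \<partial>?C :: ennreal)"
      by (rule nn_integral_bij_count_space)
    moreover have "s *\<^sub>R lattice_vec (- fst z, - snd z) = - (s *\<^sub>R lattice_vec z)" for z by (simp add: vec_eq_iff forall_2)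
    ultimately show "(\<integral>\<^sup>+z. indicator ?Q (u + v - s *\<^sub>R lattice_vec z) \<partial>?C) = (\<integral>\<^sup>+z. indicator ?Q (u + v + s *\<^sub>R lattice_vec z) \<partial>?C :: ennreal)"
      by simp
  qed
  finally show ?thesis by (simp add: one)
qed


text \<open>
The closed square that carries the uniform law and the half-open cell differ by a part of two lines.
\<close>

lemma AE_lborel_cbox_cell:
  assumes s: "0 < s"
  shows "AE x in lborel. x \<in> cbox 0 (\<chi> i. s) \<longleftrightarrow> x \<in> cell s (0, 0)"
proof -
  have null: "AE x in lborel. x $ i \<noteq> s" for i :: 2
  proof -
    have "{x :: real^2. x \<bullet> axis i 1 = s} \<in> null_sets lborel"
      using negligible_standard_hyperplane[of "axis i 1 :: real^2" s]
      by (simp add: negligible_iff_null_sets null_sets_completion_iff axis_in_Basis_iff inner_commute)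
    from AE_not_in[OF this] show ?thesis by eventually_elim (simp add: inner_axis)
  qed
  show ?thesis
    using null[of 1] null[of 2]
    by eventually_elim (use s in \<open>auto simp: cell_iff cbox_def mem_box_cart forall_2 Basis_vec_def inner_axis less_le\<close>)
qed

text \<open>
Translation of the superposition by \<open>v\<close> amounts to the translation of the Poisson process and of the grid.
The law of the former does not change. For the latter, the probability of an event as a function
of the shift is periodic.
\<close>

theorem superposition_law_translate:
  fixes M :: "'w measure"
  assumes "prob_space M" and P: "poisson_process M \<nu> \<Psi>" and s: "0 < s"
    and dU: "distr M borel U = uniform_measure lborel (cbox 0 (\<chi> i. s))"
    and ind: "indep_of_process M \<Psi> borel U"
  shows "distr M conf (\<lambda>\<omega>. (\<lambda>x. x - v) ` (\<Psi> \<omega> \<union> shifted_grid s (U \<omega>))) = distr M conf (\<lambda>\<omega>. \<Psi> \<omega> \<union> shifted_grid s (U \<omega>))"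
proof (rule measure_eqI)
  interpret prob_space M by fact
  note [measurable] = poisson_process_measurable[OF P] measurable_Un_grid[OF s]
  have U[measurable]: "U \<in> borel_measurable M" using ind by (simp add: indep_of_process_def)
  define J where "J z = fst z \<union> shifted_grid s (snd z)" for z :: "(real^2) set \<times> (real^2)"
  have J[measurable]: "J \<in> conf \<Otimes>\<^sub>M borel \<rightarrow>\<^sub>M conf" unfolding J_def using measurable_Un_grid[OF s] .
  let ?P = "distr M conf \<Psi>" and ?U = "distr M borel U"
  interpret P: prob_space ?P by (rule prob_space_distr) simp
  interpret U: prob_space ?U by (rule prob_space_distr) simp
  interpret PU: pair_prob_space ?P ?U ..
  have joint: "?P \<Otimes>\<^sub>M ?U = distr M (conf \<Otimes>\<^sub>M borel) (\<lambda>\<omega>. (\<Psi> \<omega>, U \<omega>))"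
  proof (rule pair_measure_eqI)
    fix A B assume AB: "A \<in> sets ?P" "B \<in> sets ?U"
    then have [measurable]: "A \<in> sets conf" "B \<in> sets borel" by simp_all
    have "\<Psi> -` A \<inter> space M \<in> sets (process_algebra M \<Psi>)"
      using AB by (subst process_algebra_eq_vimage) (auto simp: poisson_process_loc_finite[OF P] intro: in_vimage_algebra)
    then have "prob ((\<Psi> -` A \<inter> space M) \<inter> (U -` B \<inter> space M)) = prob (\<Psi> -` A \<inter> space M) * prob (U -` B \<inter> space M)"
      using ind AB by (intro indep_setD[of "sets (process_algebra M \<Psi>)" "{U -` B \<inter> space M | B. B \<in> sets borel}"]) (auto simp: indep_of_process_def)
    moreover have "(\<lambda>\<omega>. (\<Psi> \<omega>, U \<omega>)) -` (A \<times> B) \<inter> space M = (\<Psi> -` A \<inter> space M) \<inter> (U -` B \<inter> space M)" by auto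
    ultimately show "emeasure ?P A * emeasure ?U B = emeasure (distr M (conf \<Otimes>\<^sub>M borel) (\<lambda>\<omega>. (\<Psi> \<omega>, U \<omega>))) (A \<times> B)"
      by (simp add: emeasure_distr emeasure_eq_measure ennreal_mult'[symmetric])
  qed (simp_all add: P.sigma_finite_measure_axioms U.sigma_finite_measure_axioms)
  fix A assume "A \<in> sets (distr M conf (\<lambda>\<omega>. (\<lambda>x. x - v) ` (\<Psi> \<omega> \<union> shifted_grid s (U \<omega>))))"
  then have A[measurable]: "A \<in> sets conf" by simp
  define H where "H u = (\<integral>\<^sup>+S. indicator A (J (S, u)) \<partial>?P)" for u
  have H[measurable]: "H \<in> borel_measurable borel" unfolding H_def by measurable
  have per: "H (u + s *\<^sub>R lattice_vec z) = H u" for u z by (simp add: H_def J_def shifted_grid_periodic)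
  have unif: "(\<integral>\<^sup>+u. f u \<partial>?U) = (\<integral>\<^sup>+u. f u * indicator (cell s (0, 0)) u \<partial>lborel) / emeasure lborel (cbox 0 (\<chi> i. s) :: (real^2) set)"
    if [measurable]: "f \<in> borel_measurable borel" for f
    unfolding dU by (subst nn_integral_uniform_measure)
      (auto intro!: arg_cong2[where f="(/)"] nn_integral_cong_AE intro: AE_mp[OF AE_lborel_cbox_cell[OF s]] simp: indicator_def)
  have ind_distr: "emeasure (distr M conf f) A = (\<integral>\<^sup>+\<omega>. indicator A (f \<omega>) \<partial>M)" if "f \<in> M \<rightarrow>\<^sub>M conf" for f
  proof -
    have "(\<integral>\<^sup>+\<omega>. indicator A (f \<omega>) \<partial>M) = (\<integral>\<^sup>+S. indicator A S \<partial>distr M conf f)"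
      by (rule nn_integral_distr[symmetric]) (use that in auto)
    then show ?thesis by simp
  qed
  have J_comp: "(\<lambda>\<omega>. J (\<Psi> \<omega>, U \<omega>)) \<in> M \<rightarrow>\<^sub>M conf" by measurable
  have J_tr: "(\<lambda>x. x - v) ` J (S, u) = J ((\<lambda>x. x - v) ` S, u - v)" for S u
    by (simp add: J_def image_Un shifted_grid_translate)
  have tr: "(\<integral>\<^sup>+S. indicator A (J ((\<lambda>x. x - v) ` S, u - v)) \<partial>?P) = H (u - v)" for u
  proof -
    have "?P = distr ?P conf (\<lambda>S. (\<lambda>x. x - v) ` S)"
      using poisson_law_translate[OF \<open>prob_space M\<close> P, of v] by (simp add: distr_distr comp_def)
    then have "H (u - v) = (\<integral>\<^sup>+S. indicator A (J (S, u - v)) \<partial>distr ?P conf (\<lambda>S. (\<lambda>x. x - v) ` S))"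
      unfolding H_def by simp
    also have "\<dots> = (\<integral>\<^sup>+S. indicator A (J ((\<lambda>x. x - v) ` S, u - v)) \<partial>?P)"
      by (rule nn_integral_distr) measurable
    finally show ?thesis ..
  qed
  have "emeasure (distr M conf (\<lambda>\<omega>. (\<lambda>x. x - v) ` (\<Psi> \<omega> \<union> shifted_grid s (U \<omega>)))) A
      = (\<integral>\<^sup>+\<omega>. indicator A (J ((\<lambda>x. x - v) ` \<Psi> \<omega>, U \<omega> - v)) \<partial>M)"
    using ind_distr[OF measurable_compose[OF J_comp measurable_translate[of v]]]
    by (simp add: J_def image_Un shifted_grid_translate)
  also have "\<dots> = (\<integral>\<^sup>+z. indicator A (J ((\<lambda>x. x - v) ` fst z, snd z - v)) \<partial>(?P \<Otimes>\<^sub>M ?U))"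
    unfolding joint by (subst nn_integral_distr) auto
  also have "\<dots> = (\<integral>\<^sup>+u. \<integral>\<^sup>+S. indicator A (J ((\<lambda>x. x - v) ` S, u - v)) \<partial>?P \<partial>?U)"
    by (subst PU.nn_integral_snd[symmetric]) auto
  also have "\<dots> = (\<integral>\<^sup>+u. H (u - v) \<partial>?U)" by (simp add: tr)
  also have "\<dots> = (\<integral>\<^sup>+u. H u \<partial>?U)"
    by (simp add: unif nn_integral_periodic_translate[OF s H per])
  also have "\<dots> = (\<integral>\<^sup>+z. indicator A (J z) \<partial>(?P \<Otimes>\<^sub>M ?U))"
    unfolding H_def by (subst PU.nn_integral_snd[symmetric]) auto
  also have "\<dots> = (\<integral>\<^sup>+\<omega>. indicator A (J (\<Psi> \<omega>, U \<omega>)) \<partial>M)"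
    unfolding joint by (subst nn_integral_distr) auto
  also have "\<dots> = emeasure (distr M conf (\<lambda>\<omega>. \<Psi> \<omega> \<union> shifted_grid s (U \<omega>))) A"
    using ind_distr[OF J_comp] by (simp add: J_def)
  finally show "emeasure (distr M conf (\<lambda>\<omega>. (\<lambda>x. x - v) ` (\<Psi> \<omega> \<union> shifted_grid s (U \<omega>)))) A
     = emeasure (distr M conf (\<lambda>\<omega>. \<Psi> \<omega> \<union> shifted_grid s (U \<omega>))) A" .
qed simp

section \<open>Waiting for a direct transmission\<close>

text \<open>
A single coordinate is independent of an event in which it does not occur: replacing that
coordinate by the one of an independent copy leaves the law unchanged.
\<close>

lemma emeasure_PiM_coordinate_split:
  fixes N :: "'b measure" and i :: 'i
  assumes N: "prob_space N" and B: "B \<in> sets N" and Z: "Z \<in> sets (\<Pi>\<^sub>M _\<in>UNIV. N)"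
    and free: "\<And>f g. (\<And>k. k \<noteq> i \<Longrightarrow> f k = g k) \<Longrightarrow> f \<in> Z \<Longrightarrow> g \<in> space (\<Pi>\<^sub>M _\<in>UNIV. N) \<Longrightarrow> g \<in> Z"
  shows "emeasure (\<Pi>\<^sub>M _\<in>UNIV. N) {f \<in> Z. f i \<in> B} = emeasure N B * emeasure (\<Pi>\<^sub>M _\<in>UNIV. N) Z"
proof -
  let ?P = "\<Pi>\<^sub>M _\<in>(UNIV :: 'i set). N" and ?t = "splice (\<lambda>k. k = i) (\<lambda>k. k) (\<lambda>k. k) :: ('i \<Rightarrow> 'b) \<times> ('i \<Rightarrow> 'b) \<Rightarrow> 'i \<Rightarrow> 'b"
  interpret P: prob_space ?P by (intro prob_space_PiM N)
  have comp: "(\<lambda>f. f i) \<in> ?P \<rightarrow>\<^sub>M N" by simp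
  have ZB: "{f \<in> Z. f i \<in> B} \<in> sets ?P"
  proof -
    have "{f \<in> Z. f i \<in> B} = Z \<inter> ((\<lambda>f. f i) -` B \<inter> space ?P)" using sets.sets_into_space[OF Z] by auto
    then show ?thesis using Z measurable_sets[OF comp B] by simp
  qed
  have "emeasure ?P {f \<in> Z. f i \<in> B} = emeasure (distr (?P \<Otimes>\<^sub>M ?P) ?P ?t) {f \<in> Z. f i \<in> B}"
    by (subst distr_splice[OF N]) auto
  also have "\<dots> = emeasure (?P \<Otimes>\<^sub>M ?P) (?t -` {f \<in> Z. f i \<in> B} \<inter> space (?P \<Otimes>\<^sub>M ?P))"
    using ZB by (simp add: emeasure_distr)
  also have "?t -` {f \<in> Z. f i \<in> B} \<inter> space (?P \<Otimes>\<^sub>M ?P) = ((\<lambda>f. f i) -` B \<inter> space ?P) \<times> Z"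
  proof (intro set_eqI iffI)
    fix z assume z: "z \<in> ?t -` {f \<in> Z. f i \<in> B} \<inter> space (?P \<Otimes>\<^sub>M ?P)"
    then have sp: "fst z \<in> space ?P" "snd z \<in> space ?P" by (auto simp: space_pair_measure)
    have "snd z \<in> Z" by (rule free[of "?t z"]) (use z sp in \<open>auto simp: splice_def case_prod_beta'\<close>)
    then show "z \<in> ((\<lambda>f. f i) -` B \<inter> space ?P) \<times> Z"
      using z sp by (cases z) (auto simp: splice_def)
  next
    fix z assume z: "z \<in> ((\<lambda>f. f i) -` B \<inter> space ?P) \<times> Z"
    then have sp: "z \<in> space (?P \<Otimes>\<^sub>M ?P)" using sets.sets_into_space[OF Z] by (auto simp: space_pair_measure)
    have tz: "?t z \<in> space ?P" by (rule measurable_space[OF measurable_splice sp])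
    have "?t z \<in> Z" by (rule free[of "snd z"]) (use z tz in \<open>auto simp: splice_def case_prod_beta'\<close>)
    then show "z \<in> ?t -` {f \<in> Z. f i \<in> B} \<inter> space (?P \<Otimes>\<^sub>M ?P)"
      using z sp by (cases z) (auto simp: splice_def)
  qed
  also have "emeasure (?P \<Otimes>\<^sub>M ?P) \<dots> = emeasure ?P ((\<lambda>f. f i) -` B \<inter> space ?P) * emeasure ?P Z"
    using Z measurable_sets[OF comp B] by (rule P.emeasure_pair_measure_Times[rotated])
  also have "emeasure ?P ((\<lambda>f. f i) -` B \<inter> space ?P) = emeasure (distr ?P N (\<lambda>f. f i)) B"
    using B by (simp add: emeasure_distr)
  also have "distr ?P N (\<lambda>f. f i) = N" by (rule distr_PiM_component) (use N in auto)
  finally show ?thesis .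
qed

context sinr_model
begin

lemma emeasure_eq_nn_integral_if:
  assumes "Measurable.pred K P"
  shows "emeasure K {mk \<in> space K. P mk} = (\<integral>\<^sup>+mk. (if P mk then 1 else 0) \<partial>K)"
proof -
  have "(\<integral>\<^sup>+mk. (if P mk then 1 else 0) \<partial>K) = (\<integral>\<^sup>+mk. indicator {mk \<in> space K. P mk} mk \<partial>K)"
    by (rule nn_integral_cong) (simp add: indicator_def)
  then show ?thesis using assms by simp
qed

text \<open>
Splicing at time \<open>1\<close> separates the first slot from the others, which start afresh.
\<close>

lemma prob_no_direct_transmission:
  "K.prob {mk \<in> space K. \<forall>m<n. \<not> conn l T X mk i j (int m)} = (1 - K.prob {mk \<in> space K. conn l T X mk i j 0}) ^ n"
proof (induction n)
  case 0
  show ?case by (simp add: K.prob_space)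
next
  case (Suc n)
  let ?q = "K.prob {mk \<in> space K. conn l T X mk i j 0}"
  have [measurable]: "Measurable.pred K (\<lambda>mk. \<forall>m<n. \<not> conn l T X mk i j (int m))" for n by measurable
  let ?I = "\<lambda>P. if P then 1 else 0 :: ennreal"
  note em = emeasure_eq_nn_integral_if
  have "emeasure K {mk \<in> space K. \<forall>m<Suc n. \<not> conn l T X mk i j (int m)} = (\<integral>\<^sup>+mk. ?I (\<forall>m<Suc n. \<not> conn l T X mk i j (int m)) \<partial>K)"
    by (rule em) measurable
  also have "\<dots> = (\<integral>\<^sup>+u. \<integral>\<^sup>+v. ?I (\<forall>m<Suc n. \<not> conn l T X (splice_time 1 (u, v)) i j (int m)) \<partial>K \<partial>K)"
    by (rule nn_integral_splice_time) measurable
  also have "\<dots> = (\<integral>\<^sup>+u. \<integral>\<^sup>+v. ?I (\<not> conn l T X u i j 0) * ?I (\<forall>m<n. \<not> conn l T X v i j (int m)) \<partial>K \<partial>K)"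
  proof (intro nn_integral_cong)
    fix u v
    have "(\<forall>m<Suc n. \<not> conn l T X (splice_time 1 (u, v)) i j (int m)) \<longleftrightarrow>
        \<not> conn l T X u i j 0 \<and> (\<forall>m<n. \<not> conn l T X v i j (int m))"
      using conn_splice_time_less[of 0 1 l T X u v i j]
      by (simp add: All_less_Suc2 conn_splice_time_ge)
    then show "?I (\<forall>m<Suc n. \<not> conn l T X (splice_time 1 (u, v)) i j (int m)) = ?I (\<not> conn l T X u i j 0) * ?I (\<forall>m<n. \<not> conn l T X v i j (int m))"
      by simp
  qed
  also have "\<dots> = (\<integral>\<^sup>+u. ?I (\<not> conn l T X u i j 0) \<partial>K) * (\<integral>\<^sup>+v. ?I (\<forall>m<n. \<not> conn l T X v i j (int m)) \<partial>K)"
    by (simp add: nn_integral_cmult nn_integral_multc)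
  also have "\<dots> = emeasure K {mk \<in> space K. \<not> conn l T X mk i j 0} * emeasure K {mk \<in> space K. \<forall>m<n. \<not> conn l T X mk i j (int m)}"
    by (simp add: em)
  finally have "K.prob {mk \<in> space K. \<forall>m<Suc n. \<not> conn l T X mk i j (int m)}
      = K.prob {mk \<in> space K. \<not> conn l T X mk i j 0} * K.prob {mk \<in> space K. \<forall>m<n. \<not> conn l T X mk i j (int m)}"
    by (simp add: K.emeasure_eq_measure ennreal_mult'[symmetric] del: ennreal_mult')
  moreover have "K.prob {mk \<in> space K. \<not> conn l T X mk i j 0} = 1 - ?q"
    by (rule K.prob_neg) measurable
  ultimately show ?case using Suc by simp
qed

text \<open>
Waiting at \<open>i\<close> until the first slot in which the direct transmission succeeds is a path to \<open>j\<close>. The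
sum counts the slots up to and including that slot.
\<close>

lemma delay_le_waiting_time:
  "delay l T X mk 0 i j \<le> (\<Sum>n. if \<forall>m<n. \<not> conn l T X mk i j (int m) then 1 else 0)"
proof (cases "\<exists>m::nat. conn l T X mk i j (int m)")
  case True
  define m where "m = (LEAST m. conn l T X mk i j (int m))"
  have m: "conn l T X mk i j (int m)" unfolding m_def using True by (rule LeastI_ex)
  have min: "\<not> conn l T X mk i j (int k)" if "k < m" for k using that not_less_Least unfolding m_def by blast
  have "hop l T X mk 0 (Suc m) i j" using m hop_stay[of l T X mk 0 m i] by auto
  then have "delay l T X mk 0 i j \<le> of_nat (Suc m)" by (intro delay_le) auto
  also have "\<dots> = (\<Sum>n<Suc m. if \<forall>m<n. \<not> conn l T X mk i j (int m) then 1 else 0)"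
    using min by simp
  also have "\<dots> \<le> (\<Sum>n. if \<forall>m<n. \<not> conn l T X mk i j (int m) then 1 else 0)" by (rule sum_le_suminf) auto
  finally show ?thesis .
next
  case False
  have "(of_nat N :: ennreal) \<le> (\<Sum>n. if \<forall>m<n. \<not> conn l T X mk i j (int m) then 1 else 0)" for N
    using sum_le_suminf[of "\<lambda>n. if \<forall>m<n. \<not> conn l T X mk i j (int m) then 1 else 0 :: ennreal" "{..<N}"] False by simp
  then have "(SUP N. of_nat N :: ennreal) \<le> (\<Sum>n. if \<forall>m<n. \<not> conn l T X mk i j (int m) then 1 else 0)" by (rule SUP_least)
  then show ?thesis by (simp add: ennreal_SUP_of_nat_eq_top top_unique)
qed

text \<open>
The waiting time for a direct transmission is geometric.
\<close>

lemma mean_hops_le_inverse: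
  assumes q: "0 < K.prob {mk \<in> space K. conn l T X mk i j 0}"
  shows "mean_hops X i j \<le> ennreal (1 / K.prob {mk \<in> space K. conn l T X mk i j 0})"
proof -
  let ?q = "K.prob {mk \<in> space K. conn l T X mk i j 0}"
  have [measurable]: "Measurable.pred K (\<lambda>mk. \<forall>m<n. \<not> conn l T X mk i j (int m))" for n by measurable
  have "mean_hops X i j \<le> (\<integral>\<^sup>+mk. (\<Sum>n. if \<forall>m<n. \<not> conn l T X mk i j (int m) then 1 else 0) \<partial>K)"
    unfolding mean_hops_def by (rule nn_integral_mono) (rule delay_le_waiting_time)
  also have "\<dots> = (\<Sum>n. \<integral>\<^sup>+mk. (if \<forall>m<n. \<not> conn l T X mk i j (int m) then 1 else 0) \<partial>K)"
    by (rule nn_integral_suminf) measurable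
  also have "\<dots> = (\<Sum>n. ennreal ((1 - ?q) ^ n))"
  proof (rule suminf_cong)
    fix n
    have "(\<integral>\<^sup>+mk. (if \<forall>m<n. \<not> conn l T X mk i j (int m) then 1 else 0) \<partial>K) = emeasure K {mk \<in> space K. \<forall>m<n. \<not> conn l T X mk i j (int m)}"
      by (rule emeasure_eq_nn_integral_if[symmetric]) measurable
    then show "(\<integral>\<^sup>+mk. (if \<forall>m<n. \<not> conn l T X mk i j (int m) then 1 else 0) \<partial>K) = ennreal ((1 - ?q) ^ n)"
      by (simp add: K.emeasure_eq_measure prob_no_direct_transmission)
  qed
  also have "\<dots> = ennreal (\<Sum>n. (1 - ?q) ^ n)"
    by (rule suminf_ennreal2) (use q in \<open>auto intro!: summable_geometric\<close>)
  also have "(\<Sum>n. (1 - ?q) ^ n) = 1 / ?q"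
    using suminf_geometric[of "1 - ?q"] q by simp
  finally show ?thesis .
qed

end

section \<open>Exponential fading and power-law path loss\<close>

text \<open>
Up to a constant factor this dominates \<open>norm x powr (- \<beta>)\<close> far from the origin. In contrast to that power it is a
product of functions of the coordinates, which reduces its summability over the lattice to
one dimension, where the exponent is \<open>\<beta> / 2 > 1\<close>.
\<close>

definition decay :: "real \<Rightarrow> real^2 \<Rightarrow> real" where
  "decay \<beta> x = ((1 + \<bar>x $ 1\<bar>) * (1 + \<bar>x $ 2\<bar>)) powr (- \<beta> / 2)"

lemma decay_pos: "0 < decay \<beta> x"
proof -
  have "0 < (1 + \<bar>x $ 1\<bar>) * (1 + \<bar>x $ 2\<bar>)" by (intro mult_pos_pos add_pos_nonneg) auto
  then show ?thesis unfolding decay_def powr_gt_zero by (rule less_imp_neq[symmetric])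
qed

lemma decay_lower:
  assumes "0 < \<beta>" "norm x \<le> r"
  shows "(1 + r) powr (- \<beta>) \<le> decay \<beta> x"
proof -
  have c: "\<bar>x $ i\<bar> \<le> r" for i using component_le_norm_cart[of x i] assms(2) by linarith
  have r: "0 \<le> r" using norm_ge_zero[of x] assms(2) by linarith
  have "(1 + \<bar>x $ 1\<bar>) * (1 + \<bar>x $ 2\<bar>) \<le> (1 + r) * (1 + r)" using c r by (intro mult_mono) auto
  then have "((1 + r) * (1 + r)) powr (- \<beta> / 2) \<le> decay \<beta> x"
    unfolding decay_def using assms(1) by (intro powr_mono2') (auto intro!: mult_pos_pos add_pos_nonneg)
  moreover have "((1 + r) * (1 + r)) powr (- \<beta> / 2) = (1 + r) powr (- \<beta>)"
    using r by (simp add: powr_mult powr_add[symmetric])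
  ultimately show ?thesis by simp
qed

locale sinr_exponential =
  fixes p :: real and \<W> :: "real measure" and \<mu> T A \<beta> :: real
  assumes p: "0 < p" "p < 1" and W_prob': "prob_space \<W>" and W_sets': "sets \<W> = sets borel"
    and \<mu>: "0 < \<mu>" and T: "0 < T" and A: "0 < A" and \<beta>: "2 < \<beta>"
begin

abbreviation fading :: "real measure" where "fading \<equiv> density lborel (exponential_density \<mu>)"
abbreviation path_loss :: "real \<Rightarrow> real" where "path_loss \<equiv> \<lambda>r. (A * r) powr \<beta>"

sublocale sinr_model p \<W> fading path_loss T
  by (rule sinr_model.intro) (simp_all add: W_prob' W_sets' prob_space_exponential_density[OF \<mu>])

lemma mean_fading: "(\<integral>\<^sup>+x. ennreal x \<partial>fading) = ennreal (1 / \<mu>)"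
proof -
  have "(\<integral>\<^sup>+x. ennreal x \<partial>fading) = (\<integral>\<^sup>+x. ennreal (exponential_density \<mu> x) * ennreal x \<partial>lborel)"
    by (rule nn_integral_density) auto
  also have "\<dots> = (\<integral>\<^sup>+x. ennreal (erlang_density 0 \<mu> x * x ^ 1) \<partial>lborel)"
    by (intro nn_integral_cong) (simp add: ennreal_mult' less_imp_le[OF \<mu>])
  also have "\<dots> = ennreal (1 / \<mu>)" using nn_integral_erlang_ith_moment[OF \<mu>, of 0 1] by simp
  finally show ?thesis .
qed

lemma fading_tail: "0 \<le> a \<Longrightarrow> ennreal (exp (- \<mu> * a)) \<le> emeasure fading {a..}"
proof -
  assume a: "0 \<le> a"
  interpret F: prob_space fading by (rule F_prob)
  have "emeasure fading {..a} = ennreal (1 - exp (- \<mu> * a))"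
    using emeasure_erlang_density[OF \<mu>, of 0 a] a by (simp add: erlang_CDF_0)
  then have "F.prob {..a} = 1 - exp (- \<mu> * a)" using \<mu> a by (simp add: F.emeasure_eq_measure)
  moreover have "F.prob (space fading - {..a}) = 1 - F.prob {..a}" by (rule F.prob_compl) simp
  moreover have "F.prob (space fading - {..a}) \<le> F.prob {a..}" by (rule F.finite_measure_mono) auto
  ultimately show ?thesis by (simp add: F.emeasure_eq_measure)
qed

lemma noise_bounded_with_positive_probability: "\<exists>w0\<ge>0. 0 < measure \<W> {..w0}"
proof (rule ccontr)
  interpret W: prob_space \<W> by (rule W_prob')
  assume no: "\<not> ?thesis"
  have "emeasure \<W> {..real n} = 0" for n :: nat
  proof -
    have "\<not> 0 < measure \<W> {..real n}" using no by (meson of_nat_0_le_iff)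
    then have "measure \<W> {..real n} = 0" using measure_nonneg[of \<W> "{..real n}"] by linarith
    then show ?thesis by (simp add: W.emeasure_eq_measure)
  qed
  then have "(\<Union>n::nat. {..real n}) \<in> null_sets \<W>" by (intro null_sets_UN') (auto simp: W_sets' null_sets_def)
  moreover have "(\<Union>n::nat. {..real n}) = UNIV"
  proof (intro set_eqI iffI UNIV_I)
    fix x :: real
    obtain n :: nat where "x \<le> n" using real_arch_simple by blast
    then show "x \<in> (\<Union>n::nat. {..real n})" by blast
  qed
  moreover have "space \<W> = UNIV" using sets_eq_imp_space_eq[OF W_sets'] by simp
  ultimately show False using W.emeasure_space_1 by (auto simp: null_sets_def)
qed


lemma inverse_path_loss_le_decay:
  assumes "1 \<le> r" "norm y \<le> r" "2 * r < norm x"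
  shows "1 / path_loss (dist x y) \<le> ((A / 2) powr (- \<beta>) * 2 powr \<beta>) * decay \<beta> x"
proof -
  have d: "norm x / 2 \<le> dist x y" using norm_triangle_ineq2[of x y] assms by (simp add: dist_norm)
  have n: "0 < norm x" using assms by linarith
  have "1 / path_loss (dist x y) = (A * dist x y) powr (- \<beta>)" by (simp add: powr_minus_divide)
  also have "\<dots> \<le> (A * (norm x / 2)) powr (- \<beta>)"
    using d n A \<beta> by (intro powr_mono2') (auto intro: mult_left_mono)
  also have "\<dots> = (A / 2) powr (- \<beta>) * (norm x) powr (- \<beta>)"
    using n A by (simp add: powr_mult[symmetric])
  also have "norm x powr (- \<beta>) = 2 powr \<beta> * (2 * norm x) powr (- \<beta>)"
    using n by (simp add: powr_mult powr_minus)
  also have "(2 * norm x) powr (- \<beta>) \<le> (1 + norm x) powr (- \<beta>)"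
    using assms \<beta> by (intro powr_mono2') auto
  also have "\<dots> \<le> decay \<beta> x" using \<beta> by (intro decay_lower) auto
  finally show ?thesis by (simp add: mult_left_mono mult.assoc)
qed

lemma prob_no_near_transmitter:
  fixes N :: "nat set"
  assumes N: "finite N" "i \<in> N" "j \<in> N" "i \<noteq> j"
  shows "ennreal (p * (1 - p) ^ card N) \<le> emeasure (\<Pi>\<^sub>M _\<in>UNIV. measure_pmf (bernoulli_pmf p))
     {e. e (i, 0::int) \<and> (\<forall>k\<in>N - {i}. \<not> e (k, 0))}"
    (is "_ \<le> emeasure ?E ?Z")
proof -
  let ?J = "N \<times> {0::int}" and ?A = "\<lambda>k :: nat \<times> int. if fst k = i then {True} else {False}"
  have "?Z = prod_emb UNIV (\<lambda>_. measure_pmf (bernoulli_pmf p)) ?J (Pi\<^sub>E ?J ?A)"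
    using N by (auto simp: prod_emb_def PiE_iff split: if_splits)
  then have "emeasure ?E ?Z = (\<Prod>k\<in>?J. emeasure (measure_pmf (bernoulli_pmf p)) (?A k))"
    by (simp only:) (rule emeasure_PiM_emb, use N prob_space_measure_pmf in auto)
  also have "\<dots> = (\<Prod>k\<in>?J. ennreal (if fst k = i then p else 1 - p))"
    using p by (intro prod.cong refl) (auto simp: emeasure_pmf_single)
  also have "\<dots> = (\<Prod>k\<in>N. ennreal (if k = i then p else 1 - p))"
    by (rule prod.reindex_bij_witness[of _ "\<lambda>k. (k, 0)" fst]) auto
  also have "\<dots> = ennreal (\<Prod>k\<in>N. if k = i then p else 1 - p)"
    using p by (intro prod_ennreal) auto
  also have "(\<Prod>k\<in>N. if k = i then p else 1 - p) = p * (\<Prod>k\<in>N - {i}. if k = i then p else 1 - p)"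
    using N by (subst prod.remove[of N i]) auto
  also have "(\<Prod>k\<in>N - {i}. if k = i then p else 1 - p) = (1 - p) ^ (card N - 1)"
    using N by (subst prod.cong[of _ _ _ "\<lambda>_. 1 - p"]) auto
  finally have "emeasure ?E ?Z = ennreal (p * (1 - p) ^ (card N - 1))" .
  moreover have "p * (1 - p) ^ card N \<le> p * (1 - p) ^ (card N - 1)"
    using p by (intro mult_left_mono power_decreasing) auto
  ultimately show ?thesis by (simp add: ennreal_leI)
qed

text \<open>
Markov's inequality bounds the interference from the far points by twice its mean with probability
at least \<open>1 / 2\<close>; the summand \<open>1\<close> in \<open>2 * m + 1\<close> covers the case of mean \<open>0\<close>. The
fading variable of the signal does not occur in the interference.
\<close>

lemma prob_far_interference:
  fixes c :: "nat \<Rightarrow> ennreal" and i j :: nat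
  assumes a: "0 \<le> a" and m: "0 \<le> m" and far: "\<And>k. c k \<noteq> 0 \<Longrightarrow> k \<noteq> i" and sum: "(\<Sum>k. c k) * ennreal (1 / \<mu>) \<le> ennreal m"
  shows "ennreal (exp (- \<mu> * a) / 2) \<le> emeasure (\<Pi>\<^sub>M _\<in>UNIV. fading)
     {F. a \<le> F (i, j, 0::int) \<and> (\<Sum>k. ennreal (F (k, j, 0)) * c k) \<le> ennreal (2 * m + 1)}"
proof -
  let ?P = "\<Pi>\<^sub>M _\<in>(UNIV :: (nat \<times> nat \<times> int) set). fading"
  interpret P: prob_space ?P by (intro prob_space_PiM F_prob)
  define Y where "Y F = (\<Sum>k. ennreal (F (k, j, 0::int)) * c k)" for F :: "nat \<times> nat \<times> int \<Rightarrow> real"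
  have space: "space ?P = UNIV" by (simp add: space_PiM)
  have [measurable]: "(\<lambda>F. F k) \<in> borel_measurable ?P" for k
    using measurable_component_singleton[of k UNIV "\<lambda>_. fading"] by (simp cong: measurable_cong_sets)
  have [measurable]: "Y \<in> borel_measurable ?P" unfolding Y_def by measurable
  define Z where "Z = {F. Y F \<le> ennreal (2 * m + 1)}"
  have Zs: "Z \<in> sets ?P"
  proof -
    have "Z = {F \<in> space ?P. Y F \<le> ennreal (2 * m + 1)}" by (simp add: Z_def space)
    also have "\<dots> \<in> sets ?P" by measurable
    finally show ?thesis .
  qed
  have "(\<integral>\<^sup>+F. Y F \<partial>?P) = (\<Sum>k. (\<integral>\<^sup>+F. ennreal (F (k, j, 0)) \<partial>?P) * c k)"
    unfolding Y_def by (subst nn_integral_suminf) (auto simp: nn_integral_multc)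
  also have "\<dots> = (\<Sum>k. ennreal (1 / \<mu>) * c k)"
  proof (rule suminf_cong)
    fix k
    have "(\<integral>\<^sup>+F. ennreal (F (k, j, 0::int)) \<partial>?P) = (\<integral>\<^sup>+x. ennreal x \<partial>distr ?P fading (\<lambda>F. F (k, j, 0)))"
      by (rule nn_integral_distr[symmetric]) auto
    also have "distr ?P fading (\<lambda>F. F (k, j, 0)) = fading" by (rule distr_PiM_component) (use F_prob in auto)
    finally show "(\<integral>\<^sup>+F. ennreal (F (k, j, 0::int)) \<partial>?P) * c k = ennreal (1 / \<mu>) * c k" by (simp add: mean_fading)
  qed
  also have "\<dots> \<le> ennreal m" using sum by (simp add: mult.commute)
  finally have EY: "(\<integral>\<^sup>+F. Y F \<partial>?P) \<le> ennreal m" .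
  have "emeasure ?P {F \<in> space ?P. ennreal (2 * m + 1) \<le> Y F} \<le> ennreal (1 / 2)"
  proof -
    have "emeasure ?P {F \<in> space ?P. 1 \<le> ennreal (1 / (2 * m + 1)) * Y F} \<le> ennreal (1 / (2 * m + 1)) * (\<integral>\<^sup>+F. Y F * indicator (space ?P) F \<partial>?P)"
      by (rule nn_integral_Markov_inequality) auto
    also have "\<dots> \<le> ennreal (1 / (2 * m + 1)) * ennreal m"
      using EY by (intro mult_left_mono) (auto cong: nn_integral_cong)
    also have "\<dots> = ennreal (m / (2 * m + 1))" using m by (simp add: ennreal_mult'[symmetric])
    also have "\<dots> \<le> ennreal (1 / 2)" using m by (intro ennreal_leI) (simp add: field_simps)
    finally have *: "emeasure ?P {F \<in> space ?P. 1 \<le> ennreal (1 / (2 * m + 1)) * Y F} \<le> ennreal (1 / 2)" .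
    have "emeasure ?P {F \<in> space ?P. ennreal (2 * m + 1) \<le> Y F} \<le> emeasure ?P {F \<in> space ?P. 1 \<le> ennreal (1 / (2 * m + 1)) * Y F}"
    proof (rule emeasure_mono)
      have "1 \<le> ennreal (1 / (2 * m + 1)) * Y F" if "ennreal (2 * m + 1) \<le> Y F" for F
      proof -
        have "ennreal (1 / (2 * m + 1)) * ennreal (2 * m + 1) \<le> ennreal (1 / (2 * m + 1)) * Y F" using that by (rule mult_left_mono) simp
        moreover have "ennreal (1 / (2 * m + 1)) * ennreal (2 * m + 1) = 1"
          using m by (subst ennreal_mult'[symmetric]) auto
        ultimately show ?thesis by simp
      qed
      then show "{F \<in> space ?P. ennreal (2 * m + 1) \<le> Y F} \<subseteq> {F \<in> space ?P. 1 \<le> ennreal (1 / (2 * m + 1)) * Y F}" by auto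
    qed measurable
    then show ?thesis using * by (rule order_trans)
  qed
  moreover have "emeasure ?P (space ?P - Z) \<le> emeasure ?P {F \<in> space ?P. ennreal (2 * m + 1) \<le> Y F}"
  proof (rule emeasure_mono)
    show "space ?P - Z \<subseteq> {F \<in> space ?P. ennreal (2 * m + 1) \<le> Y F}" by (auto simp: Z_def)
  qed measurable
  ultimately have "emeasure ?P (space ?P - Z) \<le> ennreal (1 / 2)" by (rule order_trans[rotated])
  then have "ennreal (P.prob (space ?P - Z)) \<le> ennreal (1 / 2)" by (simp only: P.emeasure_eq_measure)
  then have "P.prob (space ?P - Z) \<le> 1 / 2" by (rule iffD1[OF ennreal_le_iff, rotated]) simp
  then have "1 / 2 \<le> P.prob Z" using P.prob_compl[OF Zs] by linarith
  then have half: "ennreal (1 / 2) \<le> emeasure ?P Z" unfolding P.emeasure_eq_measure[of Z] by (rule ennreal_leI)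
  have "emeasure ?P {F \<in> Z. F (i, j, 0) \<in> {a..}} = emeasure fading {a..} * emeasure ?P Z"
  proof (rule emeasure_PiM_coordinate_split[OF F_prob _ Zs])
    fix F G :: "nat \<times> nat \<times> int \<Rightarrow> real" assume FG: "\<And>k. k \<noteq> (i, j, 0) \<Longrightarrow> F k = G k" and "F \<in> Z"
    have "ennreal (F (k, j, 0)) * c k = ennreal (G (k, j, 0)) * c k" for k
      using FG[of "(k, j, 0)"] far[of k] by (cases "c k = 0") auto
    then show "G \<in> Z" using \<open>F \<in> Z\<close> by (simp add: Z_def Y_def)
  qed simp
  also have "\<dots> \<ge> ennreal (exp (- \<mu> * a)) * ennreal (1 / 2)"
    by (rule mult_mono[OF fading_tail[OF a] half]) simp_all
  finally have "ennreal (exp (- \<mu> * a)) * ennreal (1 / 2) \<le> emeasure ?P {F \<in> Z. F (i, j, 0) \<in> {a..}}" .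
  moreover have "{F \<in> Z. F (i, j, 0) \<in> {a..}} = {F. a \<le> F (i, j, 0::int) \<and> (\<Sum>k. ennreal (F (k, j, 0)) * c k) \<le> ennreal (2 * m + 1)}"
    by (auto simp: Z_def Y_def)
  moreover have "ennreal (exp (- \<mu> * a)) * ennreal (1 / 2) = ennreal (exp (- \<mu> * a) / 2)"
    by (subst ennreal_mult'[symmetric]) auto
  ultimately show ?thesis by (simp only:)
qed


lemma ennreal_le_divideI:
  fixes a t :: real and d :: ennreal
  assumes "0 < a" "0 < t" "0 \<le> b" "t * b \<le> a" "d \<le> ennreal b"
  shows "ennreal t \<le> ennreal a / d"
proof (cases "d = 0")
  case True
  then show ?thesis using assms by (simp add: ennreal_divide_zero)
next
  case False
  then obtain r where r: "d = ennreal r" "0 < r" using assms(5)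
    by (cases d) (auto simp: top_unique le_less)
  have "r \<le> b" using r assms(3,5) by simp
  then have "t * r \<le> t * b" using assms(2) by (intro mult_left_mono) auto
  then have "t * r \<le> a" using assms(4) by (rule order_trans)
  then show ?thesis using r assms by (simp add: divide_ennreal ennreal_leI le_divide_eq)
qed

text \<open>
The points within distance \<open>2 R\<close> of the origin are near, the others far. The number of near points
and the mean interference of the far points are both bounded by a multiple of \<open>\<sigma>\<close>. Silence
of the near points other than \<open>i\<close> costs at most a factor \<open>1 - p\<close> for each of them, and the tail of the exponential
law makes the price of beating noise and far interference exponential in the latter.
\<close>

theorem mean_hops_le_exp_decay:
  assumes R: "1 \<le> R"
  shows "\<exists>C c. 0 \<le> C \<and> 0 \<le> c \<and> (\<forall>X i j \<sigma>. inj X \<longrightarrow> norm (X i) \<le> R \<longrightarrow> norm (X j) \<le> R \<longrightarrow> 0 \<le> \<sigma> \<longrightarrow>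
     (\<Sum>k. ennreal (decay \<beta> (X k))) \<le> ennreal \<sigma> \<longrightarrow> mean_hops X i j \<le> ennreal (C * exp (c * \<sigma>)))"
proof -
  interpret W: prob_space \<W> by (rule W_prob')
  (* the noise has an arbitrary law, but is finite *)
  obtain w0 where w0: "0 \<le> w0" "0 < W.prob {..w0}" using noise_bounded_with_positive_probability by blast
  define pW where "pW = W.prob {..w0}"
  define h0 where "h0 = (1 + 2 * R) powr (- \<beta>)"
  define b where "b = (A / 2) powr (- \<beta>) * 2 powr \<beta>"
  define L where "L = path_loss (2 * R)"
  define C where "C = 2 / (p * pW) * exp (\<mu> * T * L * (w0 + 1))"
  define c where "c = ln (1 / (1 - p)) / h0 + 2 * T * L * b"
  have pos: "0 < h0" "0 < b" "0 < L" "0 < pW" "pW \<le> 1" using R A w0 by (auto simp: h0_def b_def L_def pW_def)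
  have lnp: "0 < ln (1 / (1 - p))" using p by simp
  have C1: "1 \<le> C"
  proof -
    have "p * pW \<le> 1 * 1" using p pos by (intro mult_mono) auto
    then have "2 \<le> 2 / (p * pW)" using p pos by (simp add: le_divide_eq)
    moreover have "1 \<le> exp (\<mu> * T * L * (w0 + 1))" using \<mu> T pos w0 by simp
    moreover have "1 \<le> 2 / (p * pW)" using \<open>2 \<le> 2 / (p * pW)\<close> by linarith
    moreover have "0 \<le> 2 / (p * pW)" using \<open>2 \<le> 2 / (p * pW)\<close> by linarith
    ultimately have "1 * 1 \<le> C" unfolding C_def by (intro mult_mono) simp_all
    then show ?thesis by simp
  qed
  have c0: "0 \<le> c" using lnp pos T by (simp add: c_def)
  have key: "mean_hops X i j \<le> ennreal (C * exp (c * \<sigma>))"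
    if inj: "inj X" and i: "norm (X i) \<le> R" and j: "norm (X j) \<le> R" and \<sigma>: "0 \<le> \<sigma>"
      and sum: "(\<Sum>k. ennreal (decay \<beta> (X k))) \<le> ennreal \<sigma>"
    for X i j \<sigma>
  proof (cases "i = j")
    case True
    have "1 * 1 \<le> C * exp (c * \<sigma>)" using C1 c0 \<sigma> by (intro mult_mono) auto
    then have "ennreal 1 \<le> ennreal (C * exp (c * \<sigma>))" by (intro ennreal_leI) simp
    then show ?thesis using True by (simp add: mean_hops_self)
  next
    case ij: False
    define N where "N = {k. norm (X k) \<le> 2 * R}"
    have ijN: "i \<in> N" "j \<in> N" using i j R by (auto simp: N_def)
    have card_le: "real (card G) * h0 \<le> \<sigma>" if G: "finite G" "G \<subseteq> N" for G
    proof -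
      have "ennreal (real (card G) * h0) = (\<Sum>k\<in>G. ennreal h0)" using pos by (simp add: ennreal_mult'[symmetric] ennreal_of_nat_eq_real_of_nat)
      also have "\<dots> \<le> (\<Sum>k\<in>G. ennreal (decay \<beta> (X k)))"
        using G \<beta> by (intro sum_mono ennreal_leI) (auto simp: h0_def N_def intro!: decay_lower)
      also have "\<dots> \<le> (\<Sum>k. ennreal (decay \<beta> (X k)))" by (rule sum_le_suminf) (use G in auto)
      also have "\<dots> \<le> ennreal \<sigma>" by (rule sum)
      finally show ?thesis using \<sigma> by simp
    qed
    have finN: "finite N"
    proof (rule ccontr)
      assume inf: "infinite N"
      obtain n :: nat where n: "\<sigma> / h0 < n" using reals_Archimedean2 by blast
      obtain G where "finite G" "card G = n" "G \<subseteq> N" using infinite_arbitrarily_large[OF inf] by blast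
      then show False using card_le[of G] n pos by (simp add: divide_less_eq)
    qed
    define cN where "cN = card N"
    have cN: "real cN \<le> \<sigma> / h0" using card_le[OF finN order_refl] pos by (simp add: cN_def le_divide_eq)
    define m where "m = b * \<sigma> / \<mu>"
    have m: "0 \<le> m" using pos \<sigma> \<mu> by (simp add: m_def)
    define t where "t = 2 * m + 1"
    define a where "a = T * L * (w0 + t)"
    have t: "0 < t" using m by (simp add: t_def)
    have a: "0 < a" using T pos w0 t by (simp add: a_def)
    define g where "g k = (if k \<in> N then 0 else ennreal (1 / path_loss (dist (X k) (X j))))" for k
    have "(\<Sum>k. g k) \<le> (\<Sum>k. ennreal b * ennreal (decay \<beta> (X k)))"
    proof (rule suminf_le)
      fix k
      show "g k \<le> ennreal b * ennreal (decay \<beta> (X k))"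
        using inverse_path_loss_le_decay[OF R j, of "X k"] pos
        by (auto simp: g_def N_def not_le b_def ennreal_mult'[symmetric] intro!: ennreal_leI)
    qed auto
    also have "\<dots> \<le> ennreal (b * \<sigma>)" using sum pos by (simp add: ennreal_mult' mult_left_mono)
    finally have "(\<Sum>k. g k) * ennreal (1 / \<mu>) \<le> ennreal (b * \<sigma>) * ennreal (1 / \<mu>)" by (rule mult_right_mono) simp
    also have "\<dots> = ennreal m" using pos \<sigma> \<mu> by (simp add: m_def ennreal_mult'[symmetric])
    finally have gsum: "(\<Sum>k. g k) * ennreal (1 / \<mu>) \<le> ennreal m" .
    let ?E = "\<Pi>\<^sub>M _\<in>(UNIV :: (nat \<times> int) set). measure_pmf (bernoulli_pmf p)"
    let ?W = "\<Pi>\<^sub>M _\<in>(UNIV :: (nat \<times> int) set). \<W>" and ?F = "\<Pi>\<^sub>M _\<in>(UNIV :: (nat \<times> nat \<times> int) set). fading"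
    interpret E: prob_space ?E by (intro prob_space_PiM prob_space_measure_pmf)
    interpret Ws: prob_space ?W by (intro prob_space_PiM W_prob)
    interpret Fs: prob_space ?F by (intro prob_space_PiM F_prob)
    interpret WF: pair_prob_space ?W ?F ..
    (* the three parts of the event concern the access indicators, the noise and the fading at time 0 *)
    define EE where "EE = {e. e (i, 0::int) \<and> (\<forall>k\<in>N - {i}. \<not> e (k, 0))}"
    define WW where "WW = {w \<in> space ?W. w (j, 0::int) \<le> w0}"
    define FF where "FF = {F. a \<le> F (i, j, 0::int) \<and> (\<Sum>k. ennreal (F (k, j, 0)) * g k) \<le> ennreal (2 * m + 1)}"
    have E: "ennreal (p * (1 - p) ^ cN) \<le> emeasure ?E EE"
      unfolding EE_def cN_def by (rule prob_no_near_transmitter[OF finN ijN ij])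
    have F: "ennreal (exp (- \<mu> * a) / 2) \<le> emeasure ?F FF"
      unfolding FF_def by (rule prob_far_interference) (use a m gsum ijN in \<open>auto simp: g_def split: if_splits\<close>)
    have W: "emeasure ?W WW = ennreal pW"
    proof -
      have "emeasure ?W WW = emeasure (distr ?W \<W> (\<lambda>w. w (j, 0))) {..w0}"
        by (subst emeasure_distr) (auto simp: W_sets' WW_def intro!: arg_cong2[where f=emeasure])
      also have "distr ?W \<W> (\<lambda>w. w (j, 0)) = \<W>" by (rule distr_PiM_component) (use W_prob in auto)
      finally show ?thesis by (simp add: W.emeasure_eq_measure pW_def)
    qed
    have "0 < p * (1 - p) ^ cN" using p by simp
    then have "0 < emeasure ?E EE" using less_le_trans[OF _ E, of 0] by simp
    then have Es: "EE \<in> sets ?E" by (intro emeasure_neq_0_sets) simp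
    have Ws: "WW \<in> sets ?W" using W pos by (intro emeasure_neq_0_sets) (auto simp: ennreal_eq_0_iff not_le)
    have Fs: "FF \<in> sets ?F" using F by (intro emeasure_neq_0_sets) (auto simp: ennreal_eq_0_iff not_le)
    have conn: "conn path_loss T X mk i j 0" if mk: "mk \<in> EE \<times> (WW \<times> FF)" for mk
    proof -
      obtain e w f where mk': "mk = (e, w, f)" and e: "e \<in> EE" and w: "w \<in> WW" and f: "f \<in> FF" using mk by auto
      have "interference path_loss X e f i j 0 \<le> (\<Sum>k. ennreal (f (k, j, 0)) * g k)"
        unfolding interference_def
      proof (rule suminf_le)
        fix k
        show "(if k \<noteq> i \<and> e (k, 0) then ennreal (f (k, j, 0)) / ennreal (path_loss (dist (X k) (X j))) else 0) \<le> ennreal (f (k, j, 0)) * g k"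
        proof (cases "k \<noteq> i \<and> e (k, 0)")
          case True
          then have k: "k \<notin> N" using e by (auto simp: EE_def)
          then have "X k \<noteq> X j" using ijN inj by (auto simp: inj_eq)
          then have "0 < path_loss (dist (X k) (X j))" using A by simp
          then show ?thesis using True k
            by (simp add: g_def divide_ennreal_def inverse_ennreal divide_inverse)
        next
          case False
          then show ?thesis by auto
        qed
      qed auto
      also have "\<dots> \<le> ennreal t" using f by (simp add: FF_def t_def)
      finally have I: "interference path_loss X e f i j 0 \<le> ennreal t" .
      have "w (j, 0) \<le> w0" using w by (simp add: WW_def)
      then have den: "ennreal (w (j, 0)) + interference path_loss X e f i j 0 \<le> ennreal (w0 + t)"
        using I w0 t by (simp add: add_mono ennreal_leI)
      have "X i \<noteq> X j" using ij inj by (auto simp: inj_eq)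
      then have Lij: "0 < path_loss (dist (X i) (X j))" using A by simp
      have "dist (X i) (X j) \<le> 2 * R" using norm_triangle_ineq4[of "X i" "X j"] i j by (simp add: dist_norm)
      then have LL: "path_loss (dist (X i) (X j)) \<le> L"
        unfolding L_def using A \<beta> by (intro powr_mono2) auto
      have fa: "a \<le> f (i, j, 0)" using f by (simp add: FF_def)
      have "T * (w0 + t) * path_loss (dist (X i) (X j)) \<le> T * (w0 + t) * L"
        using LL T w0 t by (intro mult_left_mono) auto
      also have "\<dots> \<le> f (i, j, 0)" using fa by (simp add: a_def mult.commute mult.left_commute)
      finally have "T * (w0 + t) \<le> f (i, j, 0) / path_loss (dist (X i) (X j))" using Lij by (simp add: le_divide_eq)
      then have "ennreal T \<le> ennreal (f (i, j, 0) / path_loss (dist (X i) (X j))) / (ennreal (w (j, 0)) + interference path_loss X e f i j 0)"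
        by (intro ennreal_le_divideI[where b="w0 + t"]) (use fa a Lij T w0 t den in auto)
      then have "ennreal T \<le> sinr path_loss X e w f i j 0"
        using fa a Lij by (simp add: sinr_def divide_ennreal)
      moreover have "e (i, 0)" "\<not> e (j, 0)" using e ijN ij by (auto simp: EE_def)
      ultimately show ?thesis by (simp add: mk' conn_def connected_at_def)
    qed
    let ?q = "K.prob {mk \<in> space K. conn path_loss T X mk i j 0}"
    have WFs: "WW \<times> FF \<in> sets (?W \<Otimes>\<^sub>M ?F)" using Ws Fs by simp
    have "ennreal (p * (1 - p) ^ cN) * (ennreal pW * ennreal (exp (- \<mu> * a) / 2)) \<le> emeasure ?E EE * (emeasure ?W WW * emeasure ?F FF)"
      using E F W by (intro mult_mono) auto
    also have "emeasure ?W WW * emeasure ?F FF = emeasure (?W \<Otimes>\<^sub>M ?F) (WW \<times> FF)"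
      using Ws Fs by (rule Fs.emeasure_pair_measure_Times[symmetric])
    also have "emeasure ?E EE * emeasure (?W \<Otimes>\<^sub>M ?F) (WW \<times> FF) = emeasure K (EE \<times> (WW \<times> FF))"
      unfolding marks_law_def using Es WFs by (rule WF.emeasure_pair_measure_Times[symmetric])
    also have "\<dots> \<le> emeasure K {mk \<in> space K. conn path_loss T X mk i j 0}"
    proof (rule emeasure_mono)
      have "EE \<times> (WW \<times> FF) \<in> sets K" unfolding marks_law_def using Es WFs by (rule pair_measureI)
      then show "EE \<times> (WW \<times> FF) \<subseteq> {mk \<in> space K. conn path_loss T X mk i j 0}"
        using conn sets.sets_into_space by fast
    qed measurable
    finally have "ennreal (p * (1 - p) ^ cN) * (ennreal pW * ennreal (exp (- \<mu> * a) / 2)) \<le> ennreal ?q"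
      by (simp add: K.emeasure_eq_measure)
    moreover have "ennreal (p * (1 - p) ^ cN) * (ennreal pW * ennreal (exp (- \<mu> * a) / 2)) = ennreal (p * (1 - p) ^ cN * (pW * (exp (- \<mu> * a) / 2)))"
      using p pos by (simp add: ennreal_mult'[symmetric])
    ultimately have q: "p * (1 - p) ^ cN * (pW * (exp (- \<mu> * a) / 2)) \<le> ?q" by simp
    have expo: "exp (- (c * \<sigma>)) / C \<le> p * (1 - p) ^ cN * (pW * (exp (- \<mu> * a) / 2))"
    proof -
      have "(1 - p) ^ cN = exp (- (real cN * ln (1 / (1 - p))))"
        using p by (simp add: ln_div exp_of_nat_mult)
      also have "\<dots> \<ge> exp (- (\<sigma> / h0 * ln (1 / (1 - p))))"
        using mult_right_mono[OF cN less_imp_le[OF lnp]] by simp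
      finally have 1: "exp (- (\<sigma> / h0 * ln (1 / (1 - p)))) \<le> (1 - p) ^ cN" .
      have "\<mu> * a = \<mu> * T * L * (w0 + 1) + 2 * T * L * b * \<sigma>"
        using \<mu> by (simp add: a_def t_def m_def field_simps)
      then have 2: "exp (- \<mu> * a) = exp (- (\<mu> * T * L * (w0 + 1))) * exp (- (2 * T * L * b * \<sigma>))"
        by (simp add: exp_add[symmetric])
      have "exp (- (c * \<sigma>)) / C = p * exp (- (\<sigma> / h0 * ln (1 / (1 - p)))) * (pW * (exp (- \<mu> * a) / 2))"
      proof -
        have "c * \<sigma> = \<sigma> / h0 * ln (1 / (1 - p)) + 2 * T * L * b * \<sigma>" by (simp add: c_def field_simps)
        then have "exp (- (c * \<sigma>)) = exp (- (\<sigma> / h0 * ln (1 / (1 - p)))) * exp (- (2 * T * L * b * \<sigma>))"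
          by (simp add: exp_add[symmetric])
        moreover define q where "q = exp (\<mu> * T * L * (w0 + 1))"
        moreover have "exp (- (\<mu> * T * L * (w0 + 1))) = inverse q" by (simp only: q_def exp_minus)
        moreover have "0 < q" by (simp add: q_def)
        ultimately show ?thesis unfolding 2 C_def using p pos by (simp only: q_def[symmetric]) (simp add: divide_simps)
      qed
      also have "\<dots> \<le> p * (1 - p) ^ cN * (pW * (exp (- \<mu> * a) / 2))"
        using 1 p pos by (intro mult_right_mono mult_left_mono) auto
      finally show ?thesis .
    qed
    have qpos: "0 < exp (- (c * \<sigma>)) / C" using C1 by simp
    then have "0 < ?q" using q expo by linarith
    then have "mean_hops X i j \<le> ennreal (1 / ?q)" by (rule mean_hops_le_inverse)
    also have "\<dots> \<le> ennreal (1 / (exp (- (c * \<sigma>)) / C))"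
      using order_trans[OF expo q] qpos \<open>0 < ?q\<close> by (intro ennreal_leI divide_left_mono mult_pos_pos) simp_all
    also have "1 / (exp (- (c * \<sigma>)) / C) = C * exp (c * \<sigma>)" by (simp add: exp_minus field_simps)
    finally show ?thesis .
  qed
  then show ?thesis using C1 c0 by (intro exI[of _ C] exI[of _ c]) auto
qed

end

section \<open>Summability of the decay over the lattice\<close>

lemma decay_lattice_vec:
  "decay \<beta> (lattice_vec z) = (1 + \<bar>real_of_int (fst z)\<bar>) powr (- \<beta> / 2) * (1 + \<bar>real_of_int (snd z)\<bar>) powr (- \<beta> / 2)"
  unfolding decay_def lattice_vec_nth by (rule powr_mult)

lemma decay_le_1: "0 \<le> \<beta> \<Longrightarrow> decay \<beta> x \<le> 1"
proof -
  assume \<beta>: "0 \<le> \<beta>"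
  have "1 * 1 \<le> (1 + \<bar>x $ 1\<bar>) * (1 + \<bar>x $ 2\<bar>)" by (intro mult_mono) auto
  then have "decay \<beta> x \<le> 1 powr (- \<beta> / 2)" unfolding decay_def using \<beta> by (intro powr_mono2') auto
  then show ?thesis by simp
qed

lemma sum_decay_lattice_bounded:
  assumes \<beta>: "2 < \<beta>"
  shows "\<exists>B. \<forall>G. finite G \<longrightarrow> (\<Sum>z\<in>G. decay \<beta> (lattice_vec z)) \<le> B"
proof -
  define a where "a k = (1 + \<bar>real_of_int k\<bar>) powr (- \<beta> / 2)" for k
  have a0: "0 \<le> a k" for k by (simp add: a_def)
  have "summable (\<lambda>n. real n powr (- \<beta> / 2))" using \<beta> by (subst summable_real_powr_iff) simp
  then have sm: "summable (\<lambda>n. real (Suc n) powr (- \<beta> / 2))" by (subst summable_Suc_iff)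
  define S where "S = (\<Sum>n. real (Suc n) powr (- \<beta> / 2))"
  have S0: "0 \<le> S" unfolding S_def by (rule suminf_nonneg[OF sm]) simp
  have half: "(\<Sum>n\<le>N. a (int n)) \<le> S" "(\<Sum>n\<le>N. a (- int n)) \<le> S" for N
    unfolding S_def a_def using sum_le_suminf[OF sm, of "{..N}"] by (simp_all add: add.commute)
  have a_sum: "(\<Sum>k\<in>{-int N..int N}. a k) \<le> 2 * S" for N
  proof -
    have sub: "{-int N..int N} \<subseteq> int ` {..N} \<union> (\<lambda>n. - int n) ` {..N}"
    proof
      fix k assume "k \<in> {-int N..int N}"
      then show "k \<in> int ` {..N} \<union> (\<lambda>n. - int n) ` {..N}"
        by (cases k rule: int_cases2) auto
    qed
    have "(\<Sum>k\<in>{-int N..int N}. a k) \<le> (\<Sum>k\<in>int ` {..N} \<union> (\<lambda>n. - int n) ` {..N}. a k)"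
      by (rule sum_mono2[OF _ sub]) (use a0 in auto)
    also have "\<dots> \<le> (\<Sum>k\<in>int ` {..N}. a k) + (\<Sum>k\<in>(\<lambda>n. - int n) ` {..N}. a k)"
      by (subst sum_Un) (use a0 in \<open>auto intro!: sum_nonneg\<close>)
    also have "\<dots> = (\<Sum>n\<le>N. a (int n)) + (\<Sum>n\<le>N. a (- int n))"
      by (subst (1 2) sum.reindex) (auto simp: inj_on_def)
    also have "\<dots> \<le> 2 * S" using half[of N] by linarith
    finally show ?thesis .
  qed
  have "(\<Sum>z\<in>G. decay \<beta> (lattice_vec z)) \<le> (2 * S) * (2 * S)" if "finite G" for G
  proof -
    define N where "N = Max (insert 0 ((\<lambda>z. nat \<bar>fst z\<bar>) ` G \<union> (\<lambda>z. nat \<bar>snd z\<bar>) ` G))"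
    have sub: "G \<subseteq> {-int N..int N} \<times> {-int N..int N}"
    proof
      fix z assume z: "z \<in> G"
      have "nat \<bar>fst z\<bar> \<le> N" "nat \<bar>snd z\<bar> \<le> N" unfolding N_def by (rule Max_ge; use that z in auto)+
      then show "z \<in> {-int N..int N} \<times> {-int N..int N}" by (cases z) auto
    qed
    have "(\<Sum>z\<in>G. decay \<beta> (lattice_vec z)) = (\<Sum>z\<in>G. a (fst z) * a (snd z))" by (simp add: decay_lattice_vec a_def)
    also have "\<dots> \<le> (\<Sum>z\<in>{-int N..int N} \<times> {-int N..int N}. a (fst z) * a (snd z))"
      by (rule sum_mono2[OF _ sub]) (use a0 in auto)
    also have "\<dots> = (\<Sum>k\<in>{-int N..int N}. a k) * (\<Sum>k\<in>{-int N..int N}. a k)"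
      by (simp add: sum_product sum.cartesian_product case_prod_beta')
    also have "\<dots> \<le> (2 * S) * (2 * S)"
      using a_sum[of N] S0 by (intro mult_mono) (auto intro!: sum_nonneg simp: a0)
    finally show ?thesis .
  qed
  then show ?thesis by blast
qed

lemma decay_on_cell:
  assumes s: "0 < s" and \<beta>: "0 < \<beta>" and x: "x \<in> cell s z"
  shows "decay \<beta> x \<le> (2 + 1 / s) powr \<beta> * decay \<beta> (lattice_vec z)"
proof -
  have c: "1 + \<bar>real_of_int k\<bar> \<le> (2 + 1 / s) * (1 + \<bar>y\<bar>)" if "\<lfloor>y / s\<rfloor> = k" for y :: real and k
  proof -
    have "\<bar>real_of_int k\<bar> \<le> \<bar>y / s\<bar> + 1" using that by linarith
    also have "\<bar>y / s\<bar> = \<bar>y\<bar> / s" using s by simp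
    finally have "1 + \<bar>real_of_int k\<bar> \<le> 2 + 1 / s * \<bar>y\<bar>" by simp
    also have "\<dots> \<le> (2 + 1 / s) * (1 + \<bar>y\<bar>)" using s by (simp add: field_simps)
    finally show ?thesis .
  qed
  let ?q = "2 + 1 / s" and ?x = "(1 + \<bar>x $ 1\<bar>) * (1 + \<bar>x $ 2\<bar>)"
  let ?z = "(1 + \<bar>real_of_int (fst z)\<bar>) * (1 + \<bar>real_of_int (snd z)\<bar>)"
  have q: "0 < ?q" using s by (simp add: add_pos_pos)
  have zpos: "0 < ?z" and xpos: "0 < ?x" by (intro mult_pos_pos add_pos_nonneg; simp)+
  have "?z \<le> (?q * (1 + \<bar>x $ 1\<bar>)) * (?q * (1 + \<bar>x $ 2\<bar>))"
    using x q by (intro mult_mono c) (auto simp: cell_def)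
  then have "?z \<le> (?q * ?q) * ?x" by (simp only: ac_simps)
  then have "((?q * ?q) * ?x) powr (- \<beta> / 2) \<le> ?z powr (- \<beta> / 2)"
    using \<beta> zpos by (intro powr_mono2') auto
  moreover have "((?q * ?q) * ?x) powr (- \<beta> / 2) = ?q powr (- \<beta>) * decay \<beta> x"
    using q xpos by (simp add: powr_mult powr_add[symmetric] decay_def)
  moreover have "?z powr (- \<beta> / 2) = decay \<beta> (lattice_vec z)" by (simp add: decay_def)
  ultimately have "?q powr (- \<beta>) * decay \<beta> x \<le> decay \<beta> (lattice_vec z)" by simp
  then have "?q powr \<beta> * (?q powr (- \<beta>) * decay \<beta> x) \<le> ?q powr \<beta> * decay \<beta> (lattice_vec z)"
    by (intro mult_left_mono) auto
  then show ?thesis using q by (simp add: mult.assoc[symmetric] powr_add[symmetric])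
qed

section \<open>Exponential moments\<close>

lemma cell_eq_translate: "0 < s \<Longrightarrow> cell s z = (\<lambda>x. x + s *\<^sub>R lattice_vec z) ` cell s (0, 0)"
proof
  assume s: "0 < s"
  show "(\<lambda>x. x + s *\<^sub>R lattice_vec z) ` cell s (0, 0) \<subseteq> cell s z" using add_lattice_mem_cell[OF s, of _ z z] by auto
  show "cell s z \<subseteq> (\<lambda>x. x + s *\<^sub>R lattice_vec z) ` cell s (0, 0)"
  proof
    fix x assume "x \<in> cell s z"
    then have "x - s *\<^sub>R lattice_vec z \<in> cell s (0, 0)" using add_lattice_mem_cell[OF s, of "x - s *\<^sub>R lattice_vec z" z z] by simp
    then show "x \<in> (\<lambda>x. x + s *\<^sub>R lattice_vec z) ` cell s (0, 0)" by force
  qed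
qed

lemma measure_cell: "0 < s \<Longrightarrow> measure lborel (cell s z) = measure lborel (cell s (0, 0))"
  using measure_translate[OF cell_borel, of "s *\<^sub>R lattice_vec z" s "(0, 0)"] cell_eq_translate[of s z] by simp

lemma bounded_cell: assumes s: "0 < s" shows "bounded (cell s z)"
proof -
  have "cell s (0, 0) \<subseteq> cbox 0 (\<chi> i. s)"
    using s by (auto simp: cell_iff mem_box_cart forall_2 less_imp_le)
  then have "bounded (cell s (0, 0))" by (rule bounded_subset[OF bounded_cbox])
  then show ?thesis unfolding cell_eq_translate[OF s, of z] by (rule bounded_translate)
qed

lemma disjoint_cells: "z \<noteq> z' \<Longrightarrow> cell s z \<inter> cell s z' = {}"
  by (auto simp: cell_def prod_eq_iff)

text \<open>
The moment generating function of the Poisson law.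
\<close>

lemma poisson_count_exp_moment:
  fixes \<theta> :: real
  assumes "prob_space M" and P: "poisson_process M \<nu> \<Psi>" and B: "B \<in> sets borel" "bounded B"
  shows "(\<integral>\<^sup>+\<omega>. ennreal (exp (\<theta> * card (\<Psi> \<omega> \<inter> B))) \<partial>M) = ennreal (exp (\<nu> * measure lborel B * (exp \<theta> - 1)))"
proof -
  interpret prob_space M by fact
  let ?N = "\<lambda>\<omega>. card (\<Psi> \<omega> \<inter> B)" and ?a = "\<nu> * measure lborel B"
  have [measurable]: "?N \<in> M \<rightarrow>\<^sub>M count_space UNIV" using P B by (simp add: poisson_process_def)
  have prob: "measure M {\<omega> \<in> space M. ?N \<omega> = k} = ?a ^ k / fact k * exp (- ?a)" for k
    using P[unfolded poisson_process_def, THEN conjunct2, THEN conjunct1] B by blast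
  have a0: "0 \<le> ?a"
  proof -
    have "0 \<le> ?a ^ 1 / fact 1 * exp (- ?a)" unfolding prob[symmetric] by simp
    then show ?thesis by (simp add: zero_le_mult_iff)
  qed
  have "(\<integral>\<^sup>+\<omega>. ennreal (exp (\<theta> * ?N \<omega>)) \<partial>M) = (\<integral>\<^sup>+\<omega>. (\<Sum>k. ennreal (exp (\<theta> * real k)) * indicator {\<omega> \<in> space M. ?N \<omega> = k} \<omega>) \<partial>M)"
  proof (rule nn_integral_cong)
    fix \<omega> assume \<omega>: "\<omega> \<in> space M"
    have "(\<Sum>k. ennreal (exp (\<theta> * real k)) * indicator {\<omega> \<in> space M. ?N \<omega> = k} \<omega>) = (\<Sum>k\<in>{?N \<omega>}. ennreal (exp (\<theta> * real k)) * indicator {\<omega> \<in> space M. ?N \<omega> = k} \<omega>)"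
      by (rule suminf_finite) auto
    then show "ennreal (exp (\<theta> * ?N \<omega>)) = (\<Sum>k. ennreal (exp (\<theta> * real k)) * indicator {\<omega> \<in> space M. ?N \<omega> = k} \<omega>)" using \<omega> by simp
  qed
  also have "\<dots> = (\<Sum>k. ennreal (exp (\<theta> * real k)) * emeasure M {\<omega> \<in> space M. ?N \<omega> = k})"
    by (subst nn_integral_suminf) (auto simp: nn_integral_cmult)
  also have "\<dots> = (\<Sum>k. ennreal (exp (- ?a) * ((?a * exp \<theta>) ^ k / fact k)))"
  proof (rule suminf_cong)
    fix k
    have "exp (\<theta> * real k) = exp \<theta> ^ k" by (simp add: exp_of_nat_mult[symmetric] mult.commute)
    then show "ennreal (exp (\<theta> * real k)) * emeasure M {\<omega> \<in> space M. ?N \<omega> = k} = ennreal (exp (- ?a) * ((?a * exp \<theta>) ^ k / fact k))"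
      unfolding emeasure_eq_measure prob by (subst ennreal_mult'[symmetric]) (simp_all add: power_mult_distrib mult_ac)
  qed
  also have "\<dots> = ennreal (\<Sum>k. exp (- ?a) * ((?a * exp \<theta>) ^ k / fact k))"
  proof (rule suminf_ennreal2)
    have "0 \<le> ?a * exp \<theta>" using a0 by simp
    from mult_nonneg_nonneg[OF exp_ge_zero divide_nonneg_pos[OF zero_le_power[OF this] fact_gt_zero]]
    show "0 \<le> exp (- ?a) * ((?a * exp \<theta>) ^ k / fact k)" for k .
    have "summable (\<lambda>k. (?a * exp \<theta>) ^ k / fact k)"
      using summable_exp[of "?a * exp \<theta>"] by (simp only: divide_inverse mult.commute)
    then show "summable (\<lambda>k. exp (- ?a) * ((?a * exp \<theta>) ^ k / fact k))" by (rule summable_mult)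
  qed
  also have "(\<Sum>k. exp (- ?a) * ((?a * exp \<theta>) ^ k / fact k)) = exp (- ?a) * exp (?a * exp \<theta>)"
    using exp_converges[of "?a * exp \<theta>"] by (intro sums_unique[symmetric] sums_mult) (simp add: divide_inverse mult_ac scaleR_conv_of_real)
  also have "\<dots> = exp (?a * (exp \<theta> - 1))" by (simp add: exp_add[symmetric] algebra_simps)
  finally show ?thesis .
qed

definition lattice_enum :: "nat \<Rightarrow> int \<times> int" where
  "lattice_enum = from_nat_into UNIV"

lemma bij_lattice_enum: "bij lattice_enum"
proof -
  have "infinite (UNIV :: (int \<times> int) set)" by (simp add: finite_prod infinite_UNIV_int)
  then show ?thesis unfolding lattice_enum_def by (intro bij_betw_from_nat_into) auto
qed

text \<open>
A bound for the part of the sum of \<open>decay\<close> that is due to the \<open>n\<close>-th cell; the summand \<open>1\<close> in the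
number of points stands for the grid.
\<close>

definition load :: "real \<Rightarrow> real \<Rightarrow> (real^2) set \<Rightarrow> nat \<Rightarrow> real" where
  "load s \<beta> S n = (2 + 1 / s) powr \<beta> * decay \<beta> (lattice_vec (lattice_enum n)) * (card (S \<inter> cell s (lattice_enum n)) + 1)"

lemma load_nonneg: "0 \<le> load s \<beta> S n"
  unfolding load_def by (intro mult_nonneg_nonneg less_imp_le[OF decay_pos]) auto

text \<open>
The cells are disjoint, so that the expectation of the product factors. Each factor is one plus a
quantity of the order of the weight of its cell, and the weights are summable.
The supremum over \<open>m\<close> replaces the exponential of the possibly infinite sum.
\<close>

lemma load_exp_moment:
  assumes "prob_space M" and P: "poisson_process M \<nu> \<Psi>" and s: "0 < s" and \<beta>: "2 < \<beta>" and c: "0 \<le> c" and \<nu>: "0 \<le> \<nu>"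
  shows "(\<integral>\<^sup>+\<omega>. (SUP m. ennreal (exp (c * (\<Sum>n<m. load s \<beta> (\<Psi> \<omega>) n)))) \<partial>M) < \<infinity>"
proof -
  interpret prob_space M by fact
  define V where "V = measure lborel (cell s (0, 0))"
  have V: "0 \<le> V" by (simp add: V_def)
  define w where "w n = c * ((2 + 1 / s) powr \<beta> * decay \<beta> (lattice_vec (lattice_enum n)))" for n
  define D where "D = c * (2 + 1 / s) powr \<beta>"
  have D: "0 \<le> D" using c by (simp add: D_def)
  have w: "0 \<le> w n" "w n \<le> D" for n
    using c decay_pos[of \<beta> "lattice_vec (lattice_enum n)"] decay_le_1[of \<beta> "lattice_vec (lattice_enum n)"] \<beta>
    by (auto simp: w_def D_def intro!: mult_nonneg_nonneg mult_left_le mult_left_mono)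
  obtain B where B: "\<And>G. finite G \<Longrightarrow> (\<Sum>z\<in>G. decay \<beta> (lattice_vec z)) \<le> B" using sum_decay_lattice_bounded[OF \<beta>] by blast
  have sum_w: "(\<Sum>n<m. w n) \<le> D * B" for m
  proof -
    have "(\<Sum>n<m. w n) = D * (\<Sum>n<m. decay \<beta> (lattice_vec (lattice_enum n)))"
      by (simp add: w_def D_def sum_distrib_left mult.assoc)
    also have "(\<Sum>n<m. decay \<beta> (lattice_vec (lattice_enum n))) = (\<Sum>z\<in>lattice_enum ` {..<m}. decay \<beta> (lattice_vec z))"
      by (subst sum.reindex) (use bij_is_inj[OF bij_lattice_enum] in \<open>auto intro: inj_on_subset\<close>)
    also have "\<dots> \<le> B" by (rule B) simp
    finally show ?thesis using D by (simp add: mult_left_mono)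
  qed
  let ?N = "\<lambda>n \<omega>. card (\<Psi> \<omega> \<inter> cell s (lattice_enum n))"
  have cells: "cell s z \<in> sets borel" "bounded (cell s z)" for z using bounded_cell[OF s] by auto
  have N[measurable]: "?N n \<in> M \<rightarrow>\<^sub>M count_space UNIV" for n
    using P cells by (simp add: poisson_process_def)
  let ?H = "\<lambda>m \<omega>. exp (c * (\<Sum>n<m. load s \<beta> (\<Psi> \<omega>) n))"
  have H: "?H m \<omega> = exp (\<Sum>n<m. w n) * (\<Prod>n<m. exp (w n * ?N n \<omega>))" for m \<omega>
    by (simp add: load_def w_def exp_sum[symmetric] exp_add[symmetric] sum.distrib[symmetric] sum_distrib_left algebra_simps)
  have H_meas: "(\<lambda>\<omega>. ennreal (?H m \<omega>)) \<in> borel_measurable M" for m unfolding H by measurable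
  define C where "C = exp (D * B + \<nu> * V * exp D * (D * B))"
  have bound: "(\<integral>\<^sup>+\<omega>. ennreal (?H m \<omega>) \<partial>M) \<le> ennreal C" for m
  proof -
    have ind: "indep_vars (\<lambda>_. count_space UNIV) ?N {..<m}"
    proof (rule P[unfolded poisson_process_def, THEN conjunct2, THEN conjunct2, rule_format])
      show "(\<forall>i<m. cell s (lattice_enum i) \<in> sets borel \<and> bounded (cell s (lattice_enum i))) \<and> disjoint_family_on (\<lambda>i. cell s (lattice_enum i)) {..<m}"
        using cells disjoint_cells bij_is_inj[OF bij_lattice_enum] by (auto simp: disjoint_family_on_def inj_eq)
    qed
    have ind': "indep_vars (\<lambda>_. borel) (\<lambda>n \<omega>. ennreal (exp (w n * ?N n \<omega>))) {..<m}"
      by (rule indep_vars_compose2[OF ind]) simp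
    have "(\<integral>\<^sup>+\<omega>. ennreal (?H m \<omega>) \<partial>M) = ennreal (exp (\<Sum>n<m. w n)) * (\<integral>\<^sup>+\<omega>. (\<Prod>n<m. ennreal (exp (w n * ?N n \<omega>))) \<partial>M)"
      unfolding H by (subst nn_integral_cmult[symmetric]) (auto intro!: nn_integral_cong simp: ennreal_mult' prod_ennreal)
    also have "(\<integral>\<^sup>+\<omega>. (\<Prod>n<m. ennreal (exp (w n * ?N n \<omega>))) \<partial>M) = (\<Prod>n<m. \<integral>\<^sup>+\<omega>. ennreal (exp (w n * ?N n \<omega>)) \<partial>M)"
      by (rule indep_vars_nn_integral[OF _ ind']) auto
    also have "\<dots> = (\<Prod>n<m. ennreal (exp (\<nu> * V * (exp (w n) - 1))))"
    proof (rule prod.cong[OF refl])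
      fix n
      have "(\<integral>\<^sup>+\<omega>. ennreal (exp (w n * ?N n \<omega>)) \<partial>M) = ennreal (exp (\<nu> * measure lborel (cell s (lattice_enum n)) * (exp (w n) - 1)))"
        by (rule poisson_count_exp_moment[OF \<open>prob_space M\<close> P cells])
      also have "measure lborel (cell s (lattice_enum n)) = V" unfolding V_def by (rule measure_cell[OF s])
      finally show "(\<integral>\<^sup>+\<omega>. ennreal (exp (w n * ?N n \<omega>)) \<partial>M) = ennreal (exp (\<nu> * V * (exp (w n) - 1)))" .
    qed
    also have "\<dots> = ennreal (exp (\<Sum>n<m. \<nu> * V * (exp (w n) - 1)))"
      by (simp add: prod_ennreal exp_sum)
    also have "ennreal (exp (\<Sum>n<m. w n)) * \<dots> = ennreal (exp ((\<Sum>n<m. w n) + (\<Sum>n<m. \<nu> * V * (exp (w n) - 1))))"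
      by (simp add: ennreal_mult'[symmetric] exp_add)
    also have "\<dots> \<le> ennreal C"
      unfolding C_def
    proof (intro ennreal_leI, subst exp_le_cancel_iff, intro add_mono sum_w)
      have e: "exp (w n) - 1 \<le> exp D * w n" for n
      proof -
        have "1 - w n \<le> exp (- w n)" using exp_ge_add_one_self[of "- w n"] by simp
        then have "exp (w n) * (1 - w n) \<le> exp (w n) * exp (- w n)" by (intro mult_left_mono) auto
        then have "exp (w n) - 1 \<le> exp (w n) * w n" by (simp add: exp_minus right_diff_distrib)
        also have "\<dots> \<le> exp D * w n" using w[of n] by (intro mult_right_mono) auto
        finally show ?thesis .
      qed
      have "(\<Sum>n<m. \<nu> * V * (exp (w n) - 1)) \<le> (\<Sum>n<m. \<nu> * V * (exp D * w n))"
        using e \<nu> V by (intro sum_mono mult_left_mono) auto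
      also have "\<dots> = \<nu> * V * exp D * (\<Sum>n<m. w n)" by (simp add: sum_distrib_left mult.assoc)
      also have "\<dots> \<le> \<nu> * V * exp D * (D * B)" using \<nu> V by (intro mult_left_mono sum_w) auto
      finally show "(\<Sum>n<m. \<nu> * V * (exp (w n) - 1)) \<le> \<nu> * V * exp D * (D * B)" .
    qed
    finally show ?thesis .
  qed
  have "(\<integral>\<^sup>+\<omega>. (SUP m. ennreal (?H m \<omega>)) \<partial>M) = (SUP m. \<integral>\<^sup>+\<omega>. ennreal (?H m \<omega>) \<partial>M)"
  proof (rule nn_integral_monotone_convergence_SUP)
    show "incseq (\<lambda>m \<omega>. ennreal (?H m \<omega>))"
      by (intro incseq_SucI le_funI ennreal_leI) (use c load_nonneg in \<open>simp add: mult_left_mono\<close>)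
  qed (rule H_meas)
  also have "\<dots> \<le> ennreal C" by (rule SUP_least) (rule bound)
  also have "\<dots> < \<infinity>" by simp
  finally show ?thesis .
qed

lemma card_grid_cell_le_1:
  assumes s: "0 < s"
  shows "card (shifted_grid s u \<inter> cell s z) \<le> 1"
proof -
  have "shifted_grid s u \<inter> cell s z \<subseteq> {s *\<^sub>R lattice_vec (fst z - \<lfloor>u $ 1 / s\<rfloor>, snd z - \<lfloor>u $ 2 / s\<rfloor>) + u}"
  proof
    fix x assume "x \<in> shifted_grid s u \<inter> cell s z"
    then obtain k where k: "x = s *\<^sub>R lattice_vec k + u" and "u + s *\<^sub>R lattice_vec k \<in> cell s z" by (auto simp: shifted_grid_eq add.commute)
    then have "u \<in> cell s (fst z - fst k, snd z - snd k)" by (simp only: add_lattice_mem_cell[OF s])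
    then have "k = (fst z - \<lfloor>u $ 1 / s\<rfloor>, snd z - \<lfloor>u $ 2 / s\<rfloor>)" by (simp add: cell_def prod_eq_iff)
    then show "x \<in> {s *\<^sub>R lattice_vec (fst z - \<lfloor>u $ 1 / s\<rfloor>, snd z - \<lfloor>u $ 2 / s\<rfloor>) + u}" using k by simp
  qed
  from card_mono[OF _ this] show ?thesis by simp
qed

lemma sum_decay_le_load:
  assumes s: "0 < s" and \<beta>: "0 < \<beta>" and S: "loc_finite S" and bij: "bij_betw X UNIV (S \<union> shifted_grid s u)"
  shows "(\<Sum>k. ennreal (decay \<beta> (X k))) \<le> (\<Sum>n. ennreal (load s \<beta> S n))"
proof -
  let ?q = "(2 + 1 / s) powr \<beta>" and ?z = lattice_enum
  let ?f = "\<lambda>n k. ennreal (?q * decay \<beta> (lattice_vec (?z n))) * indicator (cell s (?z n)) (X k)"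
  have "ennreal (decay \<beta> (X k)) \<le> (\<Sum>n. ?f n k)" for k
  proof -
    obtain n where n: "?z n = (\<lfloor>X k $ 1 / s\<rfloor>, \<lfloor>X k $ 2 / s\<rfloor>)" using bij_pointE[OF bij_lattice_enum] by metis
    then have x: "X k \<in> cell s (?z n)" by (simp add: cell_def)
    have "ennreal (decay \<beta> (X k)) \<le> ?f n k"
      using decay_on_cell[OF s \<beta> x] x by (simp add: ennreal_leI)
    also have "\<dots> = (\<Sum>m\<in>{n}. ?f m k)"
      by (subst sum.insert) (simp_all only: sum.empty add_0_right empty_iff finite.emptyI not_False_eq_True)
    also have "\<dots> \<le> (\<Sum>n. ?f n k)" by (rule sum_le_suminf) auto
    finally show ?thesis .
  qed
  then have "(\<Sum>k. ennreal (decay \<beta> (X k))) \<le> (\<Sum>k. \<Sum>n. ?f n k)" by (intro suminf_le) auto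
  also have "\<dots> = (\<Sum>n. \<Sum>k. ?f n k)"
    unfolding nn_integral_count_space_nat[symmetric, of "\<lambda>k. suminf (\<lambda>n. ?f n k)"]
    by (subst nn_integral_suminf) (auto simp: nn_integral_count_space_nat)
  also have "\<dots> \<le> (\<Sum>n. ennreal (load s \<beta> S n))"
  proof (rule suminf_le)
    fix n
    let ?Q = "cell s (?z n)" and ?S = "S \<union> shifted_grid s u"
    have lf: "loc_finite ?S" by (intro loc_finite_Un S loc_finite_shifted_grid s)
    have img: "X ` {k. X k \<in> ?Q} = ?S \<inter> ?Q" using bij by (auto simp: bij_betw_def)
    have inj: "inj_on X {k. X k \<in> ?Q}" using bij by (auto simp: bij_betw_def intro: inj_on_subset)
    have fin: "finite {k. X k \<in> ?Q}"
      using loc_finiteD[OF lf bounded_cell[OF s], of "?z n"] finite_imageD[OF _ inj] by (simp add: img)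
    have "(\<Sum>k. indicator ?Q (X k) :: ennreal) = (\<Sum>k\<in>{k. X k \<in> ?Q}. indicator ?Q (X k))"
      by (rule suminf_finite[OF fin]) auto
    also have "\<dots> = of_nat (card {k. X k \<in> ?Q})" by simp
    also have "card {k. X k \<in> ?Q} = card (?S \<inter> ?Q)" using card_image[OF inj] by (simp add: img)
    also have "?S \<inter> ?Q = (S \<inter> ?Q) \<union> (shifted_grid s u \<inter> ?Q)" by blast
    also have "of_nat (card \<dots>) \<le> (of_nat (card (S \<inter> ?Q) + 1) :: ennreal)"
      using card_Un_le[of "S \<inter> ?Q" "shifted_grid s u \<inter> ?Q"] card_grid_cell_le_1[OF s, of u "?z n"] by (intro of_nat_mono) linarith
    finally have cnt: "(\<Sum>k. indicator ?Q (X k) :: ennreal) \<le> of_nat (card (S \<inter> ?Q) + 1)" .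
    have "(\<Sum>k. ?f n k) = ennreal (?q * decay \<beta> (lattice_vec (?z n))) * (\<Sum>k. indicator ?Q (X k))" by (rule ennreal_suminf_cmult)
    also have "\<dots> \<le> ennreal (?q * decay \<beta> (lattice_vec (?z n))) * of_nat (card (S \<inter> ?Q) + 1)" using cnt by (rule mult_left_mono) simp
    also have "\<dots> = ennreal (load s \<beta> S n)"
      unfolding load_def ennreal_of_nat_eq_real_of_nat
      by (subst ennreal_mult'[symmetric]) (auto intro!: mult_nonneg_nonneg less_imp_le[OF decay_pos])
    finally show "(\<Sum>k. ?f n k) \<le> ennreal (load s \<beta> S n)" .
  qed auto
  finally show ?thesis .
qed

lemma borel_measurable_SUP_SUP:
  fixes f :: "nat \<Rightarrow> nat \<Rightarrow> 'a \<Rightarrow> ennreal"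
  assumes "\<And>i j. f i j \<in> borel_measurable S"
  shows "(\<lambda>a. SUP i. SUP j. f i j a) \<in> borel_measurable S"
proof -
  have "(\<lambda>a. SUP j. f i j a) \<in> borel_measurable S" for i
    using borel_measurable_SUP[of UNIV "f i" S] assms by simp
  then show ?thesis using borel_measurable_SUP[of UNIV "\<lambda>i a. SUP j. f i j a" S] by simp
qed

section \<open>Worst mean delay between neighbourhoods\<close>

context sinr_model
begin

text \<open>
In contrast to the mean delay between nearest points this does not depend on the enumeration, see
\<open>max_hops_enumeration\<close>.
\<close>

definition max_hops :: "real \<Rightarrow> (nat \<Rightarrow> real^2) \<Rightarrow> real^2 \<Rightarrow> real^2 \<Rightarrow> ennreal" where
  "max_hops r X x y = (SUP i. SUP j. if X i \<in> cball x r \<and> X j \<in> cball y r then mean_hops X i j else 0)"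

lemma mean_hops_le_max_hops: "X i \<in> cball x r \<Longrightarrow> X j \<in> cball y r \<Longrightarrow> mean_hops X i j \<le> max_hops r X x y"
  unfolding max_hops_def by (rule SUP_upper2[of i], simp, rule SUP_upper2[of j]) auto

lemma max_hops_least:
  assumes "\<And>i j. X i \<in> cball x r \<Longrightarrow> X j \<in> cball y r \<Longrightarrow> mean_hops X i j \<le> B"
  shows "max_hops r X x y \<le> B"
  unfolding max_hops_def by (intro SUP_least) (use assms in auto)

lemma max_hops_triangle:
  assumes "\<exists>j. X j \<in> cball y r"
  shows "max_hops r X x z \<le> max_hops r X x y + max_hops r X y z"
proof (rule max_hops_least)
  fix i k assume ik: "X i \<in> cball x r" "X k \<in> cball z r"
  obtain j where j: "X j \<in> cball y r" using assms by blast
  have "mean_hops X i k \<le> mean_hops X i j + mean_hops X j k" by (rule mean_hops_triangle)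
  also have "\<dots> \<le> max_hops r X x y + max_hops r X y z"
    using ik j by (intro add_mono mean_hops_le_max_hops)
  finally show "mean_hops X i k \<le> max_hops r X x y + max_hops r X y z" .
qed

lemma max_hops_translate: "max_hops r (\<lambda>i. X i - v) x y = max_hops r X (x + v) (y + v)"
proof -
  have d: "dist w (X i - v) = dist (w + v) (X i)" for i w by (simp add: dist_norm algebra_simps)
  have t: "mean_hops (\<lambda>i. X i - v) i j = mean_hops X i j" for i j
    using mean_hops_translate[of X "- v"] by simp
  show ?thesis by (simp only: max_hops_def mem_cball d t)
qed

text \<open>
Two enumerations of a set differ by a permutation of indices, which leaves the law of the marks
unchanged.
\<close>

lemma max_hops_enumeration:
  assumes X: "bij_betw X UNIV S" and Y: "bij_betw Y UNIV S"
  shows "max_hops r X x y = max_hops r Y x y"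
proof -
  have le: "max_hops r Y x y \<le> max_hops r X x y" if X: "bij_betw X UNIV S" and Y: "bij_betw Y UNIV S" for X Y
  proof -
    define \<sigma> where "\<sigma> = inv_into UNIV X \<circ> Y"
    have \<sigma>: "bij \<sigma>" unfolding \<sigma>_def by (rule bij_betw_trans[OF Y bij_betw_inv_into[OF X]])
    have YX: "Y = X \<circ> \<sigma>"
    proof
      fix i
      have "Y i \<in> X ` UNIV" using X Y by (auto simp: bij_betw_def)
      then show "Y i = (X \<circ> \<sigma>) i" by (simp add: \<sigma>_def f_inv_into_f)
    qed
    show ?thesis
    proof (rule max_hops_least)
      fix i j assume "Y i \<in> cball x r" "Y j \<in> cball y r"
      then have "mean_hops X (\<sigma> i) (\<sigma> j) \<le> max_hops r X x y"
        unfolding YX comp_def by (rule mean_hops_le_max_hops)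
      then show "mean_hops Y i j \<le> max_hops r X x y" unfolding YX mean_hops_permute[OF \<sigma>] .
    qed
  qed
  show ?thesis using le[OF X Y] le[OF Y X] by (rule antisym[rotated])
qed

lemma measurable_max_hops:
  fixes X :: "'a \<Rightarrow> nat \<Rightarrow> real^2"
  assumes "\<And>i. (\<lambda>a. X a i) \<in> borel_measurable S"
  shows "(\<lambda>a. max_hops r (X a) x y) \<in> borel_measurable S"
proof -
  define f where "f i j a = (if X a i \<in> cball x r \<and> X a j \<in> cball y r then mean_hops (X a) i j else 0)" for i j a
  have f: "(\<lambda>a. f i j a) \<in> borel_measurable S" for i j
  proof -
    have "{a \<in> space S. X a i \<in> cball x r \<and> X a j \<in> cball y r} =
        ((\<lambda>a. X a i) -` cball x r \<inter> space S) \<inter> ((\<lambda>a. X a j) -` cball y r \<inter> space S)" by auto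
    also have "\<dots> \<in> sets S"
      by (intro sets.Int measurable_sets[OF assms] borel_closed closed_cball)
    finally have P: "{a \<in> space S. X a i \<in> cball x r \<and> X a j \<in> cball y r} \<in> sets S" .
    have m: "(\<lambda>a. mean_hops (X a) i j) \<in> borel_measurable S" by (rule measurable_mean_hops) (rule assms)
    show ?thesis unfolding f_def by (rule measurable_If[OF m borel_measurable_const P])
  qed
  have "(\<lambda>a. SUP i. SUP j. f i j a) \<in> borel_measurable S" by (rule borel_measurable_SUP_SUP) (rule f)
  then show ?thesis unfolding max_hops_def f_def .
qed

end

section \<open>Measurability of being an enumeration\<close>

text \<open>
An injective enumeration of a part of a locally finite set exhausts it as soon as it
finds the right number of points in every ball around the origin. In this form the property is a countable
conjunction of measurable conditions.
\<close>

lemma bij_betw_iff_counts: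
  assumes S: "loc_finite S"
  shows "bij_betw Y UNIV S \<longleftrightarrow> (\<forall>i j. Y i = Y j \<longrightarrow> i = j) \<and> (\<forall>i. Y i \<in> S) \<and>
    (\<forall>n::nat. card {i. Y i \<in> ball 0 (real n)} = card (S \<inter> ball 0 (real n)))" (is "?L \<longleftrightarrow> ?R")
proof
  assume L: ?L
  have "card {i. Y i \<in> ball 0 (real n)} = card (S \<inter> ball 0 (real n))" for n :: nat
  proof -
    have "Y ` {i. Y i \<in> ball 0 (real n)} = S \<inter> ball 0 (real n)" using L by (auto simp: bij_betw_def)
    moreover have "inj_on Y {i. Y i \<in> ball 0 (real n)}" using L by (auto simp: bij_betw_def intro: inj_on_subset)
    ultimately show ?thesis using card_image by fastforce
  qed
  then show ?R using L by (auto simp: bij_betw_def inj_on_def)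
next
  assume R: ?R
  then have inj: "inj Y" by (auto simp: inj_on_def)
  have "S \<subseteq> range Y"
  proof
    fix x assume x: "x \<in> S"
    obtain n :: nat where n: "norm x < n" using reals_Archimedean2 by blast
    have fin: "finite (S \<inter> ball 0 (real n))" by (rule loc_finiteD[OF S]) simp
    have sub: "Y ` {i. Y i \<in> ball 0 (real n)} \<subseteq> S \<inter> ball 0 (real n)" using R by auto
    have "card (Y ` {i. Y i \<in> ball 0 (real n)}) = card (S \<inter> ball 0 (real n))"
      using R card_image[OF inj_on_subset[OF inj subset_UNIV]] by simp
    then have "Y ` {i. Y i \<in> ball 0 (real n)} = S \<inter> ball 0 (real n)" by (rule card_subset_eq[OF fin sub])
    moreover have "x \<in> S \<inter> ball 0 (real n)" using x n by simp
    ultimately show "x \<in> range Y" by blast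
  qed
  then show ?L using R inj by (auto simp: bij_betw_def)
qed

lemma pred_enumerates:
  fixes f :: "nat \<Rightarrow> (real^2) set \<Rightarrow> real^2"
  assumes f[measurable]: "\<And>i. f i \<in> borel_measurable conf"
  shows "Measurable.pred conf (\<lambda>S. bij_betw (\<lambda>i. f i S) UNIV S)"
proof (subst measurable_cong[OF bij_betw_iff_counts])
  have "(\<lambda>S. (S, f i S)) \<in> conf \<rightarrow>\<^sub>M conf \<Otimes>\<^sub>M borel" for i by measurable
  from measurable_compose[OF this pred_mem_conf]
  have [measurable]: "Measurable.pred conf (\<lambda>S. f i S \<in> S)" for i by simp
  have c2: "(\<lambda>S. card (S \<inter> ball 0 (real n))) \<in> conf \<rightarrow>\<^sub>M count_space UNIV" for n :: nat
    by (rule measurable_card_conf) auto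
  have c1: "(\<lambda>S. card {i. f i S \<in> ball 0 (real n)}) \<in> conf \<rightarrow>\<^sub>M count_space UNIV" for n :: nat
  proof (rule measurable_card)
    fix i
    show "{S \<in> space conf. i \<in> {i. f i S \<in> ball 0 (real n)}} \<in> sets conf"
      unfolding mem_Collect_eq mem_ball by measurable
  qed
  have "Measurable.pred conf (\<lambda>S. \<forall>i j. f i S = f j S \<longrightarrow> i = j)" by measurable
  moreover have "Measurable.pred conf (\<lambda>S. \<forall>i. f i S \<in> S)" by measurable
  moreover have "Measurable.pred conf (\<lambda>S. \<forall>n::nat. card {i. f i S \<in> ball 0 (real n)} = card (S \<inter> ball 0 (real n)))"
  proof (rule pred_intros_countable)
    fix n :: nat
    have "Measurable.pred conf (\<lambda>S. real (card {i. f i S \<in> ball 0 (real n)}) = real (card (S \<inter> ball 0 (real n))))"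
      unfolding pred_def
      by (rule borel_measurable_eq) (rule measurable_compose[OF c1] measurable_compose[OF c2], simp)+
    then show "Measurable.pred conf (\<lambda>S. card {i. f i S \<in> ball 0 (real n)} = card (S \<inter> ball 0 (real n)))" by simp
  qed
  ultimately show "Measurable.pred conf (\<lambda>S. (\<forall>i j. f i S = f j S \<longrightarrow> i = j) \<and> (\<forall>i. f i S \<in> S) \<and>
    (\<forall>n::nat. card {i. f i S \<in> ball 0 (real n)} = card (S \<inter> ball 0 (real n))))"
    by (rule pred_intros_logic(3)[OF _ pred_intros_logic(3)])
qed simp

section \<open>Nearest points\<close>

lemma grid_point_near:
  assumes s: "0 < s"
  shows "\<exists>y\<in>shifted_grid s u. dist x y \<le> 2 * s"
proof -
  define k where "k = (\<lfloor>(x $ 1 - u $ 1) / s\<rfloor>, \<lfloor>(x $ 2 - u $ 2) / s\<rfloor>)"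
  let ?y = "s *\<^sub>R lattice_vec k + u"
  have c: "\<bar>a - (s * of_int \<lfloor>(a - b) / s\<rfloor> + b)\<bar> \<le> s" for a b :: real
  proof -
    let ?q = "(a - b) / s"
    have q: "s * ?q = a - b" using s by simp
    have "s * of_int \<lfloor>?q\<rfloor> \<le> s * ?q" "s * ?q \<le> s * (of_int \<lfloor>?q\<rfloor> + 1)"
      using s by (intro mult_left_mono; linarith)+
    then show ?thesis unfolding q distrib_left by linarith
  qed
  have "norm (x - ?y) \<le> (\<Sum>i\<in>UNIV. \<bar>(x - ?y) $ i\<bar>)" by (rule norm_le_l1_cart)
  also have "\<dots> = \<bar>(x - ?y) $ 1\<bar> + \<bar>(x - ?y) $ 2\<bar>" by (simp add: UNIV_2)
  also have "\<dots> \<le> s + s" using c[of "x $ 1" "u $ 1"] c[of "x $ 2" "u $ 2"] by (intro add_mono) (simp_all add: k_def)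
  finally show ?thesis by (intro bexI[of _ ?y]) (auto simp: dist_norm shifted_grid_eq)
qed

text \<open>
Local finiteness yields a minimiser of the distance, so that the least index in the definition of \<open>nearest\<close>
exists.
\<close>

lemma nearest_index:
  assumes S: "loc_finite S" and X: "bij_betw X UNIV S" and near: "\<exists>y\<in>S. dist x y \<le> r"
  obtains i where "nearest X x = X i" "X i \<in> cball x r"
proof -
  obtain y where y: "y \<in> S" "dist x y \<le> r" using near by blast
  then obtain i0 where i0: "X i0 = y" using X by (auto simp: bij_betw_def)
  have fin: "finite (S \<inter> cball x r)" by (rule loc_finiteD[OF S]) simp
  define z where "z = arg_min_on (dist x) (S \<inter> cball x r)"
  have ne: "S \<inter> cball x r \<noteq> {}" using y by auto
  have zS: "z \<in> S \<inter> cball x r" unfolding z_def by (rule arg_min_if_finite(1)[OF fin ne])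
  have "\<not> (\<exists>z'\<in>S \<inter> cball x r. dist x z' < dist x z)" unfolding z_def by (rule arg_min_if_finite(2)[OF fin ne])
  then have z: "z \<in> S" "dist x z \<le> r" "\<And>z'. z' \<in> S \<Longrightarrow> dist x z' \<le> r \<Longrightarrow> dist x z \<le> dist x z'"
    using zS by (auto simp: not_less)
  obtain i where i: "X i = z" using X z(1) by (auto simp: bij_betw_def)
  have "dist x (X i) \<le> dist x (X j)" for j
  proof (cases "dist x (X j) \<le> r")
    case True
    then show ?thesis using z(3)[of "X j"] X i by (auto simp: bij_betw_def)
  next
    case False
    then show ?thesis using z(2) i by simp
  qed
  then have ex: "\<exists>i. \<forall>j. dist x (X i) \<le> dist x (X j)" by blast
  define k where "k = (LEAST i. \<forall>j. dist x (X i) \<le> dist x (X j))"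
  have "\<forall>j. dist x (X k) \<le> dist x (X j)" unfolding k_def using ex by (rule LeastI_ex)
  then have "dist x (X k) \<le> dist x (X i0)" by blast
  then have "dist x (X k) \<le> r" using y(2) i0 by simp
  then show ?thesis using that[of k] by (simp add: nearest_def k_def)
qed

context sinr_exponential
begin

text \<open>
If the supremum on the right-hand side is finite, the loads are summable, and their sum plays the
role of \<open>\<sigma>\<close> in \<open>mean_hops_le_exp_decay\<close>.
\<close>

lemma mean_hops_le_load:
  assumes R: "1 \<le> R" and s: "0 < s"
  shows "\<exists>C c. 0 \<le> c \<and> (\<forall>X S u i j. loc_finite S \<longrightarrow> bij_betw X UNIV (S \<union> shifted_grid s u) \<longrightarrow>
    norm (X i) \<le> R \<longrightarrow> norm (X j) \<le> R \<longrightarrow>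
    mean_hops X i j \<le> ennreal C * (SUP m. ennreal (exp (c * (\<Sum>n<m. load s \<beta> S n)))))"
proof -
  obtain C c where C: "0 \<le> C" and c: "0 \<le> c"
    and bound: "\<And>X i j \<sigma>. inj X \<Longrightarrow> norm (X i) \<le> R \<Longrightarrow> norm (X j) \<le> R \<Longrightarrow> 0 \<le> \<sigma> \<Longrightarrow>
     (\<Sum>k. ennreal (decay \<beta> (X k))) \<le> ennreal \<sigma> \<Longrightarrow> mean_hops X i j \<le> ennreal (C * exp (c * \<sigma>))"
    using mean_hops_le_exp_decay[OF R] by blast
  have "mean_hops X i j \<le> ennreal (C + 1) * (SUP m. ennreal (exp ((c + 1) * (\<Sum>n<m. load s \<beta> S n))))"
    if S: "loc_finite S" and X: "bij_betw X UNIV (S \<union> shifted_grid s u)" and ij: "norm (X i) \<le> R" "norm (X j) \<le> R" for X S u i j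
  proof -
    let ?L = "load s \<beta> S"
    define h where "h = (SUP m. ennreal (exp ((c + 1) * (\<Sum>n<m. ?L n))))"
    show ?thesis
    proof (cases "h = \<infinity>")
      case True
      then show ?thesis using C by (simp add: h_def[symmetric] ennreal_mult_top)
    next
      case False
      have le_h: "ennreal (exp ((c + 1) * (\<Sum>n<m. ?L n))) \<le> h" for m unfolding h_def by (rule SUP_upper) simp
      obtain hr where hr: "h = ennreal hr" "0 \<le> hr" using False by (cases h) auto
      have ex: "exp ((c + 1) * (\<Sum>n<m. ?L n)) \<le> hr" for m using le_h[of m] hr by simp
      have pos: "0 < hr" using ex[of 0] by (simp add: less_le_trans[OF zero_less_one])
      have bnd: "(\<Sum>n<m. ?L n) \<le> ln hr" for m
      proof -
        have "0 \<le> (\<Sum>n<m. ?L n)" by (intro sum_nonneg load_nonneg)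
        then have "(\<Sum>n<m. ?L n) \<le> (c + 1) * (\<Sum>n<m. ?L n)" using c by (simp add: mult_le_cancel_right1)
        also have "\<dots> \<le> ln hr" using ex[of m] pos by (simp add: ln_ge_iff)
        finally show ?thesis .
      qed
      have sm: "summable ?L" by (rule summableI_nonneg_bounded[OF load_nonneg bnd])
      have \<sigma>: "0 \<le> suminf ?L" using sm load_nonneg by (rule suminf_nonneg)
      have "(\<lambda>m. exp ((c + 1) * (\<Sum>n<m. ?L n))) \<longlonglongrightarrow> exp ((c + 1) * suminf ?L)"
        by (intro tendsto_intros summable_LIMSEQ sm)
      then have le: "exp ((c + 1) * suminf ?L) \<le> hr" by (rule LIMSEQ_le_const2) (use ex in blast)
      have "(\<Sum>k. ennreal (decay \<beta> (X k))) \<le> (\<Sum>n. ennreal (?L n))"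
        using \<beta> by (intro sum_decay_le_load[OF s _ S X]) simp
      also have "\<dots> = ennreal (suminf ?L)" by (rule suminf_ennreal2[OF load_nonneg sm])
      finally have "mean_hops X i j \<le> ennreal (C * exp (c * suminf ?L))"
        by (intro bound ij \<sigma>) (use X in \<open>auto simp: bij_betw_def\<close>)
      also have "\<dots> \<le> ennreal ((C + 1) * hr)"
      proof (rule ennreal_leI, rule mult_mono)
        have "exp (c * suminf ?L) \<le> exp ((c + 1) * suminf ?L)" using \<sigma> by (simp add: mult_right_mono)
        then show "exp (c * suminf ?L) \<le> hr" using le by linarith
      qed (use C in auto)
      also have "\<dots> = ennreal (C + 1) * h" using C by (simp add: hr ennreal_mult')
      finally show ?thesis by (simp add: h_def)
    qed
  qed
  then show ?thesis using c by (intro exI[of _ "C + 1"] exI[of _ "c + 1"]) auto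
qed

end

section \<open>The network as a stationary system\<close>

lemma load_measurable:
  assumes "poisson_process M \<nu> \<Psi>" "0 < s"
  shows "(\<lambda>\<omega>. load s \<beta> (\<Psi> \<omega>) n) \<in> borel_measurable M"
proof -
  have [measurable]: "(\<lambda>\<omega>. card (\<Psi> \<omega> \<inter> cell s (lattice_enum n))) \<in> M \<rightarrow>\<^sub>M count_space UNIV"
    using assms bounded_cell[OF assms(2)] by (simp add: poisson_process_def)
  show ?thesis unfolding load_def by measurable
qed

locale poisson_grid_network = sinr_exponential p \<W> \<mu> T A \<beta> + prob_space M
  for p :: real and \<W> :: "real measure" and \<mu> T A \<beta> :: real and M :: "'w measure" +
  fixes \<Phi>\<^sub>M \<Phi> :: "'w \<Rightarrow> (real^2) set" and U :: "'w \<Rightarrow> real^2"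
    and X :: "nat \<Rightarrow> 'w \<Rightarrow> real^2"
    and e :: "'w \<Rightarrow> nat \<times> int \<Rightarrow> bool" and W :: "'w \<Rightarrow> nat \<times> int \<Rightarrow> real"
    and F :: "'w \<Rightarrow> nat \<times> nat \<times> int \<Rightarrow> real"
    and \<nu> s :: real and d :: "real^2"
  assumes \<nu>: "0 < \<nu>" and poisson: "poisson_process M \<nu> \<Phi>\<^sub>M" and s: "0 < s"
    and U_unif: "distr M borel U = uniform_measure lborel (cbox 0 (\<chi> i. s))"
    and U_indep: "indep_of_process M \<Phi>\<^sub>M borel U"
    and \<Phi>_eq: "\<And>\<omega>. \<omega> \<in> space M \<Longrightarrow> \<Phi> \<omega> = \<Phi>\<^sub>M \<omega> \<union> shifted_grid s (U \<omega>)"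
    and X_meas: "\<And>i. X i \<in> borel_measurable (process_algebra M \<Phi>)"
    and X_bij: "\<And>\<omega>. \<omega> \<in> space M \<Longrightarrow> bij_betw (\<lambda>i. X i \<omega>) UNIV (\<Phi> \<omega>)"
    and marks_distr: "distr M K (\<lambda>\<omega>. (e \<omega>, W \<omega>, F \<omega>)) = K"
    and marks_indep: "indep_of_process M \<Phi> K (\<lambda>\<omega>. (e \<omega>, W \<omega>, F \<omega>))"
    and d: "norm d = 1"
begin

text \<open>
Every point of the plane has a grid point within distance \<open>2 * s\<close>. The additional \<open>1\<close> makes up for the
distance between \<open>t d\<close> and \<open>\<lfloor>t\<rfloor> d\<close>.
\<close>

definition radius :: real where "radius = 2 * s + 1"

lemma loc_finite_\<Phi>: "\<omega> \<in> space M \<Longrightarrow> loc_finite (\<Phi> \<omega>)"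
  by (simp add: \<Phi>_eq loc_finite_Un loc_finite_shifted_grid[OF s] poisson_process_loc_finite[OF poisson])

lemma \<Phi>_measurable [measurable]: "\<Phi> \<in> M \<rightarrow>\<^sub>M conf"
proof -
  have "(\<lambda>\<omega>. (\<Phi>\<^sub>M \<omega>, U \<omega>)) \<in> M \<rightarrow>\<^sub>M conf \<Otimes>\<^sub>M borel"
    using poisson_process_measurable[OF poisson] U_indep by (intro measurable_Pair) (simp_all add: indep_of_process_def)
  from measurable_compose[OF this measurable_Un_grid[OF s]]
  show ?thesis by (rule measurable_cong[THEN iffD1, rotated]) (simp add: \<Phi>_eq)
qed

definition law :: "(real^2) set measure" where "law = distr M conf \<Phi>"

definition shift :: "(real^2) set \<Rightarrow> (real^2) set" where "shift S = (\<lambda>x. x - d) ` S"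

lemma sets_law [measurable_cong]: "sets law = sets conf" by (simp add: law_def)

lemma space_law [simp]: "space law = {S. loc_finite S}" by (simp add: law_def)

lemma shift_iterate: "(shift ^^ n) S = (\<lambda>x. x - real n *\<^sub>R d) ` S"
  by (induction n) (simp_all add: shift_def image_image algebra_simps)

sublocale law: measure_preserving law shift
proof -
  interpret L: prob_space law unfolding law_def by (rule prob_space_distr) simp
  show "measure_preserving law shift"
  proof
    show m: "shift \<in> law \<rightarrow>\<^sub>M law" unfolding shift_def by measurable
    have "distr law law shift = distr M conf (\<lambda>\<omega>. shift (\<Phi> \<omega>))"
    proof -
      have sm: "shift \<in> conf \<rightarrow>\<^sub>M conf" unfolding shift_def by measurable
      have "distr law law shift = distr law conf shift" by (rule distr_cong) (auto simp: sets_law)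
      then show ?thesis unfolding law_def by (simp add: distr_distr[OF sm \<Phi>_measurable] comp_def)
    qed
    also have "\<dots> = distr M conf (\<lambda>\<omega>. (\<lambda>x. x - d) ` (\<Phi>\<^sub>M \<omega> \<union> shifted_grid s (U \<omega>)))"
      unfolding shift_def by (rule distr_cong) (auto simp: \<Phi>_eq)
    also have "\<dots> = distr M conf (\<lambda>\<omega>. \<Phi>\<^sub>M \<omega> \<union> shifted_grid s (U \<omega>))"
      by (rule superposition_law_translate[OF prob_space_axioms poisson s U_unif U_indep])
    also have "\<dots> = law" unfolding law_def by (rule distr_cong) (auto simp: \<Phi>_eq)
    finally show "distr law law shift = law" .
  qed
qed

lemma AE_law_iff: "Measurable.pred conf P \<Longrightarrow> (AE S in law. P S) \<longleftrightarrow> (AE \<omega> in M. P (\<Phi> \<omega>))"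
  unfolding law_def by (subst AE_distr_iff) (auto simp: pred_def)

lemma AE_lawD: "AE S in law. P S \<Longrightarrow> AE \<omega> in M. P (\<Phi> \<omega>)"
  unfolding law_def by (rule AE_distrD[OF \<Phi>_measurable])

lemma nn_integral_law: "f \<in> borel_measurable conf \<Longrightarrow> (\<integral>\<^sup>+S. f S \<partial>law) = (\<integral>\<^sup>+\<omega>. f (\<Phi> \<omega>) \<partial>M)"
  unfolding law_def by (rule nn_integral_distr) auto

text \<open>
Since the enumeration is measurable with respect to the point process, it can be read off from the
configuration, and then also be evaluated at translated configurations.
\<close>

lemma factor_X: "\<exists>f. f \<in> borel_measurable conf \<and> (\<forall>\<omega>\<in>space M. X i \<omega> = f (\<Phi> \<omega>))"
proof -
  have "X i \<in> borel_measurable (vimage_algebra (space M) \<Phi> conf)"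
    using X_meas[of i] process_algebra_eq_vimage[of M \<Phi>, OF loc_finite_\<Phi>] by (simp cong: measurable_cong_sets)
  from factor_euclidean[OF this] loc_finite_\<Phi> show ?thesis by (metis (mono_tags, lifting) Pi_I mem_Collect_eq space_conf)
qed

definition pts :: "(real^2) set \<Rightarrow> nat \<Rightarrow> real^2" where
  "pts = (SOME f. \<forall>i. (\<lambda>S. f S i) \<in> borel_measurable conf \<and> (\<forall>\<omega>\<in>space M. X i \<omega> = f (\<Phi> \<omega>) i))"

lemma pts: "(\<lambda>S. pts S i) \<in> borel_measurable conf" "\<omega> \<in> space M \<Longrightarrow> pts (\<Phi> \<omega>) i = X i \<omega>"
proof -
  obtain f where f: "\<And>i. f i \<in> borel_measurable conf" "\<And>i \<omega>. \<omega> \<in> space M \<Longrightarrow> X i \<omega> = f i (\<Phi> \<omega>)"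
    using factor_X by metis
  have "\<exists>f. \<forall>i. (\<lambda>S. f S i) \<in> borel_measurable conf \<and> (\<forall>\<omega>\<in>space M. X i \<omega> = f (\<Phi> \<omega>) i)"
    by (rule exI[of _ "\<lambda>S i. f i S"]) (simp add: f)
  from someI_ex[OF this, folded pts_def]
  show "(\<lambda>S. pts S i) \<in> borel_measurable conf" "\<omega> \<in> space M \<Longrightarrow> pts (\<Phi> \<omega>) i = X i \<omega>"
    by auto
qed

lemma pts_\<Phi>: "\<omega> \<in> space M \<Longrightarrow> pts (\<Phi> \<omega>) = (\<lambda>i. X i \<omega>)"
  by (rule ext) (rule pts(2))

text \<open>
Being an enumeration is a measurable property, hence it is inherited by the translated
configurations, which have the same law.
\<close>

lemma AE_enumerates: "AE S in law. \<forall>n. bij_betw (pts ((shift ^^ n) S)) UNIV ((shift ^^ n) S)"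
proof (rule law.AE_iterate)
  have "AE \<omega> in M. bij_betw (pts (\<Phi> \<omega>)) UNIV (\<Phi> \<omega>)" by (rule AE_I2) (simp add: pts_\<Phi> X_bij)
  then show "AE S in law. bij_betw (pts S) UNIV S" using pred_enumerates[OF pts(1)] by (subst AE_law_iff) auto
qed

definition region_delay :: "real^2 \<Rightarrow> real^2 \<Rightarrow> (real^2) set \<Rightarrow> ennreal" where
  "region_delay x y S = max_hops radius (pts S) x y"

lemma region_delay_measurable [measurable]: "region_delay x y \<in> borel_measurable conf"
  unfolding region_delay_def by (rule measurable_max_hops) (rule pts(1))

lemma region_delay_measurable_law [measurable]: "region_delay x y \<in> borel_measurable law"
  by (subst measurable_cong_sets[OF sets_law refl]) (rule region_delay_measurable)

lemma region_delay_iterate_measurable [measurable]: "(\<lambda>S. region_delay x y ((shift ^^ n) S)) \<in> borel_measurable law"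
  by (rule measurable_compose[OF law.iterate_measurable region_delay_measurable_law])

text \<open>
The enumeration of a translated configuration need not be the translate of the enumeration, but both
enumerate the same set.
\<close>

lemma AE_region_delay_shift: "AE S in law. \<forall>n x y. region_delay x y ((shift ^^ n) S) = region_delay (x + real n *\<^sub>R d) (y + real n *\<^sub>R d) S"
  using AE_enumerates
proof eventually_elim
  case (elim S)
  show ?case
  proof (intro allI)
    fix n x y
    let ?v = "real n *\<^sub>R d"
    have b: "bij_betw (pts S) UNIV S" using elim[rule_format, of 0] by simp
    have "bij_betw (\<lambda>i. pts S i - ?v) UNIV ((\<lambda>x. x - ?v) ` S)"
      using bij_betw_trans[OF b, of "\<lambda>x. x - ?v" "(\<lambda>x. x - ?v) ` S"] by (simp add: bij_betw_def inj_on_def comp_def)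
    moreover have "bij_betw (pts ((shift ^^ n) S)) UNIV ((\<lambda>x. x - ?v) ` S)" using elim[rule_format, of n] by (simp only: shift_iterate)
    ultimately have "region_delay x y ((shift ^^ n) S) = max_hops radius (\<lambda>i. pts S i - ?v) x y"
      unfolding region_delay_def by (intro max_hops_enumeration)
    then show "region_delay x y ((shift ^^ n) S) = region_delay (x + ?v) (y + ?v) S" by (simp add: max_hops_translate region_delay_def)
  qed
qed

lemma nearest_X:
  assumes "\<omega> \<in> space M"
  obtains i where "nearest (\<lambda>i. X i \<omega>) x = X i \<omega>" "X i \<omega> \<in> cball x (2 * s)"
proof -
  have "\<exists>y\<in>\<Phi> \<omega>. dist x y \<le> 2 * s" using grid_point_near[OF s, of "U \<omega>" x] by (auto simp: \<Phi>_eq[OF assms])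
  from nearest_index[OF loc_finite_\<Phi>[OF assms] X_bij[OF assms] this] that show ?thesis by blast
qed

lemma AE_region_delay_triangle: "AE S in law. \<forall>n x z. region_delay x z S \<le> region_delay x (real n *\<^sub>R d) S + region_delay (real n *\<^sub>R d) z S"
proof -
  have "AE S in law. \<forall>n::nat. \<exists>j. pts S j \<in> cball (real n *\<^sub>R d) radius"
  proof (subst AE_law_iff)
    note [measurable] = pts(1)
    show "Measurable.pred conf (\<lambda>S. \<forall>n::nat. \<exists>j. pts S j \<in> cball (real n *\<^sub>R d) radius)" unfolding mem_cball by measurable
    show "AE \<omega> in M. \<forall>n::nat. \<exists>j. pts (\<Phi> \<omega>) j \<in> cball (real n *\<^sub>R d) radius"
    proof (rule AE_I2, rule allI)
      fix \<omega> and n :: nat assume \<omega>: "\<omega> \<in> space M"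
      obtain i where "X i \<omega> \<in> cball (real n *\<^sub>R d) (2 * s)" using nearest_X[OF \<omega>] by blast
      then show "\<exists>j. pts (\<Phi> \<omega>) j \<in> cball (real n *\<^sub>R d) radius" using pts(2)[OF \<omega>, of i] by (auto simp: radius_def intro!: exI[of _ i])
    qed
  qed
  then show ?thesis by eventually_elim (simp add: region_delay_def max_hops_triangle)
qed

text \<open>
All points that occur lie in a ball around the origin, since \<open>y\<close> is near the origin.
\<close>

lemma region_delay_integral_finite:
  assumes "norm y \<le> 1"
  shows "(\<integral>\<^sup>+S. region_delay 0 y S \<partial>law) < \<infinity>"
proof -
  define R where "R = radius + 1"
  have R: "1 \<le> R" using s by (simp add: R_def radius_def)
  obtain C c where c: "0 \<le> c" and bound: "\<And>X S u i j. loc_finite S \<Longrightarrow> bij_betw X UNIV (S \<union> shifted_grid s u) \<Longrightarrow>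
    norm (X i) \<le> R \<Longrightarrow> norm (X j) \<le> R \<Longrightarrow>
    mean_hops X i j \<le> ennreal C * (SUP m. ennreal (exp (c * (\<Sum>n<m. load s \<beta> S n))))"
    using mean_hops_le_load[OF R s] by blast
  define H where "H \<omega> = (SUP m. ennreal (exp (c * (\<Sum>n<m. load s \<beta> (\<Phi>\<^sub>M \<omega>) n))))" for \<omega>
  note [measurable] = load_measurable[OF poisson s]
  have [measurable]: "H \<in> borel_measurable M" unfolding H_def by measurable
  have H: "(\<integral>\<^sup>+\<omega>. H \<omega> \<partial>M) < \<infinity>"
    unfolding H_def by (rule load_exp_moment[OF prob_space_axioms poisson s \<beta> c]) (use \<nu> in simp)
  have "region_delay 0 y (\<Phi> \<omega>) \<le> ennreal C * H \<omega>" if \<omega>: "\<omega> \<in> space M" for \<omega>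
    unfolding region_delay_def pts_\<Phi>[OF \<omega>]
  proof (rule max_hops_least)
    fix i j assume i: "X i \<omega> \<in> cball 0 radius" and j: "X j \<omega> \<in> cball y radius"
    have "norm (X i \<omega>) \<le> R" using i by (simp add: R_def)
    moreover have "norm (X j \<omega>) \<le> R"
      using j assms norm_triangle_sub[of "X j \<omega>" y] by (simp add: R_def dist_norm norm_minus_commute)
    ultimately show "mean_hops (\<lambda>i. X i \<omega>) i j \<le> ennreal C * H \<omega>"
      unfolding H_def by (intro bound[of "\<Phi>\<^sub>M \<omega>" "\<lambda>i. X i \<omega>" "U \<omega>" i j]) (use \<omega> X_bij[OF \<omega>] poisson_process_loc_finite[OF poisson \<omega>] in \<open>simp_all add: \<Phi>_eq\<close>)
  qed
  then have "(\<integral>\<^sup>+\<omega>. region_delay 0 y (\<Phi> \<omega>) \<partial>M) \<le> (\<integral>\<^sup>+\<omega>. ennreal C * H \<omega> \<partial>M)" by (rule nn_integral_mono)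
  also have "\<dots> = ennreal C * (\<integral>\<^sup>+\<omega>. H \<omega> \<partial>M)" by (rule nn_integral_cmult) simp
  also have "\<dots> < \<infinity>" using H by (simp add: ennreal_mult_less_top)
  finally show ?thesis by (simp add: nn_integral_law)
qed

lemma region_delay_integral_finite_iterate: "(\<integral>\<^sup>+S. region_delay 0 (real n *\<^sub>R d) S \<partial>law) < \<infinity>"
proof (induction n)
  case 0
  show ?case using region_delay_integral_finite[of 0] by simp
next
  case (Suc n)
  have "AE S in law. region_delay 0 (real (Suc n) *\<^sub>R d) S \<le> region_delay 0 (real n *\<^sub>R d) S + region_delay 0 d ((shift ^^ n) S)"
    using AE_region_delay_triangle AE_region_delay_shift
  proof eventually_elim
    case (elim S)
    have "region_delay 0 d ((shift ^^ n) S) = region_delay (real n *\<^sub>R d) (real (Suc n) *\<^sub>R d) S"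
      using elim(2) by (simp add: algebra_simps)
    then show ?case using elim(1) by simp
  qed
  then have "(\<integral>\<^sup>+S. region_delay 0 (real (Suc n) *\<^sub>R d) S \<partial>law) \<le> (\<integral>\<^sup>+S. region_delay 0 (real n *\<^sub>R d) S + region_delay 0 d ((shift ^^ n) S) \<partial>law)"
    by (rule nn_integral_mono_AE)
  also have "\<dots> = (\<integral>\<^sup>+S. region_delay 0 (real n *\<^sub>R d) S \<partial>law) + (\<integral>\<^sup>+S. region_delay 0 d S \<partial>law)"
    by (subst nn_integral_add) (simp_all add: law.nn_integral_iterate)
  also have "\<dots> < \<infinity>" using Suc region_delay_integral_finite[of d] d by simp
  finally show ?case .
qed

lemma mean_delay_eq:
  assumes \<omega>: "\<omega> \<in> space M" and i: "nearest (\<lambda>i. X i \<omega>) x = X i \<omega>" and j: "nearest (\<lambda>i. X i \<omega>) y = X j \<omega>"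
  shows "mean_delay M path_loss T X e W F x y \<omega> = mean_hops (\<lambda>i. X i \<omega>) i j"
proof -
  have inj: "inj (\<lambda>i. X i \<omega>)" using X_bij[OF \<omega>] by (simp add: bij_betw_def)
  have [measurable]: "(\<lambda>\<omega>. (e \<omega>, W \<omega>, F \<omega>)) \<in> M \<rightarrow>\<^sub>M K" using marks_indep by (simp add: indep_of_process_def)
  have "mean_delay M path_loss T X e W F x y \<omega> = (\<integral>\<^sup>+\<omega>'. delay path_loss T (\<lambda>i. X i \<omega>) (e \<omega>', W \<omega>', F \<omega>') 0 i j \<partial>M)"
    unfolding mean_delay_def by (intro nn_integral_cong path_delay_eq_delay inj i j)
  also have "\<dots> = (\<integral>\<^sup>+mk. delay path_loss T (\<lambda>i. X i \<omega>) mk 0 i j \<partial>distr M K (\<lambda>\<omega>. (e \<omega>, W \<omega>, F \<omega>)))"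
    by (rule nn_integral_distr[symmetric]) simp_all
  finally show ?thesis by (simp add: marks_distr mean_hops_def)
qed

text \<open>
The first inequality holds since the nearest points of \<open>0\<close> and \<open>t d\<close> lie in the balls around \<open>0\<close> and
\<open>n d\<close>. For the second, any two points of these balls are joined via those nearest points.
\<close>

lemma mean_delay_bounds:
  assumes \<omega>: "\<omega> \<in> space M" and t: "0 \<le> t" and n: "n = nat \<lfloor>t\<rfloor>"
  shows "mean_delay M path_loss T X e W F 0 (t *\<^sub>R d) \<omega> \<le> region_delay 0 (real n *\<^sub>R d) (\<Phi> \<omega>)"
    and "region_delay 0 (real n *\<^sub>R d) (\<Phi> \<omega>) \<le> region_delay 0 0 (\<Phi> \<omega>) + mean_delay M path_loss T X e W F 0 (t *\<^sub>R d) \<omega> + region_delay (real n *\<^sub>R d) (real n *\<^sub>R d) (\<Phi> \<omega>)"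
proof -
  let ?X = "\<lambda>i. X i \<omega>" and ?y = "real n *\<^sub>R d"
  obtain i where i: "nearest ?X 0 = X i \<omega>" "X i \<omega> \<in> cball 0 (2 * s)" using nearest_X[OF \<omega>] by blast
  obtain j where j: "nearest ?X (t *\<^sub>R d) = X j \<omega>" "X j \<omega> \<in> cball (t *\<^sub>R d) (2 * s)" using nearest_X[OF \<omega>] by blast
  have D: "mean_delay M path_loss T X e W F 0 (t *\<^sub>R d) \<omega> = mean_hops ?X i j" by (rule mean_delay_eq[OF \<omega> i(1) j(1)])
  have i': "X i \<omega> \<in> cball 0 radius" using i(2) by (simp add: radius_def)
  have "dist ?y (t *\<^sub>R d) = \<bar>real n - t\<bar>" using d by (simp add: dist_norm scaleR_diff_left[symmetric])
  also have "\<dots> \<le> 1" using t n by linarith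
  finally have j': "X j \<omega> \<in> cball ?y radius"
    using j(2) dist_triangle[of ?y "X j \<omega>" "t *\<^sub>R d"] by (simp add: radius_def)
  show "mean_delay M path_loss T X e W F 0 (t *\<^sub>R d) \<omega> \<le> region_delay 0 ?y (\<Phi> \<omega>)"
    unfolding D region_delay_def pts_\<Phi>[OF \<omega>] using i' j' by (rule mean_hops_le_max_hops)
  show "region_delay 0 ?y (\<Phi> \<omega>) \<le> region_delay 0 0 (\<Phi> \<omega>) + mean_delay M path_loss T X e W F 0 (t *\<^sub>R d) \<omega> + region_delay ?y ?y (\<Phi> \<omega>)"
    unfolding D region_delay_def pts_\<Phi>[OF \<omega>]
  proof (rule max_hops_least)
    fix a b assume a: "X a \<omega> \<in> cball 0 radius" and b: "X b \<omega> \<in> cball ?y radius"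
    have "mean_hops ?X a b \<le> mean_hops ?X a i + mean_hops ?X i b" by (rule mean_hops_triangle)
    also have "\<dots> \<le> mean_hops ?X a i + (mean_hops ?X i j + mean_hops ?X j b)" by (intro add_left_mono mean_hops_triangle)
    also have "\<dots> \<le> max_hops radius ?X 0 0 + (mean_hops ?X i j + max_hops radius ?X ?y ?y)"
      using a b i' j' by (intro add_mono mean_hops_le_max_hops order_refl)
    finally show "mean_hops ?X a b \<le> max_hops radius ?X 0 0 + mean_hops ?X i j + max_hops radius ?X ?y ?y" by (simp add: add.assoc)
  qed
qed


text \<open>
The subadditive process; its value at time \<open>0\<close> is set to \<open>0\<close>, as the ergodic theorem requires.
\<close>

definition g :: "nat \<Rightarrow> (real^2) set \<Rightarrow> real" where
  "g n S = (if n = 0 then 0 else enn2real (region_delay 0 (real n *\<^sub>R d) S))"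

definition b :: "(real^2) set \<Rightarrow> real" where
  "b S = enn2real (region_delay 0 0 S)"

lemma g_nonneg: "0 \<le> g n S" by (simp add: g_def)
lemma b_nonneg: "0 \<le> b S" by (simp add: b_def)

lemma integrable_region_delay: "integrable law (\<lambda>S. enn2real (region_delay 0 (real n *\<^sub>R d) S))"
proof (rule integrableI_nonneg)
  have "(\<integral>\<^sup>+S. ennreal (enn2real (region_delay 0 (real n *\<^sub>R d) S)) \<partial>law) \<le> (\<integral>\<^sup>+S. region_delay 0 (real n *\<^sub>R d) S \<partial>law)"
    by (rule nn_integral_mono) (simp add: ennreal_enn2real_if)
  also have "\<dots> < \<infinity>" by (rule region_delay_integral_finite_iterate)
  finally show "(\<integral>\<^sup>+S. ennreal (enn2real (region_delay 0 (real n *\<^sub>R d) S)) \<partial>law) < \<infinity>" .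
qed auto

lemma g_integrable: "integrable law (g n)"
proof (cases "n = 0")
  case True
  then show ?thesis by (simp add: g_def[abs_def])
next
  case False
  then show ?thesis using integrable_region_delay[of n] by (simp add: g_def[abs_def])
qed

lemma b_integrable: "integrable law b"
  using integrable_region_delay[of 0] by (simp add: b_def[abs_def])

lemma AE_region_delay_finite: "AE S in law. \<forall>k n. region_delay 0 (real n *\<^sub>R d) ((shift ^^ k) S) \<noteq> \<infinity>"
proof (rule law.AE_iterate, subst AE_all_countable, rule allI)
  fix n
  show "AE S in law. region_delay 0 (real n *\<^sub>R d) S \<noteq> \<infinity>"
    using region_delay_integral_finite_iterate[of n] by (intro nn_integral_PInf_AE) auto
qed

lemma g_subadditive: "AE S in law. \<forall>m n. g (m + n) S \<le> g m S + g n ((shift ^^ m) S)"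
  using AE_region_delay_finite AE_region_delay_shift AE_region_delay_triangle
proof eventually_elim
  case (elim S)
  show ?case
  proof (intro allI)
    fix m n
    show "g (m + n) S \<le> g m S + g n ((shift ^^ m) S)"
    proof (cases "m = 0 \<or> n = 0")
      case True
      then show ?thesis by (auto simp: g_def)
    next
      case False
      have fin: "region_delay 0 (real m *\<^sub>R d) S \<noteq> \<infinity>" "region_delay 0 (real n *\<^sub>R d) ((shift ^^ m) S) \<noteq> \<infinity>"
        using elim(1)[rule_format, of m 0] elim(1)[rule_format, of n m] by auto
      have "region_delay 0 (real (m + n) *\<^sub>R d) S \<le> region_delay 0 (real m *\<^sub>R d) S + region_delay (real m *\<^sub>R d) (real (m + n) *\<^sub>R d) S"
        using elim(3) by blast
      also have "region_delay (real m *\<^sub>R d) (real (m + n) *\<^sub>R d) S = region_delay 0 (real n *\<^sub>R d) ((shift ^^ m) S)"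
        using elim(2) by (simp add: algebra_simps)
      finally have "enn2real (region_delay 0 (real (m + n) *\<^sub>R d) S) \<le> enn2real (region_delay 0 (real m *\<^sub>R d) S + region_delay 0 (real n *\<^sub>R d) ((shift ^^ m) S))"
        using fin by (intro enn2real_mono) (auto simp: less_top)
      also have "\<dots> = enn2real (region_delay 0 (real m *\<^sub>R d) S) + enn2real (region_delay 0 (real n *\<^sub>R d) ((shift ^^ m) S))"
        using fin by (intro enn2real_plus) (auto simp: less_top)
      finally show ?thesis using False by (simp add: g_def)
    qed
  qed
qed

text \<open>
The distance of \<open>g n / n\<close> from \<open>\<kappa>\<close>, the change when \<open>n\<close> is replaced by a real \<open>t\<close> with
\<open>\<lfloor>t\<rfloor> = n\<close> in the denominator, and the two local terms of \<open>mean_delay_bounds\<close>.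
\<close>

definition err :: "((real^2) set \<Rightarrow> real) \<Rightarrow> nat \<Rightarrow> (real^2) set \<Rightarrow> real" where
  "err \<kappa> n S = \<bar>g n S / n - \<kappa> S\<bar> + g n S / n / n + (b S + b ((shift ^^ n) S)) / n"

lemma err_nonneg: "0 \<le> err \<kappa> n S"
  by (simp add: err_def g_nonneg b_nonneg)

lemma ratio_sandwich:
  fixes n :: nat and t k :: real
  assumes n: "1 \<le> n" "n \<le> t" "t \<le> n + 1" and le: "0 \<le> x" "x \<le> y" "y \<le> z + x" and z: "0 \<le> z"
  shows "\<bar>x / t - k\<bar> \<le> \<bar>y / n - k\<bar> + y / n / n + z / n"
proof -
  have t: "0 < t" "0 < real n" using n by auto
  have y: "0 \<le> y" using le by linarith
  have "x / t \<le> y / t" using le t by (intro divide_right_mono) auto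
  also have "\<dots> \<le> y / n" using n t y by (intro divide_left_mono) auto
  finally have up: "x / t \<le> y / n" .
  have "y / n - y / t = y * (t - n) / (n * t)" using t by (simp add: field_simps)
  also have "\<dots> \<le> y * 1 / (n * n)"
    using n t y by (intro frac_le mult_left_mono mult_nonneg_nonneg) auto
  finally have "y / n - y / t \<le> y / n / n" by simp
  moreover have "y / t - x / t \<le> z / n"
  proof -
    have "y / t - x / t = (y - x) / t" by (simp add: diff_divide_distrib)
    also have "\<dots> \<le> z / n" using le n t z by (intro frac_le) auto
    finally show ?thesis .
  qed
  ultimately have "y / n - x / t \<le> y / n / n + z / n" by linarith
  then show ?thesis using up by linarith
qed

text \<open>
A single null set serves all \<open>t\<close>, since it comes from countably many conditions on the
\<open>region_delay\<close> at the points \<open>n d\<close>.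
\<close>

lemma AE_delay_ratio_error:
  "AE \<omega> in M. \<forall>t\<ge>1. mean_delay M path_loss T X e W F 0 (t *\<^sub>R d) \<omega> \<noteq> \<infinity> \<and>
     \<bar>enn2real (mean_delay M path_loss T X e W F 0 (t *\<^sub>R d) \<omega>) / t - \<kappa> (\<Phi> \<omega>)\<bar> \<le> err \<kappa> (nat \<lfloor>t\<rfloor>) (\<Phi> \<omega>)"
  using AE_lawD[OF AE_region_delay_finite] AE_lawD[OF AE_region_delay_shift] AE_space
proof eventually_elim
  case (elim \<omega>)
  show ?case
  proof (intro allI impI)
    fix t :: real assume t: "1 \<le> t"
    define n where "n = nat \<lfloor>t\<rfloor>"
    have n: "1 \<le> n" "n \<le> t" "t \<le> n + 1" using t unfolding n_def by linarith+
    let ?p = "mean_delay M path_loss T X e W F 0 (t *\<^sub>R d) \<omega>" and ?S = "\<Phi> \<omega>"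
    have fin: "region_delay 0 (real m *\<^sub>R d) ?S \<noteq> \<infinity>" "region_delay 0 (real m *\<^sub>R d) ((shift ^^ k) ?S) \<noteq> \<infinity>" for m k
      using elim(1)[rule_format, of m 0] elim(1)[rule_format, of m k] by auto
    have le: "?p \<le> region_delay 0 (real n *\<^sub>R d) ?S" "region_delay 0 (real n *\<^sub>R d) ?S \<le> region_delay 0 0 ?S + ?p + region_delay 0 0 ((shift ^^ n) ?S)"
      using mean_delay_bounds[OF elim(3) _ n_def] t elim(2) by auto
    have f0: "region_delay 0 0 ?S \<noteq> \<infinity>" "region_delay 0 0 ((shift ^^ n) ?S) \<noteq> \<infinity>" using fin(1)[of 0] fin(2)[of 0 n] by auto
    have pfin: "?p \<noteq> \<infinity>" using le(1) fin(1)[of n] by (auto simp: top_unique)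
    have g: "g n ?S = enn2real (region_delay 0 (real n *\<^sub>R d) ?S)" using n by (simp add: g_def)
    have "enn2real ?p \<le> g n ?S" unfolding g using le(1) fin(1)[of n] by (intro enn2real_mono) (auto simp: less_top)
    moreover have "g n ?S \<le> (b ?S + b ((shift ^^ n) ?S)) + enn2real ?p"
    proof -
      have "g n ?S \<le> enn2real (region_delay 0 0 ?S + ?p + region_delay 0 0 ((shift ^^ n) ?S))"
        unfolding g using le(2) f0 pfin by (intro enn2real_mono) (auto simp: less_top)
      also have "\<dots> = enn2real (region_delay 0 0 ?S) + enn2real ?p + enn2real (region_delay 0 0 ((shift ^^ n) ?S))"
        using f0 pfin by (simp add: enn2real_plus less_top)
      finally show ?thesis by (simp add: b_def)
    qed
    ultimately have "\<bar>enn2real ?p / t - \<kappa> ?S\<bar> \<le> err \<kappa> n ?S"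
      unfolding err_def by (intro ratio_sandwich n) (auto simp: b_nonneg)
    then show "?p \<noteq> \<infinity> \<and> \<bar>enn2real ?p / t - \<kappa> ?S\<bar> \<le> err \<kappa> (nat \<lfloor>t\<rfloor>) ?S" using pfin by (simp add: n_def)
  qed
qed

lemma filterlim_nat_floor: "filterlim (\<lambda>t::real. nat \<lfloor>t\<rfloor>) at_top at_top"
  unfolding filterlim_at_top
proof
  fix Z :: nat
  show "\<forall>\<^sub>F t::real in at_top. Z \<le> nat \<lfloor>t\<rfloor>"
    using eventually_ge_at_top[of "real Z"] by eventually_elim linarith
qed

text \<open>
The error \<open>err\<close> does not involve \<open>t\<close> but only \<open>\<lfloor>t\<rfloor>\<close>. It tends to \<open>0\<close> almost surely and in mean, and this gives both
modes of convergence along the reals.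
\<close>

theorem time_constant_exists:
  "\<exists>\<kappa> :: 'w \<Rightarrow> real.
     (\<forall>\<omega>\<in>space M. 0 \<le> \<kappa> \<omega>) \<and>
     (AE \<omega> in M. ((\<lambda>t. mean_delay M path_loss T X e W F 0 (t *\<^sub>R d) \<omega> / ennreal t)
                     \<longlongrightarrow> ennreal (\<kappa> \<omega>)) at_top) \<and>
     integrable M \<kappa> \<and>
     ((\<lambda>t. \<integral>\<^sup>+\<omega>. e2ennreal
              \<bar>enn2ereal (mean_delay M path_loss T X e W F 0 (t *\<^sub>R d) \<omega> / ennreal t)
                 - ereal (\<kappa> \<omega>)\<bar> \<partial>M)
        \<longlongrightarrow> 0) at_top"
proof -
  obtain \<kappa> where \<kappa>_int: "integrable law \<kappa>" and \<kappa>0: "\<And>S. 0 \<le> \<kappa> S"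
    and conv: "AE S in law. (\<lambda>n. g n S / n) \<longlonglongrightarrow> \<kappa> S"
    and L1: "(\<lambda>n. \<integral>S. \<bar>g n S / n - \<kappa> S\<bar> \<partial>law) \<longlonglongrightarrow> 0"
    using law.subadditive_ergodic[of g, OF g_integrable g_nonneg _ g_subadditive] by (auto simp: g_def)
  have bn_int: "integrable law (\<lambda>S. b ((shift ^^ n) S))" for n by (rule law.integrable_iterate[OF b_integrable])
  have gn_int: "integrable law (\<lambda>S. \<bar>g n S / n - \<kappa> S\<bar>)" for n using g_integrable[of n] \<kappa>_int by auto
  have err_int: "integrable law (err \<kappa> n)" for n
    unfolding err_def[abs_def] using gn_int[of n] g_integrable[of n] b_integrable bn_int[of n] by auto
  have inv0: "(\<lambda>n. c / real n) \<longlonglongrightarrow> 0" for c by (rule tendsto_divide_0[OF tendsto_const]) (rule filterlim_at_top_imp_at_infinity[OF filterlim_real_sequentially])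
  have err_conv: "AE S in law. (\<lambda>n. err \<kappa> n S) \<longlonglongrightarrow> 0"
    using conv law.iterate_over_time_tendsto_0[OF b_integrable b_nonneg]
  proof eventually_elim
    case (elim S)
    have "(\<lambda>n. \<bar>g n S / n - \<kappa> S\<bar> + g n S / n * (1 / n) + (b S / n + b ((shift ^^ n) S) / n)) \<longlonglongrightarrow> \<bar>\<kappa> S - \<kappa> S\<bar> + \<kappa> S * 0 + (0 + 0)"
      by (intro tendsto_intros elim inv0)
    then show ?case by (simp add: err_def add_divide_distrib)
  qed
  let ?I = "\<lambda>n. \<integral>S. \<bar>g n S / n - \<kappa> S\<bar> \<partial>law"
  have err_L1: "(\<lambda>n. \<integral>S. err \<kappa> n S \<partial>law) \<longlonglongrightarrow> 0"
  proof (rule tendsto_sandwich[OF _ _ tendsto_const])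
    show "\<forall>\<^sub>F n in sequentially. 0 \<le> (\<integral>S. err \<kappa> n S \<partial>law)"
      by (intro always_eventually allI integral_nonneg_AE AE_I2 err_nonneg)
    let ?B = "\<lambda>n::nat. ?I n + ((\<integral>S. \<kappa> S \<partial>law) + ?I n) * (1 / n) + (2 * (\<integral>S. b S \<partial>law)) / n"
    show "\<forall>\<^sub>F n in sequentially. (\<integral>S. err \<kappa> n S \<partial>law) \<le> ?B n"
    proof (intro always_eventually allI)
      fix n :: nat
      have "(\<integral>S. err \<kappa> n S \<partial>law) \<le> (\<integral>S. \<bar>g n S / n - \<kappa> S\<bar> + (\<kappa> S + \<bar>g n S / n - \<kappa> S\<bar>) * (1 / n) + (b S + b ((shift ^^ n) S)) * (1 / n) \<partial>law)"
      proof (rule integral_mono)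
        show "integrable law (\<lambda>S. \<bar>g n S / n - \<kappa> S\<bar> + (\<kappa> S + \<bar>g n S / n - \<kappa> S\<bar>) * (1 / n) + (b S + b ((shift ^^ n) S)) * (1 / n))"
          by (intro Bochner_Integration.integrable_add integrable_mult_left gn_int \<kappa>_int b_integrable bn_int)
        fix S
        have "g n S / n \<le> \<kappa> S + \<bar>g n S / n - \<kappa> S\<bar>" by linarith
        then have "g n S / n * (1 / n) \<le> (\<kappa> S + \<bar>g n S / n - \<kappa> S\<bar>) * (1 / n)" by (rule mult_right_mono) simp
        then show "err \<kappa> n S \<le> \<bar>g n S / n - \<kappa> S\<bar> + (\<kappa> S + \<bar>g n S / n - \<kappa> S\<bar>) * (1 / n) + (b S + b ((shift ^^ n) S)) * (1 / n)"
          by (simp add: err_def)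
      qed (rule err_int)
      also have "\<dots> = ?I n + ((\<integral>S. \<kappa> S \<partial>law) + ?I n) * (1 / n) + ((\<integral>S. b S \<partial>law) + (\<integral>S. b ((shift ^^ n) S) \<partial>law)) * (1 / n)"
        using gn_int[of n] \<kappa>_int b_integrable bn_int[of n]
        by (simp only: Bochner_Integration.integral_add Bochner_Integration.integrable_add integrable_mult_left integral_mult_left_zero)
      also have "(\<integral>S. b ((shift ^^ n) S) \<partial>law) = (\<integral>S. b S \<partial>law)"
        by (rule law.integral_iterate) (use b_integrable in auto)
      finally show "(\<integral>S. err \<kappa> n S \<partial>law) \<le> ?B n" by simp
    qed
    have "?B \<longlonglongrightarrow> 0 + ((\<integral>S. \<kappa> S \<partial>law) + 0) * 0 + 0" by (intro tendsto_intros L1 inv0)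
    then show "?B \<longlonglongrightarrow> 0" by simp
  qed
  define \<kappa>' where "\<kappa>' \<omega> = \<kappa> (\<Phi> \<omega>)" for \<omega>
  let ?p = "\<lambda>t \<omega>. mean_delay M path_loss T X e W F 0 (t *\<^sub>R d) \<omega>"
  note ratio = AE_delay_ratio_error[of \<kappa>]
  have "integrable M \<kappa>'"
    unfolding \<kappa>'_def using \<kappa>_int unfolding law_def by (rule integrable_distr[rotated]) simp
  moreover have "AE \<omega> in M. ((\<lambda>t. ?p t \<omega> / ennreal t) \<longlongrightarrow> ennreal (\<kappa>' \<omega>)) at_top"
    using ratio AE_lawD[OF err_conv]
  proof eventually_elim
    case (elim \<omega>)
    have e0: "((\<lambda>t::real. err \<kappa> (nat \<lfloor>t\<rfloor>) (\<Phi> \<omega>)) \<longlongrightarrow> 0) at_top"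
      using filterlim_compose[OF elim(2) filterlim_nat_floor] .
    have "((\<lambda>t. enn2real (?p t \<omega>) / t - \<kappa>' \<omega>) \<longlongrightarrow> 0) at_top"
    proof (rule Lim_null_comparison[OF _ e0])
      show "\<forall>\<^sub>F t in at_top. norm (enn2real (?p t \<omega>) / t - \<kappa>' \<omega>) \<le> err \<kappa> (nat \<lfloor>t\<rfloor>) (\<Phi> \<omega>)"
        using eventually_ge_at_top[of 1] by eventually_elim (use elim(1) in \<open>simp add: \<kappa>'_def\<close>)
    qed
    then have "((\<lambda>t. enn2real (?p t \<omega>) / t) \<longlongrightarrow> \<kappa>' \<omega>) at_top" by (rule Lim_null[THEN iffD2])
    then have "((\<lambda>t. ennreal (enn2real (?p t \<omega>) / t)) \<longlongrightarrow> ennreal (\<kappa>' \<omega>)) at_top" by (rule tendsto_ennrealI)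
    moreover have "\<forall>\<^sub>F t in at_top. ennreal (enn2real (?p t \<omega>) / t) = ?p t \<omega> / ennreal t"
      using eventually_ge_at_top[of 1]
    proof eventually_elim
      case (elim t)
      have "?p t \<omega> \<noteq> \<infinity>" using \<open>\<forall>t\<ge>1. _ t\<close> elim by blast
      then obtain q where "?p t \<omega> = ennreal q" "0 \<le> q" by (cases "?p t \<omega>") auto
      then show ?case using elim by (simp add: divide_ennreal)
    qed
    ultimately show ?case by (rule Lim_transform_eventually)
  qed
  moreover have "((\<lambda>t. \<integral>\<^sup>+\<omega>. e2ennreal \<bar>enn2ereal (?p t \<omega> / ennreal t) - ereal (\<kappa>' \<omega>)\<bar> \<partial>M) \<longlongrightarrow> 0) at_top"
  proof (rule tendsto_sandwich[OF _ _ tendsto_const])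
    show "\<forall>\<^sub>F t in at_top. (\<integral>\<^sup>+\<omega>. e2ennreal \<bar>enn2ereal (?p t \<omega> / ennreal t) - ereal (\<kappa>' \<omega>)\<bar> \<partial>M)
        \<le> ennreal (\<integral>S. err \<kappa> (nat \<lfloor>t\<rfloor>) S \<partial>law)"
      using eventually_ge_at_top[of 1]
    proof eventually_elim
      case (elim t)
      let ?n = "nat \<lfloor>t\<rfloor>"
      have "AE \<omega> in M. e2ennreal \<bar>enn2ereal (?p t \<omega> / ennreal t) - ereal (\<kappa>' \<omega>)\<bar> \<le> ennreal (err \<kappa> ?n (\<Phi> \<omega>))"
        using ratio
      proof eventually_elim
        case (elim \<omega>)
        have fin: "?p t \<omega> \<noteq> \<infinity>" and le: "\<bar>enn2real (?p t \<omega>) / t - \<kappa>' \<omega>\<bar> \<le> err \<kappa> ?n (\<Phi> \<omega>)"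
          using elim \<open>1 \<le> t\<close> by (auto simp: \<kappa>'_def)
        obtain q where q: "?p t \<omega> = ennreal q" "0 \<le> q" using fin by (cases "?p t \<omega>") auto
        have "enn2ereal (?p t \<omega> / ennreal t) = ereal (q / t)"
          using q \<open>1 \<le> t\<close> by (simp add: divide_ennreal enn2ereal_ennreal)
        then have "e2ennreal \<bar>enn2ereal (?p t \<omega> / ennreal t) - ereal (\<kappa>' \<omega>)\<bar> = ennreal \<bar>q / t - \<kappa>' \<omega>\<bar>"
          by (simp add: e2ennreal_ereal)
        also have "\<dots> \<le> ennreal (err \<kappa> ?n (\<Phi> \<omega>))" using le q by (intro ennreal_leI) simp
        finally show ?case .
      qed
      then have "(\<integral>\<^sup>+\<omega>. e2ennreal \<bar>enn2ereal (?p t \<omega> / ennreal t) - ereal (\<kappa>' \<omega>)\<bar> \<partial>M) \<le> (\<integral>\<^sup>+\<omega>. ennreal (err \<kappa> ?n (\<Phi> \<omega>)) \<partial>M)"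
        by (rule nn_integral_mono_AE)
      also have "\<dots> = (\<integral>\<^sup>+S. ennreal (err \<kappa> ?n S) \<partial>law)"
      proof (rule nn_integral_law[symmetric])
        have "err \<kappa> ?n \<in> borel_measurable conf"
          using borel_measurable_integrable[OF err_int[of ?n]] by (subst (asm) measurable_cong_sets[OF sets_law refl])
        then show "(\<lambda>S. ennreal (err \<kappa> ?n S)) \<in> borel_measurable conf" by measurable
      qed
      also have "\<dots> = ennreal (\<integral>S. err \<kappa> ?n S \<partial>law)"
        by (rule nn_integral_eq_integral[OF err_int]) (simp add: err_nonneg)
      finally show ?case .
    qed
    have "((\<lambda>t::real. \<integral>S. err \<kappa> (nat \<lfloor>t\<rfloor>) S \<partial>law) \<longlongrightarrow> 0) at_top"
      by (rule filterlim_compose[OF err_L1 filterlim_nat_floor])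
    then have "((\<lambda>t::real. ennreal (\<integral>S. err \<kappa> (nat \<lfloor>t\<rfloor>) S \<partial>law)) \<longlongrightarrow> ennreal 0) at_top" by (rule tendsto_ennrealI)
    then show "((\<lambda>t::real. ennreal (\<integral>S. err \<kappa> (nat \<lfloor>t\<rfloor>) S \<partial>law)) \<longlongrightarrow> 0) at_top" by simp
  qed simp
  moreover have "\<forall>\<omega>\<in>space M. 0 \<le> \<kappa>' \<omega>" by (simp add: \<kappa>'_def \<kappa>0)
  ultimately show ?thesis by blast
qed

end

theorem proposition3p4:
  fixes M :: "'w measure"
    and \<Phi>\<^sub>M \<Phi> :: "'w \<Rightarrow> (real^2) set" and U :: "'w \<Rightarrow> real^2"
    and X :: "nat \<Rightarrow> 'w \<Rightarrow> real^2"
    and e :: "'w \<Rightarrow> nat \<times> int \<Rightarrow> bool" and W :: "'w \<Rightarrow> nat \<times> int \<Rightarrow> real"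
    and F :: "'w \<Rightarrow> nat \<times> nat \<times> int \<Rightarrow> real"
    and \<W> :: "real measure"
    and intensity s p T \<mu> A \<beta> :: real and d :: "real^2"
  assumes "prob_space M"
    and "0 < intensity" and "poisson_process M intensity \<Phi>\<^sub>M"
    and "0 < s" and "U \<in> borel_measurable M"
    and "distr M borel U = uniform_measure lborel (cbox 0 (\<chi> i. s))"
    and "indep_of_process M \<Phi>\<^sub>M borel U"
    and "\<And>\<omega>. \<omega> \<in> space M \<Longrightarrow> \<Phi> \<omega> = \<Phi>\<^sub>M \<omega> \<union> shifted_grid s (U \<omega>)"
    and "\<And>i. X i \<in> borel_measurable (process_algebra M \<Phi>)"
    and "\<And>\<omega>. \<omega> \<in> space M \<Longrightarrow> bij_betw (\<lambda>i. X i \<omega>) UNIV (\<Phi> \<omega>)"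
    and "0 < p" and "p < 1"
    and "prob_space \<W>" and "sets \<W> = sets borel" and "AE w in \<W>. 0 \<le> w"
    and "0 < \<mu>"
    and "distr M (marks_law p \<W> (density lborel (exponential_density \<mu>))) (\<lambda>\<omega>. (e \<omega>, W \<omega>, F \<omega>))
           = marks_law p \<W> (density lborel (exponential_density \<mu>))"
    and "indep_of_process M \<Phi> (marks_law p \<W> (density lborel (exponential_density \<mu>)))
           (\<lambda>\<omega>. (e \<omega>, W \<omega>, F \<omega>))"
    and "0 < T" and "0 < A" and "2 < \<beta>"
    and "norm d = 1"
  shows "\<exists>\<kappa> :: 'w \<Rightarrow> real.
     (\<forall>\<omega>\<in>space M. 0 \<le> \<kappa> \<omega>) \<and>
     (AE \<omega> in M. ((\<lambda>t. mean_delay M (\<lambda>r. (A * r) powr \<beta>) T X e W F 0 (t *\<^sub>R d) \<omega> / ennreal t)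
                     \<longlongrightarrow> ennreal (\<kappa> \<omega>)) at_top) \<and>
     integrable M \<kappa> \<and>
     ((\<lambda>t. \<integral>\<^sup>+\<omega>. e2ennreal
              \<bar>enn2ereal (mean_delay M (\<lambda>r. (A * r) powr \<beta>) T X e W F 0 (t *\<^sub>R d) \<omega> / ennreal t)
                 - ereal (\<kappa> \<omega>)\<bar> \<partial>M)
        \<longlongrightarrow> 0) at_top"
proof -
  note prem = assms
  interpret prob_space M by fact
  interpret sinr_exponential p \<W> \<mu> T A \<beta>
    by (rule sinr_exponential.intro) (use prem in simp_all)
  interpret poisson_grid_network p \<W> \<mu> T A \<beta> M \<Phi>\<^sub>M \<Phi> U X e W F intensity s d
    by unfold_locales (use prem in simp_all)
  show ?thesis by (rule time_constant_exists)
qed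

end
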